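(* Let $I=[0,T]$, $T>0$, let $E$ be a Banach space and let $A\colon D(A)\subset E\to E$ be a (closed, densely defined) linear operator which is the infinitesimal generator of a $C_0$-semigroup $\{U(t)\}_{t\ge0}$ on $E$. Put $M:=\sup_{t\in I}\|U(t)\|_{\mathcal L}$. Let $F\colon I\times E\multimap E$ satisfy: (1) for every $(t,x)\in I\times E$ the set $F(t,x)$ is nonempty and convex; (2) $F(\cdot,x)$ has a strongly measurable selection for every $x\in E$; (3) for a.a. $t\in I$ the graph of $F(t,\cdot)$ is sequentially closed in $(E,|\cdot|)\times(E,w)$, where $w$ is the weak topology; (4) there is $\mu\in L^1(I,\mathbb R)$ such that $\sup\{|y|:y\in F(t,x)\}\le\mu(t)(1+|x|)$ for all $x\in E$ and a.a. $t\in I$; (5) there is $\eta\in L^1(I,\mathbb R)$ such that for all bounded $\Omega\subset E$ and a.a. $t\in I$, $\beta(F(t,\Omega))\le\eta(t)\beta(\Omega)$. Let $g\colon C(I,E)\to E$ be $L$-Lipschitz and suppose there is $k>0$ such that $\beta(g(\Omega))\le k\sup_{t\in I}\beta(\Omega(t))$ for every bounded $\Omega\subset C(I,E)$. Assume also that there exists $r>0$ such that $$0<\|\mu\|_1<M^{-1}\ln\left(\frac{1+r}{1+M(Lr+|g(0)|)}\right).$$ Then the problem $$\dot x(t)\in Ax(t)+F(t,x(t))\ \text{ on } I,\qquad x(0)=g(x),$$ possesses a mild solution in each of the following cases: (i) $M(k+\|\eta\|_1)<1$ and $E$ has property $\mathcal S$; (ii) $M(k+4\|\eta\|_1)<1$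 and $E$ is an arbitrary Banach space.
   Context: $\multimap$ denotes set-valued maps; $F(t,\Omega)=\bigcup_{x\in\Omega}F(t,x)$; $\Omega(t)=\{x(t):x\in\Omega\}$. $C(I,E)$ carries the maximum norm. $\beta$ is the Hausdorff measure of non-compactness on $E$: $\beta(\Omega)$ is the infimum of $\varepsilon>0$ such that $\Omega$ is covered by finitely many balls of radius $\varepsilon$ with centers in $E$. $E$ has property $\mathcal S$ if for every separable subspace $X\subset E$ there exist a separable subspace $Y$ of $E$ with $X\subset Y$ and a continuous linear projection $P\colon E\to Y$ of norm $1$. A mild solution is $x\in C(I,E)$ for which there is $f\in L^1(I,E)$ with $f(t)\in F(t,x(t))$ for a.a. $t\in I$ and $x(t)=U(t)g(x)+\int_0^tU(t-s)f(s)\,ds$ for all $t\in I$. *)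

theory Defs
  imports "HOL-Analysis.Analysis"
begin

section \<open>Strong measurability and the Bochner integral in arbitrary Banach spaces\<close>

text \<open>
  The Bochner integral of HOL-Analysis is restricted to second countable spaces, where Borel and
  strong measurability coincide. The definitions below follow the same pattern, with strong
  measurability in place of Borel measurability and without any separability assumption. They are
  meant for complete measures such as \<open>lebesgue_on {a..b}\<close>.
\<close>

definition strongly_measurable :: "'a measure \<Rightarrow> ('a \<Rightarrow> 'b::banach) \<Rightarrow> bool" where
  "strongly_measurable M f \<longleftrightarrow>
     (\<exists>s :: nat \<Rightarrow> 'a \<Rightarrow> 'b. (\<forall>i. simple_function M (s i)) \<and> (AE x in M. (\<lambda>i. s i x) \<longlonglongrightarrow> f x))"

definition L1_function :: "'a measure \<Rightarrow> ('a \<Rightarrow> 'b::banach) \<Rightarrow> bool" where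
  "L1_function M f \<longleftrightarrow> strongly_measurable M f \<and> (\<integral>\<^sup>+x. ennreal (norm (f x)) \<partial>M) < \<infinity>"

definition has_strong_bochner_integral :: "'a measure \<Rightarrow> ('a \<Rightarrow> 'b::banach) \<Rightarrow> 'b \<Rightarrow> bool" where
  "has_strong_bochner_integral M f v \<longleftrightarrow>
     strongly_measurable M f \<and>
     (\<exists>s :: nat \<Rightarrow> 'a \<Rightarrow> 'b.
        (\<forall>i. Bochner_Integration.simple_bochner_integrable M (s i)) \<and>
        (\<lambda>i. \<integral>\<^sup>+x. ennreal (norm (f x - s i x)) \<partial>M) \<longlonglongrightarrow> 0 \<and>
        (\<lambda>i. Bochner_Integration.simple_bochner_integral M (s i)) \<longlonglongrightarrow> v)"

section \<open>Weak topology and sequential closedness\<close>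

definition weak_topology :: "'a::real_normed_vector topology" where
  "weak_topology =
     topology_generated_by {blinfun_apply \<phi> -` V |(\<phi> :: 'a \<Rightarrow>\<^sub>L real) V. open V}"

definition sequentially_closedin :: "'a topology \<Rightarrow> 'a set \<Rightarrow> bool" where
  "sequentially_closedin X S \<longleftrightarrow>
     S \<subseteq> topspace X \<and>
     (\<forall>\<sigma> l. (\<forall>n::nat. \<sigma> n \<in> S) \<and> limitin X \<sigma> l sequentially \<longrightarrow> l \<in> S)"

lemma limitin_weak_topology:
  fixes f :: "'b \<Rightarrow> 'a::real_normed_vector"
  shows "limitin weak_topology f l F \<longleftrightarrow>
           (\<forall>\<phi> :: 'a \<Rightarrow>\<^sub>L real. ((\<lambda>x. blinfun_apply \<phi> (f x)) \<longlongrightarrow> blinfun_apply \<phi> l) F)"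
proof -
  let ?S = "{blinfun_apply \<phi> -` V |(\<phi> :: 'a \<Rightarrow>\<^sub>L real) V. open V}"
  have top: "topspace (weak_topology :: 'a topology) = UNIV"
    unfolding weak_topology_def topology_generated_by_topspace by (auto intro: exI[of _ UNIV])
  have sub: "openin weak_topology (blinfun_apply \<phi> -` V)" if "open V" for \<phi> :: "'a \<Rightarrow>\<^sub>L real" and V
    unfolding weak_topology_def by (rule topology_generated_by_Basis) (use that in auto)
  have gen: "l \<in> U \<longrightarrow> (\<forall>\<^sub>F x in F. f x \<in> U)"
    if lim: "\<forall>\<phi> :: 'a \<Rightarrow>\<^sub>L real. ((\<lambda>x. blinfun_apply \<phi> (f x)) \<longlongrightarrow> blinfun_apply \<phi> l) F"
      and "generate_topology_on ?S U" for U
    using that(2)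
  proof induction
    case (Int a b)
    then show ?case by (auto intro: eventually_conj)
  next
    case (UN K)
    show ?case
    proof
      assume "l \<in> \<Union> K"
      then obtain X where X: "X \<in> K" "l \<in> X" by auto
      with UN.IH have "\<forall>\<^sub>F x in F. f x \<in> X" by blast
      then show "\<forall>\<^sub>F x in F. f x \<in> \<Union> K"
        by (rule eventually_mono) (use X in auto)
    qed
  next
    case (Basis s)
    then obtain \<phi> :: "'a \<Rightarrow>\<^sub>L real" and V where "s = blinfun_apply \<phi> -` V" "open V" by auto
    then show ?case using lim topological_tendstoD[of "\<lambda>x. blinfun_apply \<phi> (f x)"] by auto
  qed auto
  show ?thesis
  proof
    assume L: "limitin weak_topology f l F"
    show "\<forall>\<phi> :: 'a \<Rightarrow>\<^sub>L real. ((\<lambda>x. blinfun_apply \<phi> (f x)) \<longlongrightarrow> blinfun_apply \<phi> l) F"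
    proof (intro allI topological_tendstoI)
      fix \<phi> :: "'a \<Rightarrow>\<^sub>L real" and V :: "real set"
      assume "open V" "blinfun_apply \<phi> l \<in> V"
      then have "\<forall>\<^sub>F x in F. f x \<in> blinfun_apply \<phi> -` V"
        using L sub[of V \<phi>] unfolding limitin_def by blast
      then show "\<forall>\<^sub>F x in F. blinfun_apply \<phi> (f x) \<in> V" by simp
    qed
  next
    assume "\<forall>\<phi> :: 'a \<Rightarrow>\<^sub>L real. ((\<lambda>x. blinfun_apply \<phi> (f x)) \<longlongrightarrow> blinfun_apply \<phi> l) F"
    from gen[OF this] show "limitin weak_topology f l F"
      unfolding limitin_def top
      by (auto simp: weak_topology_def openin_topology_generated_by_iff)
  qed
qed

section \<open>Hausdorff measure of non-compactness and property S\<close>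

text \<open>Extended real values are used so that unbounded sets have measure \<open>\<infinity>\<close>.\<close>

definition hausdorff_mnc :: "'a::real_normed_vector set \<Rightarrow> ereal" where
  "hausdorff_mnc \<Omega> =
     Inf {ereal \<epsilon> |\<epsilon>. \<epsilon> > 0 \<and> (\<exists>C. finite C \<and> \<Omega> \<subseteq> (\<Union>c\<in>C. ball c \<epsilon>))}"

definition property_S :: "'a::real_normed_vector itself \<Rightarrow> bool" where
  "property_S _ \<longleftrightarrow>
     (\<forall>X :: 'a set. subspace X \<and> separable_space (top_of_set X) \<longrightarrow>
       (\<exists>Y. subspace Y \<and> separable_space (top_of_set Y) \<and> X \<subseteq> Y \<and>
         (\<exists>P :: 'a \<Rightarrow>\<^sub>L 'a. range (blinfun_apply P) \<subseteq> Y \<and>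
            (\<forall>y\<in>Y. blinfun_apply P y = y) \<and> norm P = 1)))"

section \<open>Semigroups and their generators\<close>

text \<open>Only the values \<open>U t\<close> with \<open>t \<ge> 0\<close> are relevant.\<close>

definition C0_semigroup :: "(real \<Rightarrow> 'a::banach \<Rightarrow>\<^sub>L 'a) \<Rightarrow> bool" where
  "C0_semigroup U \<longleftrightarrow>
     U 0 = id_blinfun \<and>
     (\<forall>s\<ge>0. \<forall>t\<ge>0. U (s + t) = U s o\<^sub>L U t) \<and>
     (\<forall>x. ((\<lambda>t. blinfun_apply (U t) x) \<longlongrightarrow> x) (at_right 0))"

text \<open>An unbounded operator is a domain \<open>D\<close> together with a function that matters on \<open>D\<close> only.\<close>

definition closed_densely_defined_operator :: "'a::banach set \<Rightarrow> ('a \<Rightarrow> 'a) \<Rightarrow> bool" where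
  "closed_densely_defined_operator D A \<longleftrightarrow>
     subspace D \<and>
     (\<forall>x\<in>D. \<forall>y\<in>D. A (x + y) = A x + A y) \<and> (\<forall>c. \<forall>x\<in>D. A (c *\<^sub>R x) = c *\<^sub>R A x) \<and>
     closed {(x, A x) |x. x \<in> D} \<and>
     closure D = UNIV"

definition infinitesimal_generator ::
    "(real \<Rightarrow> 'a::banach \<Rightarrow>\<^sub>L 'a) \<Rightarrow> 'a set \<Rightarrow> ('a \<Rightarrow> 'a) \<Rightarrow> bool" where
  "infinitesimal_generator U D A \<longleftrightarrow>
     D = {x. \<exists>y. ((\<lambda>h. (blinfun_apply (U h) x - x) /\<^sub>R h) \<longlongrightarrow> y) (at_right 0)} \<and>
     (\<forall>x\<in>D. ((\<lambda>h. (blinfun_apply (U h) x - x) /\<^sub>R h) \<longlongrightarrow> A x) (at_right 0))"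

section \<open>The space of continuous functions and mild solutions\<close>

text \<open>
  The space \<open>C([0,T], E)\<close> with the supremum metric; its elements are extended by \<open>undefined\<close>
  outside the interval, so that they correspond uniquely to functions on the interval.
\<close>

abbreviation C_space :: "real \<Rightarrow> (real \<Rightarrow> 'a::banach) metric" where
  "C_space T \<equiv> cfunspace (top_of_set {0..T}) euclidean_metric"

definition mild_solution ::
    "real \<Rightarrow> (real \<Rightarrow> 'a::banach \<Rightarrow>\<^sub>L 'a) \<Rightarrow> (real \<Rightarrow> 'a \<Rightarrow> 'a set) \<Rightarrow> ((real \<Rightarrow> 'a) \<Rightarrow> 'a) \<Rightarrow>
     (real \<Rightarrow> 'a) \<Rightarrow> bool" where
  "mild_solution T U F g x \<longleftrightarrow>
     x \<in> mspace (C_space T) \<and>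
     (\<exists>f. L1_function (lebesgue_on {0..T}) f \<and>
          (AE t in lebesgue_on {0..T}. f t \<in> F t (x t)) \<and>
          (\<forall>t\<in>{0..T}. \<exists>v.
             has_strong_bochner_integral (lebesgue_on {0..t})
               (\<lambda>s. blinfun_apply (U (t - s)) (f s)) v \<and>
             x t = blinfun_apply (U t) (g x) + v))"

end

theory Submission
  imports Defs
begin

text \<open>
  Fix selections \<open>f\<^sub>j\<close> of \<open>F(\<cdot>, d\<^sub>j)\<close> for a sequence \<open>d\<^sub>j\<close> whose closure \<open>X\<close> is a separable subspace that is not
  left by the semigroup, by \<open>g\<close>, or by the \<open>f\<^sub>j\<close>. For \<open>\<epsilon> > 0\<close> let \<open>H\<^sub>\<epsilon>(x)\<close> be the set of all functions
  \<open>U(t) g(x) + \<integral>\<^sub>0\<^sup>t U(t - s) h(s) ds\<close> where \<open>h(s)\<close> is a convex combination of those \<open>f\<^sub>j(s)\<close> with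
  \<open>\<bar>x(s) - d\<^sub>j\<bar> < \<epsilon>\<close>. The smallness of \<open>\<mu>\<close> yields a bounded convex set invariant under \<open>H\<^sub>\<epsilon>\<close>, and since only
  countably many functions are involved, the conditions on \<open>F\<close> and \<open>g\<close> integrate to
  \<open>\<beta>(H\<^sub>\<epsilon>(\<Omega>)) \<le> q \<beta>(\<Omega>) + O(\<epsilon>)\<close> with \<open>q < 1\<close> in the space of continuous functions. This inequality is used
  twice. For fixed \<open>\<epsilon>\<close> it produces, by a Schauder projection and Brouwer's theorem, some \<open>x\<close> at distance
  \<open>O(\<epsilon>)\<close> from \<open>H\<^sub>\<epsilon>(x)\<close>; as \<open>\<epsilon> \<rightarrow> 0\<close> it shows that these approximate solutions form a relatively compact
  set. Convex combinations of the corresponding \<open>h\<close> converge almost everywhere, and the limit is a selection of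
  \<open>F(t, x(t))\<close> because \<open>F\<close> has convex values and a closed graph.
\<close>

section \<open>Covers by finitely many balls\<close>

text \<open>Selecting from F(t, x(t)) for each x separately would involve uncountably many null
  sets, a measurable selection theorem and weak compactness in L^1; the error \<epsilon> is the
  price for avoiding them. It is cheap, because \<rho> \<mapsto> q \<rho> + c drives every radius
  towards c / (1 - q), so no exact fixed point is needed before the limit. A pointwise compactness
  estimate is integrated as follows: at almost every s the relevant values lie within e(s) of
  finitely many points that do not depend on s, and the integral operator maps functions with values
  in a compact set to a totally bounded set. Independence of s requires centers from one fixed
  sequence, and this is the only source of the factor \<open>\<kappa>\<close>: a projection of norm
  one moves centers without loss, while choosing centers in the covered set doubles radii. The
  logarithm encodes a Gronwall bound: the solution of \<phi>(t) = c + M times the integral of \<mu>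
  \<phi> over [0, t], with c = 1 + M (L r + |g(0)|), stays below 1 + r. Strictness leaves room for a
  shift of c by a small \<open>\<epsilon>\<^sub>0\<close>.\<close>

text \<open>\<open>ball_cover A \<rho>\<close> says that the Hausdorff measure of non-compactness of \<open>A\<close> is at most \<open>\<rho>\<close>, up to an
  arbitrarily small enlargement of \<open>\<rho>\<close>.\<close>

definition ball_cover :: "'a::metric_space set \<Rightarrow> real \<Rightarrow> bool" where
  "ball_cover A \<rho> \<longleftrightarrow> (\<exists>C. finite C \<and> A \<subseteq> (\<Union>c\<in>C. ball c \<rho>))"

lemma ball_coverE:
  assumes "ball_cover A \<rho>"
  obtains C where "finite C" "A \<subseteq> (\<Union>c\<in>C. ball c \<rho>)"
  using assms unfolding ball_cover_def by blast

lemma ball_coverI: "finite C \<Longrightarrow> A \<subseteq> (\<Union>c\<in>C. ball c \<rho>) \<Longrightarrow> ball_cover A \<rho>"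
  unfolding ball_cover_def by blast

lemma ball_cover_mono: "ball_cover B \<rho> \<Longrightarrow> A \<subseteq> B \<Longrightarrow> \<rho> \<le> \<rho>' \<Longrightarrow> ball_cover A \<rho>'"
proof -
  assume "ball_cover B \<rho>" "A \<subseteq> B" "\<rho> \<le> \<rho>'"
  then obtain C where "finite C" "B \<subseteq> (\<Union>c\<in>C. ball c \<rho>)"
    by (auto elim: ball_coverE)
  with \<open>A \<subseteq> B\<close> show ?thesis
    using subset_ball[OF \<open>\<rho> \<le> \<rho>'\<close>] by (intro ball_coverI[of C]) blast+
qed

lemma hausdorff_mnc_imp_ball_cover:
  assumes "hausdorff_mnc A \<le> ereal a" "a < b"
  shows "ball_cover A b"
proof -
  have "hausdorff_mnc A < ereal b"
    using assms(1) by (rule order_le_less_trans) (simp add: assms(2))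
  then obtain \<epsilon> C where "\<epsilon> < b" "finite C" "A \<subseteq> (\<Union>c\<in>C. ball c \<epsilon>)"
    unfolding hausdorff_mnc_def Inf_less_iff by auto
  then show ?thesis
    by (intro ball_cover_mono[OF ball_coverI[of C A \<epsilon>]]) auto
qed

lemma ball_cover_imp_hausdorff_mnc:
  assumes "ball_cover A \<rho>" "\<rho> > 0"
  shows "hausdorff_mnc A \<le> ereal \<rho>"
  using assms unfolding hausdorff_mnc_def ball_cover_def by (intro Inf_lower) blast

lemma ball_cover_Un:
  assumes "ball_cover A \<rho>" "ball_cover B \<rho>"
  shows "ball_cover (A \<union> B) \<rho>"
proof -
  obtain C C' where "finite C" "A \<subseteq> (\<Union>c\<in>C. ball c \<rho>)" "finite C'" "B \<subseteq> (\<Union>c\<in>C'. ball c \<rho>)"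
    using assms unfolding ball_cover_def by blast
  then show ?thesis
    by (intro ball_coverI[of "C \<union> C'"]) auto
qed

lemma ball_cover_finite: "finite A \<Longrightarrow> \<rho> > 0 \<Longrightarrow> ball_cover A \<rho>"
  by (rule ball_coverI[of A]) auto

lemma compact_imp_ball_cover:
  assumes "compact A" "\<rho> > 0"
  shows "ball_cover A \<rho>"
proof -
  obtain C where "finite C" "A \<subseteq> (\<Union>c\<in>C. ball c \<rho>)"
    using compact_eq_totally_bounded[of A] assms by blast
  then show ?thesis by (rule ball_coverI)
qed

lemma ball_cover_near:
  assumes "ball_cover B \<rho>" "\<And>a. a \<in> A \<Longrightarrow> \<exists>b\<in>B. dist a b \<le> \<sigma>"
  shows "ball_cover A (\<rho> + \<sigma>)"
proof -
  obtain C where C: "finite C" "B \<subseteq> (\<Union>c\<in>C. ball c \<rho>)"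
    using assms(1) by (rule ball_coverE)
  show ?thesis
  proof (rule ball_coverI[OF C(1)], rule subsetI)
    fix a assume "a \<in> A"
    then obtain b where b: "b \<in> B" "dist a b \<le> \<sigma>" using assms(2) by blast
    then obtain c where c: "c \<in> C" "dist c b < \<rho>" using C(2) by auto
    then have "dist c a < \<rho> + \<sigma>"
      using b(2) dist_triangle[of c a b] by (simp add: dist_commute)
    with c show "a \<in> (\<Union>c\<in>C. ball c (\<rho> + \<sigma>))" by auto
  qed
qed

lemma ball_cover_sums:
  fixes A B :: "'a::real_normed_vector set"
  assumes "ball_cover A \<rho>" "ball_cover B \<sigma>"
  shows "ball_cover {a + b |a b. a \<in> A \<and> b \<in> B} (\<rho> + \<sigma>)"
proof -
  obtain C C' where C: "finite C" "A \<subseteq> (\<Union>c\<in>C. ball c \<rho>)" "finite C'" "B \<subseteq> (\<Union>c\<in>C'. ball c \<sigma>)"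
    using assms unfolding ball_cover_def by blast
  show ?thesis
  proof (rule ball_coverI[of "(\<lambda>(c, c'). c + c') ` (C \<times> C')"])
    show "{a + b |a b. a \<in> A \<and> b \<in> B} \<subseteq> (\<Union>c\<in>(\<lambda>(c, c'). c + c') ` (C \<times> C'). ball c (\<rho> + \<sigma>))"
    proof clarify
      fix a b assume "a \<in> A" "b \<in> B"
      then obtain c c' where c: "c \<in> C" "dist c a < \<rho>" "c' \<in> C'" "dist c' b < \<sigma>"
        using C by fastforce
      then have "dist (c + c') (a + b) < \<rho> + \<sigma>"
        using dist_triangle_add[of c c' a b] by linarith
      with c show "a + b \<in> (\<Union>c\<in>(\<lambda>(c, c'). c + c') ` (C \<times> C'). ball c (\<rho> + \<sigma>))"
        by force
    qed
  qed (use C in auto)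
qed

text \<open>\<open>A\<close> lies in the sum of a ball of radius \<rho> and the convex hull of the
  centers, and that sum is convex. The hull of finitely many points is compact, so covering it costs
  only the slack \<open>\<rho>' - \<rho>\<close>.\<close>

lemma ball_cover_convex_hull:
  fixes A :: "'a::real_normed_vector set"
  assumes "ball_cover A \<rho>" "\<rho> < \<rho>'"
  shows "ball_cover (convex hull A) \<rho>'"
proof -
  obtain C where C: "finite C" "A \<subseteq> (\<Union>c\<in>C. ball c \<rho>)"
    using assms(1) by (rule ball_coverE)
  let ?S = "\<Union>x\<in>ball 0 \<rho>. \<Union>y\<in>convex hull C. {x + y}"
  have "convex ?S"
    by (intro convex_sums convex_ball convex_convex_hull)
  moreover have "A \<subseteq> ?S"
  proof
    fix a assume "a \<in> A"
    then obtain c where "c \<in> C" "dist c a < \<rho>" using C by auto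
    then show "a \<in> ?S"
      by (intro UN_I[of "a - c"] UN_I[of c]) (auto simp: dist_norm norm_minus_commute intro: hull_inc)
  qed
  ultimately have "convex hull A \<subseteq> ?S"
    by (simp add: hull_minimal)
  have cov: "ball_cover (convex hull C) (\<rho>' - \<rho>)"
    using C assms by (intro compact_imp_ball_cover finite_imp_compact_convex_hull) auto
  have "ball_cover (convex hull A) ((\<rho>' - \<rho>) + \<rho>)"
  proof (rule ball_cover_near[OF cov])
    fix a assume "a \<in> convex hull A"
    then obtain x y where "norm x < \<rho>" "y \<in> convex hull C" "a = x + y"
      using \<open>convex hull A \<subseteq> ?S\<close> by auto
    then show "\<exists>b\<in>convex hull C. dist a b \<le> \<rho>"
      by (intro bexI[of _ y]) (auto simp: dist_norm)
  qed
  then show ?thesis by simp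
qed

text \<open>Every ball that meets \<open>A\<close> is recentered at a point of \<open>A\<close>,
  which at most doubles the radius. Centers in \<open>A\<close> are needed where they must stay in
  an invariant set or in a separable subspace.\<close>

lemma ball_cover_centers_in:
  assumes "ball_cover A \<rho>"
  obtains C where "finite C" "C \<subseteq> A" "A \<subseteq> (\<Union>c\<in>C. ball c (2 * \<rho>))"
proof -
  obtain C where C: "finite C" "A \<subseteq> (\<Union>c\<in>C. ball c \<rho>)"
    using assms by (rule ball_coverE)
  define p where "p c = (SOME a. a \<in> A \<inter> ball c \<rho>)" for c
  have p: "p c \<in> A \<inter> ball c \<rho>" if "A \<inter> ball c \<rho> \<noteq> {}" for c
    unfolding p_def by (rule someI_ex) (use that in blast)
  show ?thesis
  proof (rule that[of "p ` {c \<in> C. A \<inter> ball c \<rho> \<noteq> {}}"])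
    show "p ` {c \<in> C. A \<inter> ball c \<rho> \<noteq> {}} \<subseteq> A" using p by blast
    show "A \<subseteq> (\<Union>c\<in>p ` {c \<in> C. A \<inter> ball c \<rho> \<noteq> {}}. ball c (2 * \<rho>))"
    proof
      fix a assume "a \<in> A"
      then obtain c where c: "c \<in> C" "a \<in> A \<inter> ball c \<rho>" using C by auto
      then have "p c \<in> A \<inter> ball c \<rho>" using p[of c] by blast
      then have "dist (p c) a < 2 * \<rho>"
        using c dist_triangle[of "p c" a c] by (auto simp: dist_commute)
      then show "a \<in> (\<Union>c\<in>p ` {c \<in> C. A \<inter> ball c \<rho> \<noteq> {}}. ball c (2 * \<rho>))"
        using c by (intro UN_I[of "p c"] imageI CollectI conjI) auto
    qed
  qed (use C in auto)
qed

section \<open>Brouwer's theorem and approximate fixed points\<close>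

text \<open>Kuhn's lemma is available for a dimension that is a natural number; the library's Brouwer
  theorem, in contrast, ties the dimension to a type.\<close>

lemma brouwer_nat_cube:
  fixes f :: "(nat \<Rightarrow> real) \<Rightarrow> nat \<Rightarrow> real" and n :: nat
  defines "Q \<equiv> {x. (\<forall>i<n. 0 \<le> x i \<and> x i \<le> 1) \<and> (\<forall>i\<ge>n. x i = 0)}"
  assumes cont: "\<And>i. i < n \<Longrightarrow> continuous_on Q (\<lambda>x. f x i)"
    and range: "\<And>x i. x \<in> Q \<Longrightarrow> i < n \<Longrightarrow> 0 \<le> f x i \<and> f x i \<le> 1"
  shows "\<exists>x\<in>Q. \<forall>i<n. f x i = x i"
proof -
  define pt where "pt p x = (\<lambda>i. if i < n then real (x i) / real p else 0)" for p :: nat and x :: "nat \<Rightarrow> nat"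
  \<comment> \<open>Kuhn labels: 0 says that \<open>f\<close> does not decrease coordinate
    \<open>i\<close>, 1 that it does not increase it. The prescribed labels 0 on the face 0 and 1 on
    the face \<open>p\<close> agree with this because \<open>f\<close> maps into the cube.\<close>
  define label where "label p x i = (if x i = p \<or> x i \<noteq> 0 \<and> f (pt p x) i < pt p x i then 1 else 0 :: nat)" for p x i
  have ptQ: "pt p x \<in> Q" if "\<forall>i<n. x i \<le> p" for p x
    using that unfolding pt_def Q_def by (auto simp: divide_le_eq)
  define adj where "adj x q \<longleftrightarrow> (\<forall>j<n. q j \<le> x j \<and> x j \<le> q j + 1)" for x q :: "nat \<Rightarrow> nat"
  have "\<exists>q. (\<forall>i<n. q i < Suc p) \<and> (\<forall>i<n. \<exists>r s. adj r q \<and> adj s q \<and>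
      label (Suc p) r i = 0 \<and> label (Suc p) s i = 1)" for p
  proof -
    obtain q where q: "\<forall>i<n. q i < Suc p"
      "\<forall>i<n. \<exists>r s. adj r q \<and> adj s q \<and> label (Suc p) r i \<noteq> label (Suc p) s i"
      unfolding adj_def by (rule kuhn_lemma[of "Suc p" n "label (Suc p)"]) (auto simp: label_def)
    have "\<exists>r s. adj r q \<and> adj s q \<and> label (Suc p) r i = 0 \<and> label (Suc p) s i = 1" if i: "i < n" for i
    proof -
      obtain r s where rs: "adj r q" "adj s q" "label (Suc p) r i \<noteq> label (Suc p) s i"
        using q(2) i by blast
      have "label (Suc p) x i = 0 \<or> label (Suc p) x i = 1" for x
        by (simp add: label_def)
      with rs show ?thesis by metis
    qed
    with q(1) show ?thesis by blast
  qed
  then obtain q where "\<And>p. (\<forall>i<n. q p i < Suc p) \<and> (\<forall>i<n. \<exists>r s. adj r (q p) \<and> adj s (q p) \<and>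
      label (Suc p) r i = 0 \<and> label (Suc p) s i = 1)"
    using choice[of "\<lambda>p q. (\<forall>i<n. q i < Suc p) \<and> (\<forall>i<n. \<exists>r s. adj r q \<and> adj s q \<and>
      label (Suc p) r i = 0 \<and> label (Suc p) s i = 1)"] by blast
  then have q: "\<And>p i. i < n \<Longrightarrow> q p i < Suc p"
    and ex: "\<And>p i. i < n \<Longrightarrow> \<exists>r s. adj r (q p) \<and> adj s (q p) \<and>
      label (Suc p) r i = 0 \<and> label (Suc p) s i = 1"
    by blast+
  define good where "good p i rs \<longleftrightarrow> adj (fst rs) (q p) \<and> adj (snd rs) (q p) \<and>
      label (Suc p) (fst rs) i = 0 \<and> label (Suc p) (snd rs) i = 1" for p i rs
  define r where "r p i = fst (SOME rs. good p i rs)" for p i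
  define s where "s p i = snd (SOME rs. good p i rs)" for p i
  have "good p i (SOME rs. good p i rs)" if "i < n" for p i
    by (rule someI_ex) (use ex[OF that, of p] in \<open>auto simp: good_def\<close>)
  then have adj_r: "\<And>p i. i < n \<Longrightarrow> adj (r p i) (q p)"
    and adj_s: "\<And>p i. i < n \<Longrightarrow> adj (s p i) (q p)"
    and lr: "\<And>p i. i < n \<Longrightarrow> label (Suc p) (r p i) i = 0"
    and ls: "\<And>p i. i < n \<Longrightarrow> label (Suc p) (s p i) i = 1"
    unfolding good_def r_def s_def by blast+
  have r: "q p j \<le> r p i j \<and> r p i j \<le> q p j + 1" if "i < n" "j < n" for p i j
    using adj_r[OF that(1), of p] that(2) unfolding adj_def by blast
  have s: "q p j \<le> s p i j \<and> s p i j \<le> q p j + 1" if "i < n" "j < n" for p i j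
    using adj_s[OF that(1), of p] that(2) unfolding adj_def by blast
  \<comment> \<open>With singleton factors for the indices from \<open>n\<close> on, the cube
    becomes a full product, so Tychonoff gives compactness in the product topology of
    \<open>nat \<Rightarrow> real\<close>.\<close>
  have Q_eq: "Q = Pi\<^sub>E UNIV (\<lambda>i. if i < n then {0..1} else {0})"
  proof (intro set_eqI iffI)
    fix x assume "x \<in> Q"
    then show "x \<in> Pi\<^sub>E UNIV (\<lambda>i. if i < n then {0..1} else {0})"
      unfolding Q_def by (simp add: PiE_UNIV_domain Pi_iff)
  next
    fix x assume "x \<in> Pi\<^sub>E UNIV (\<lambda>i. if i < n then {0..1::real} else {0})"
    then have x: "x i \<in> (if i < n then {0..1} else {0})" for i
      by (simp add: PiE_UNIV_domain Pi_iff)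
    have "0 \<le> x i \<and> x i \<le> 1" if "i < n" for i using x[of i] that by simp
    moreover have "x i = 0" if "i \<ge> n" for i using x[of i] that by simp
    ultimately show "x \<in> Q" unfolding Q_def by blast
  qed
  have "compactin (product_topology (\<lambda>i::nat. euclidean :: real topology) UNIV) Q"
    unfolding Q_eq compactin_PiE by auto
  then have "compact Q"
    by (simp add: euclidean_product_topology)
  moreover have qQ: "pt (Suc p) (q p) \<in> Q" for p
    by (intro ptQ allI impI less_imp_le q)
  ultimately obtain x \<phi> where x: "x \<in> Q" and \<phi>: "strict_mono \<phi>"
    and lim: "(\<lambda>k. pt (Suc (\<phi> k)) (q (\<phi> k))) \<longlonglongrightarrow> x"
    using seq_compactE[of Q "\<lambda>k. pt (Suc k) (q k)"] unfolding compact_eq_seq_compact_metric comp_def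
    by metis
  have coord_lim: "(\<lambda>k. X k i) \<longlonglongrightarrow> y i" if "X \<longlonglongrightarrow> y" for X and y :: "nat \<Rightarrow> real" and i
    using continuous_on_tendsto_compose[OF continuous_on_product_coordinates that] by simp
  have lim_coord: "X \<longlonglongrightarrow> y" if "\<And>i. (\<lambda>k. X k i) \<longlonglongrightarrow> y i" for X and y :: "nat \<Rightarrow> real"
    using limitin_componentwise[of "\<lambda>_::nat. euclidean :: real topology" UNIV X y sequentially] that
    by (simp add: euclidean_product_topology)
  \<comment> \<open>All vertices of the chosen cells converge to the same \<open>x\<close>, since
    they differ from \<open>q p\<close> by at most one mesh width in each coordinate; hence both
    label inequalities pass to the limit at \<open>x\<close>.\<close>
  have near: "(\<lambda>k. pt (Suc (\<phi> k)) (z (\<phi> k))) \<longlonglongrightarrow> x"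
    if z: "\<And>p j. j < n \<Longrightarrow> q p j \<le> z p j \<and> z p j \<le> q p j + 1" for z
  proof -
    have "(\<lambda>k. pt (Suc (\<phi> k)) (z (\<phi> k)) i) \<longlonglongrightarrow> x i" for i
    proof (cases "i < n")
      case True
      have 1: "(\<lambda>k. pt (Suc (\<phi> k)) (q (\<phi> k)) i) \<longlonglongrightarrow> x i"
        by (rule coord_lim[OF lim])
      have "(\<lambda>p. 1 / real (Suc p)) \<longlonglongrightarrow> 0"
        using LIMSEQ_inverse_real_of_nat by (simp add: inverse_eq_divide)
      then have 2: "(\<lambda>k. 1 / real (Suc (\<phi> k))) \<longlonglongrightarrow> 0"
        using LIMSEQ_subseq_LIMSEQ[OF _ \<phi>] by (auto simp: comp_def)
      have 3: "(\<lambda>k. pt (Suc (\<phi> k)) (q (\<phi> k)) i + 1 / real (Suc (\<phi> k))) \<longlonglongrightarrow> x i"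
        using tendsto_add[OF 1 2] by simp
      show ?thesis
      proof (rule tendsto_sandwich[OF _ _ 1 3])
        show "\<forall>\<^sub>F k in sequentially. pt (Suc (\<phi> k)) (q (\<phi> k)) i \<le> pt (Suc (\<phi> k)) (z (\<phi> k)) i"
          using True z by (auto simp: pt_def divide_right_mono)
        have "real (z p i) / real (Suc p) \<le> (real (q p i) + 1) / real (Suc p)" for p
          using z[OF True, of p] by (intro divide_right_mono) auto
        then show "\<forall>\<^sub>F k in sequentially. pt (Suc (\<phi> k)) (z (\<phi> k)) i \<le> pt (Suc (\<phi> k)) (q (\<phi> k)) i + 1 / real (Suc (\<phi> k))"
          using True by (auto simp: pt_def add_divide_distrib)
      qed
    next
      case False
      then show ?thesis using x by (auto simp: pt_def Q_def)
    qed
    then show ?thesis by (rule lim_coord)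
  qed
  have "f x i = x i" if i: "i < n" for i
  proof (rule antisym)
    have coord: "(\<lambda>k. pt (Suc (\<phi> k)) (z (\<phi> k)) i) \<longlonglongrightarrow> x i" and fcoord: "(\<lambda>k. f (pt (Suc (\<phi> k)) (z (\<phi> k))) i) \<longlonglongrightarrow> f x i"
      if z: "\<And>p j. j < n \<Longrightarrow> q p j \<le> z p j \<and> z p j \<le> q p j + 1" for z
    proof -
      show "(\<lambda>k. pt (Suc (\<phi> k)) (z (\<phi> k)) i) \<longlonglongrightarrow> x i"
        by (rule coord_lim[OF near[OF z]])
      have "pt (Suc p) (z p) \<in> Q" for p
      proof (rule ptQ, intro allI impI)
        fix j assume "j < n"
        then show "z p j \<le> Suc p" using q[of j p] z[of j p] by simp
      qed
      then show "(\<lambda>k. f (pt (Suc (\<phi> k)) (z (\<phi> k))) i) \<longlonglongrightarrow> f x i"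
        by (intro continuous_on_tendsto_compose[OF cont[OF i] near[OF z] x]) auto
    qed
    have zr: "r p i j \<le> Suc p" "s p i j \<le> Suc p" if "j < n" for p j
      using r[OF i that, of p] s[OF i that, of p] q[OF that, of p] by auto
    have "pt (Suc p) (r p i) i \<le> f (pt (Suc p) (r p i)) i" for p
    proof -
      have "pt (Suc p) (r p i) \<in> Q" using zr by (intro ptQ) auto
      from range[OF this i] have "0 \<le> f (pt (Suc p) (r p i)) i" by simp
      then show ?thesis
        using lr[OF i, of p] i unfolding label_def by (auto simp: pt_def split: if_splits)
    qed
    then show "x i \<le> f x i"
      by (intro LIMSEQ_le[OF coord fcoord]) (use \<open>\<And>p. pt (Suc p) (r p i) i \<le> f (pt (Suc p) (r p i)) i\<close> r[OF i] in blast)+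
    have "f (pt (Suc p) (s p i)) i \<le> pt (Suc p) (s p i) i" for p
    proof -
      have "pt (Suc p) (s p i) \<in> Q" using zr by (intro ptQ) auto
      from range[OF this i] have "f (pt (Suc p) (s p i)) i \<le> 1" by simp
      then show ?thesis
        using ls[OF i, of p] i unfolding label_def by (auto simp: pt_def split: if_splits)
    qed
    then show "f x i \<le> x i"
      by (intro LIMSEQ_le[OF fcoord coord]) (use \<open>\<And>p. f (pt (Suc p) (s p i)) i \<le> pt (Suc p) (s p i) i\<close> s[OF i] in blast)+
  qed
  with x show ?thesis by blast
qed

text \<open>The map \<rho> \<mapsto> q \<rho> + c contracts towards its fixed point c / (1 - q), and
  after n steps the excess is at most R q^n. It is used once for a chain of invariant sets and once
  for the set of approximate solutions.\<close>

lemma affine_descent: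
  fixes P :: "real \<Rightarrow> bool"
  assumes mono: "\<And>\<rho> \<rho>'. P \<rho> \<Longrightarrow> \<rho> \<le> \<rho>' \<Longrightarrow> P \<rho>'"
    and step: "\<And>\<rho>. \<rho> > 0 \<Longrightarrow> P \<rho> \<Longrightarrow> P (q * \<rho> + c)"
    and "P R" "R > 0" "0 \<le> q" "q < 1" "0 \<le> c" "\<delta> > 0"
  shows "P (c / (1 - q) + \<delta>)"
proof -
  have c: "c / (1 - q) \<ge> 0" using assms by simp
  have *: "P (c / (1 - q) + R * q ^ n)" for n
  proof (induction n)
    case 0
    show ?case by (rule mono[OF \<open>P R\<close>]) (use c in simp)
  next
    case (Suc n)
    show ?case
    \<comment> \<open>For q = 0 the radius c / (1 - q) + R q^n may be 0, where \<open>step\<close>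
      does not apply; one step from the larger radius c / (1 - q) + R gives the claim.\<close>
    proof (cases "q = 0")
      case True
      have "P (q * (c / (1 - q) + R) + c)"
        by (rule step) (use c \<open>R > 0\<close> mono[OF \<open>P R\<close>] in auto)
      then show ?thesis using True by simp
    next
      case False
      have "c / (1 - q) + R * q ^ n > 0" using c False assms by (simp add: add_nonneg_pos)
      then have "P (q * (c / (1 - q) + R * q ^ n) + c)" by (rule step) (rule Suc.IH)
      moreover have "q * (c / (1 - q) + R * q ^ n) + c = c / (1 - q) + R * q ^ Suc n"
        using \<open>q < 1\<close> by (simp add: field_simps)
      ultimately show ?thesis by simp
    qed
  qed
  have "(\<lambda>n. R * q ^ n) \<longlonglongrightarrow> R * 0"
    by (intro tendsto_intros LIMSEQ_power_zero) (use assms in auto)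
  then have "\<forall>\<^sub>F n in sequentially. R * q ^ n < \<delta>"
    by (rule order_tendstoD(2)) (use assms in auto)
  then obtain n where "R * q ^ n < \<delta>"
    by (auto simp: eventually_sequentially)
  then show ?thesis using mono[OF *[of n]] by simp
qed

text \<open>The Schauder projection sends y to the average of the centers with weights \<sigma> - |y
  - c_i|, cut off at 0, and moves points of \<open>A\<close> by at most \<sigma>. Brouwer is applied
  to the weights, as points of a cube, and not to the hull, whose corners may be affinely
  dependent.\<close>

lemma schauder_approximate_fixed_point:
  fixes A :: "'b::real_normed_vector set"
  assumes A: "convex A" "0 \<in> A" and C: "finite C" "C \<subseteq> A" "A \<subseteq> (\<Union>c\<in>C. ball c \<sigma>)"
    and G: "continuous_on (convex hull (insert 0 C)) G" "\<And>x. x \<in> convex hull (insert 0 C) \<Longrightarrow> G x \<in> A"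
  shows "\<exists>x\<in>convex hull (insert 0 C). norm (x - G x) \<le> \<sigma>"
proof -
  obtain n and c :: "nat \<Rightarrow> 'b" where c: "C = c ` {i. i < n}"
    using finite_imp_nat_seg_image_inj_on[OF C(1)] by blast
  define Z where "Z = convex hull (insert 0 C)"
  define Q where "Q = {x::nat \<Rightarrow> real. (\<forall>i<n. 0 \<le> x i \<and> x i \<le> 1) \<and> (\<forall>i\<ge>n. x i = 0)}"
  \<comment> \<open>Dividing by the maximum of 1 and the sum lets \<open>X\<close> map the entire
    cube into the hull of 0 and \<open>C\<close>; at the fixed point the coordinates add up to 1 and
    the divisor disappears.\<close>
  define X where "X \<xi> = (\<Sum>i<n. (\<xi> i / max 1 (\<Sum>i<n. \<xi> i)) *\<^sub>R c i)" for \<xi>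
  define w where "w i y = max 0 (\<sigma> - dist y (c i))" for i y
  define W where "W y = (\<Sum>i<n. w i y)" for y
  define f where "f \<xi> i = w i (G (X \<xi>)) / W (G (X \<xi>))" for \<xi> i
  have W_pos: "W y > 0" if "y \<in> A" for y
  proof -
    obtain a where "a \<in> C" "y \<in> ball a \<sigma>" using C(3) \<open>y \<in> A\<close> by blast
    then obtain i where i: "i < n" "dist (c i) y < \<sigma>" using c by auto
    show ?thesis unfolding W_def
      by (rule sum_pos2[of _ i]) (use i in \<open>auto simp: w_def dist_commute\<close>)
  qed
  have XZ: "X \<xi> \<in> Z" if "\<xi> \<in> Q" for \<xi>
  proof -
    define s where "s = (\<Sum>i<n. \<xi> i)"
    have s: "0 \<le> s" unfolding s_def using that by (intro sum_nonneg) (simp add: Q_def)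
    have "(\<Sum>i<n. (\<xi> i / max 1 s) *\<^sub>R c i) + (1 - s / max 1 s) *\<^sub>R 0 \<in> Z"
    proof (cases "s = 0")
      case True
      then have "\<forall>i\<in>{..<n}. \<xi> i = 0"
        unfolding s_def by (subst (asm) sum_nonneg_eq_0_iff) (use that in \<open>auto simp: Q_def\<close>)
      then show ?thesis by (auto simp: Z_def intro: hull_inc)
    next
      case False
      have "(\<Sum>i<n. (\<xi> i / s) *\<^sub>R c i) \<in> Z"
        unfolding Z_def
      proof (rule convex_sum)
        show "(\<Sum>i<n. \<xi> i / s) = 1" using False by (simp add: s_def flip: sum_divide_distrib)
        show "0 \<le> \<xi> i / s" if "i \<in> {..<n}" for i using s that \<open>\<xi> \<in> Q\<close> by (auto simp: Q_def)
        show "c i \<in> convex hull insert 0 C" if "i \<in> {..<n}" for i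
          using that c by (intro hull_inc) auto
      qed auto
      moreover have "0 \<in> Z" by (simp add: Z_def hull_inc)
      moreover have "convex Z" by (simp add: Z_def)
      ultimately have "(s / max 1 s) *\<^sub>R (\<Sum>i<n. (\<xi> i / s) *\<^sub>R c i) + (1 - s / max 1 s) *\<^sub>R 0 \<in> Z"
        using s by (intro convexD) (auto simp: max_def)
      then show ?thesis using False by (simp add: scaleR_sum_right)
    qed
    then show ?thesis by (simp add: X_def s_def)
  qed
  have contX: "continuous_on Q X"
    unfolding X_def
    by (intro continuous_intros continuous_on_subset[OF continuous_on_product_coordinates]) auto
  have contw: "continuous_on UNIV (w i)" for i
    unfolding w_def by (intro continuous_intros)
  have contGX: "continuous_on Q (\<lambda>\<xi>. G (X \<xi>))"
    by (rule continuous_on_compose2[OF G(1) contX]) (use XZ in \<open>auto simp: Z_def\<close>)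
  have contwGX: "continuous_on Q (\<lambda>\<xi>. w i (G (X \<xi>)))" for i
    by (rule continuous_on_compose2[OF contw contGX]) auto
  have wle: "w i y \<le> W y" if "i < n" for i y
    unfolding W_def using that by (intro member_le_sum) (auto simp: w_def)
  have "\<exists>\<xi>\<in>Q. \<forall>i<n. f \<xi> i = \<xi> i"
    unfolding Q_def
  proof (rule brouwer_nat_cube)
    show "continuous_on {x. (\<forall>i<n. 0 \<le> x i \<and> x i \<le> 1) \<and> (\<forall>i\<ge>n. x i = 0)} (\<lambda>x. f x i)" if "i < n" for i
      unfolding f_def W_def Q_def[symmetric]
      by (intro continuous_intros contwGX) (use W_pos G(2) XZ in \<open>force simp: Z_def W_def\<close>)
    show "0 \<le> f x i \<and> f x i \<le> 1"
      if "x \<in> {x. (\<forall>i<n. 0 \<le> x i \<and> x i \<le> 1) \<and> (\<forall>i\<ge>n. x i = 0)}" "i < n" for x i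
    proof -
      have "x \<in> Q" using that by (simp add: Q_def)
      then have "W (G (X x)) > 0" using XZ G(2) by (intro W_pos) (simp add: Z_def)
      then show ?thesis
        unfolding f_def using wle[OF that(2), of "G (X x)"] by (simp add: w_def)
    qed
  qed
  then obtain \<xi> where \<xi>: "\<xi> \<in> Q" "\<And>i. i < n \<Longrightarrow> f \<xi> i = \<xi> i" by blast
  define y where "y = G (X \<xi>)"
  have Wy: "W y > 0" using XZ[OF \<xi>(1)] G(2) unfolding y_def by (intro W_pos) (simp add: Z_def)
  have l: "\<xi> i = w i y / W y" if "i < n" for i using \<xi>(2)[OF that] by (simp add: f_def y_def)
  have sum1: "(\<Sum>i<n. \<xi> i) = 1"
  proof -
    have "(\<Sum>i<n. \<xi> i) = (\<Sum>i<n. w i y / W y)" using l by (intro sum.cong) auto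
    also have "\<dots> = 1" using Wy by (simp add: W_def flip: sum_divide_distrib)
    finally show ?thesis .
  qed
  have "X \<xi> - y = (\<Sum>i<n. \<xi> i *\<^sub>R c i) - (\<Sum>i<n. \<xi> i) *\<^sub>R y"
    by (simp add: X_def sum1)
  also have "\<dots> = (\<Sum>i<n. \<xi> i *\<^sub>R (c i - y))"
    by (simp add: scaleR_sum_left scaleR_diff_right sum_subtractf)
  also have "norm \<dots> \<le> (\<Sum>i<n. norm (\<xi> i *\<^sub>R (c i - y)))"
    by (rule norm_sum)
  also have "\<dots> \<le> (\<Sum>i<n. \<xi> i * \<sigma>)"
  proof (rule sum_mono)
    fix i assume "i \<in> {..<n}"
    then have i: "i < n" by simp
    have "0 \<le> \<xi> i" using \<xi>(1) i by (simp add: Q_def)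
    show "norm (\<xi> i *\<^sub>R (c i - y)) \<le> \<xi> i * \<sigma>"
    proof (cases "dist y (c i) < \<sigma>")
      case True
      then have "norm (c i - y) \<le> \<sigma>" by (simp add: dist_norm norm_minus_commute)
      then show ?thesis using \<open>0 \<le> \<xi> i\<close> by (simp add: mult_left_mono)
    next
      case False
      then have "\<xi> i = 0" using l[OF i] by (simp add: w_def)
      then show ?thesis by simp
    qed
  qed
  also have "\<dots> = \<sigma>" using sum1 by (simp flip: sum_distrib_right)
  finally show ?thesis using XZ[OF \<xi>(1)] by (auto simp: Z_def y_def)
qed

text \<open>The additive error \<open>b > 0\<close> replaces compactness: finitely many steps
  \<open>A \<mapsto> co ({0} \<union> H A)\<close> lead to an invariant convex set that is covered by balls of radius \<open>O(b)\<close>, on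
  which the Schauder projection moves points by at most that much.\<close>

lemma condensing_approximate_fixed_point:
  fixes K :: "'b::real_normed_vector set" and H :: "'b \<Rightarrow> 'b set"
  assumes K: "convex K" "0 \<in> K" "bounded K"
    and HK: "\<And>x. x \<in> K \<Longrightarrow> H x \<subseteq> K"
    and sel: "\<And>Z. compact Z \<Longrightarrow> convex Z \<Longrightarrow> Z \<subseteq> K \<Longrightarrow> \<exists>G. continuous_on Z G \<and> (\<forall>x\<in>Z. G x \<in> H x)"
    and cov: "\<And>\<Omega> \<rho>. \<Omega> \<subseteq> K \<Longrightarrow> \<rho> > 0 \<Longrightarrow> ball_cover \<Omega> \<rho> \<Longrightarrow> ball_cover (\<Union>x\<in>\<Omega>. H x) (q * \<rho> + b)"
    and q: "0 \<le> q" "q < 1" and "b > 0"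
  shows "\<exists>x\<in>K. \<exists>y\<in>H x. norm (x - y) \<le> 6 * b / (1 - q)"
proof -
  define P where "P \<rho> \<longleftrightarrow> (\<exists>A. convex A \<and> 0 \<in> A \<and> A \<subseteq> K \<and> (\<forall>x\<in>A. H x \<subseteq> A) \<and> ball_cover A \<rho>)" for \<rho>
  obtain R where R: "R > 0" "K \<subseteq> ball 0 R"
    using bounded_subset_ballD[OF K(3)] by blast
  \<comment> \<open>Each step costs one \<open>b\<close> from \<open>cov\<close> and one for passing
    to the convex hull, so the additive constant is 2 b. The slack b / (1 - q) raises the limit
    radius to 3 b / (1 - q), and centers inside the set double it to the 6 b / (1 - q) of the
    claim.\<close>
  have "P (2 * b / (1 - q) + b / (1 - q))"
  proof (rule affine_descent)
    show "P R" unfolding P_def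
      using K HK R by (intro exI[of _ K]) (auto intro!: ball_coverI[of "{0}"])
    show "P \<rho>'" if "P \<rho>" "\<rho> \<le> \<rho>'" for \<rho> \<rho>'
      using that ball_cover_mono unfolding P_def by blast
    show "P (q * \<rho> + 2 * b)" if "\<rho> > 0" "P \<rho>" for \<rho>
    proof -
      obtain A where A: "convex A" "0 \<in> A" "A \<subseteq> K" "\<And>x. x \<in> A \<Longrightarrow> H x \<subseteq> A" "ball_cover A \<rho>"
        using \<open>P \<rho>\<close> unfolding P_def by blast
      define B where "B = convex hull (insert 0 (\<Union>x\<in>A. H x))"
      have BA: "B \<subseteq> A" unfolding B_def using A by (intro hull_minimal) auto
      have "ball_cover ({0} \<union> (\<Union>x\<in>A. H x)) (q * \<rho> + b)"
        by (intro ball_cover_Un ball_cover_finite cov A) (use that q \<open>b > 0\<close> in \<open>auto intro: add_nonneg_pos\<close>)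
      then have "ball_cover B (q * \<rho> + 2 * b)"
        unfolding B_def using \<open>b > 0\<close> by (intro ball_cover_convex_hull[of _ "q * \<rho> + b"]) auto
      moreover have "H x \<subseteq> B" if "x \<in> B" for x
        using that BA unfolding B_def by (intro subset_trans[OF _ hull_subset]) auto
      moreover have "convex B" "0 \<in> B" unfolding B_def by (auto intro: hull_inc)
      ultimately show ?thesis
        using BA A(3) unfolding P_def by (intro exI[of _ B]) auto
    qed
  qed (use q R \<open>b > 0\<close> in auto)
  then have "P (3 * b / (1 - q))" by (simp add: add_divide_distrib[symmetric])
  then obtain A where A: "convex A" "0 \<in> A" "A \<subseteq> K" "\<And>x. x \<in> A \<Longrightarrow> H x \<subseteq> A"
    "ball_cover A (3 * b / (1 - q))"
    unfolding P_def by blast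
  obtain C where C: "finite C" "C \<subseteq> A" "A \<subseteq> (\<Union>c\<in>C. ball c (2 * (3 * b / (1 - q))))"
    using ball_cover_centers_in[OF A(5)] by blast
  define Z where "Z = convex hull (insert 0 C)"
  have ZA: "Z \<subseteq> A" unfolding Z_def using A C by (intro hull_minimal) auto
  have "compact Z" unfolding Z_def using C by (intro finite_imp_compact_convex_hull) auto
  moreover have "convex Z" by (simp add: Z_def)
  ultimately obtain G where G: "continuous_on Z G" "\<And>x. x \<in> Z \<Longrightarrow> G x \<in> H x"
    using sel[of Z] ZA A(3) by blast
  have "\<exists>x\<in>Z. norm (x - G x) \<le> 2 * (3 * b / (1 - q))"
    unfolding Z_def
  proof (rule schauder_approximate_fixed_point[OF A(1,2) C])
    show "continuous_on (convex hull insert 0 C) G" using G(1) by (simp add: Z_def)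
    show "G x \<in> A" if "x \<in> convex hull insert 0 C" for x
      using that G(2) A(4) ZA by (auto simp: Z_def)
  qed
  then show ?thesis using G(2) ZA A(3) by force
qed

section \<open>The Bochner integral of strongly measurable functions\<close>

abbreviation (input) "simple_vector_integrable \<equiv> Bochner_Integration.simple_bochner_integrable"
abbreviation (input) "simple_vector_integral \<equiv> Bochner_Integration.simple_bochner_integral"

text \<open>Finiteness makes all simple functions integrable; completeness makes almost everywhere
  limits and modifications of measurable functions measurable.\<close>

locale finite_complete_measure = finite_measure M + complete_measure M for M :: "'a measure"

lemma finite_complete_measure_lebesgue_on: "finite_complete_measure (lebesgue_on {a..b::real})"
proof (intro finite_complete_measure.intro)
  show "finite_measure (lebesgue_on {a..b})"
    by (intro finite_measureI)
      (cases "a \<le> b"; simp add: emeasure_restrict_space space_restrict_space emeasure_lborel_Icc_eq)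
  show "complete_measure (lebesgue_on {a..b})"
  proof
    fix A B :: "real set" assume BA: "B \<subseteq> A" and "A \<in> null_sets (lebesgue_on {a..b})"
    then have A: "A \<subseteq> {a..b}" "A \<in> null_sets lebesgue"
      by (auto simp: null_sets_restrict_space)
    then have "B \<in> null_sets lebesgue"
      using BA by (meson completion.complete2)
    then have "B \<in> null_sets (lebesgue_on {a..b})"
      using A BA by (auto simp: null_sets_restrict_space)
    then show "B \<in> sets (lebesgue_on {a..b})" by auto
  qed
qed

definition bochner_integral :: "'a measure \<Rightarrow> ('a \<Rightarrow> 'b::banach) \<Rightarrow> 'b" where
  "bochner_integral M f = (THE v. has_strong_bochner_integral M f v)"

text \<open>Ties are broken by the least index, so the cells on which the choice is constant are
  given by finitely many comparisons of distances; \<open>nearest_eq_iff\<close> is this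
  description. The choice yields simple approximations and finite measurable partitions.\<close>

definition nearest :: "(nat \<Rightarrow> 'b::metric_space) \<Rightarrow> nat \<Rightarrow> 'b \<Rightarrow> nat" where
  "nearest y m v = (LEAST j. j \<le> m \<and> (\<forall>i\<le>m. dist v (y j) \<le> dist v (y i)))"

lemma nearest:
  shows nearest_le: "nearest y m v \<le> m"
    and nearest_dist: "i \<le> m \<Longrightarrow> dist v (y (nearest y m v)) \<le> dist v (y i)"
proof -
  have "\<exists>j. j \<le> m \<and> (\<forall>i\<le>m. dist v (y j) \<le> dist v (y i))"
  proof -
    have "Min ((\<lambda>j. dist v (y j)) ` {..m}) \<in> (\<lambda>j. dist v (y j)) ` {..m}"
      by (intro Min_in) auto
    then obtain j where j: "j \<le> m" "Min ((\<lambda>j. dist v (y j)) ` {..m}) = dist v (y j)" by blast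
    have "dist v (y j) \<le> dist v (y i)" if "i \<le> m" for i
      unfolding j(2)[symmetric] using that by (intro Min_le) auto
    with j(1) show ?thesis by blast
  qed
  then have "nearest y m v \<le> m \<and> (\<forall>i\<le>m. dist v (y (nearest y m v)) \<le> dist v (y i))"
    unfolding nearest_def by (rule LeastI_ex)
  then show "nearest y m v \<le> m" "i \<le> m \<Longrightarrow> dist v (y (nearest y m v)) \<le> dist v (y i)" by blast+
qed

lemma nearest_eq_iff:
  "nearest y m v = j \<longleftrightarrow> j \<le> m \<and> (\<forall>i\<le>m. dist v (y j) \<le> dist v (y i)) \<and> (\<forall>i<j. dist v (y j) < dist v (y i))"
    (is "?l \<longleftrightarrow> ?r")
proof
  assume ?r
  then have j: "j \<le> m" "\<forall>i\<le>m. dist v (y j) \<le> dist v (y i)" "\<forall>i<j. dist v (y j) < dist v (y i)" by blast+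
  show ?l unfolding nearest_def
  proof (rule Least_equality)
    show "j \<le> m \<and> (\<forall>i\<le>m. dist v (y j) \<le> dist v (y i))" using j by blast
    show "j \<le> k" if "k \<le> m \<and> (\<forall>i\<le>m. dist v (y k) \<le> dist v (y i))" for k
    proof (rule ccontr)
      assume "\<not> j \<le> k"
      then have "dist v (y j) < dist v (y k)" using j(3) by simp
      moreover have "dist v (y k) \<le> dist v (y j)" using that j(1) by blast
      ultimately show False by simp
    qed
  qed
next
  assume l: ?l
  show ?r
  proof (intro conjI allI impI)
    show "j \<le> m" using nearest_le[of y m v] l by simp
    show le: "dist v (y j) \<le> dist v (y i)" if "i \<le> m" for i using nearest_dist[OF that, of v y] l by simp
    fix i assume "i < j"
    have "\<not> (i \<le> m \<and> (\<forall>k\<le>m. dist v (y i) \<le> dist v (y k)))"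
      using not_less_Least[of i "\<lambda>j. j \<le> m \<and> (\<forall>i\<le>m. dist v (y j) \<le> dist v (y i))"] \<open>i < j\<close> l
      unfolding nearest_def by blast
    then obtain k where k: "k \<le> m" "dist v (y k) < dist v (y i)"
      using \<open>i < j\<close> \<open>j \<le> m\<close> by force
    then show "dist v (y j) < dist v (y i)" using le[OF k(1)] by simp
  qed
qed

context finite_complete_measure
begin

lemma borel_measurable_AE_eq:
  fixes f :: "'a \<Rightarrow> 'b::topological_space"
  assumes f: "f \<in> borel_measurable M" and eq: "AE x in M. f x = g x"
  shows "g \<in> borel_measurable M"
proof (rule measurableI)
  fix B :: "'b set" assume "B \<in> sets borel"
  show "g -` B \<inter> space M \<in> sets M"
  proof (rule in_sets_AE)
    show "f -` B \<inter> space M \<in> sets M" using f \<open>B \<in> sets borel\<close> by (rule measurable_sets)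
    show "AE x in M. x \<in> f -` B \<inter> space M \<longleftrightarrow> x \<in> g -` B \<inter> space M"
      using eq by eventually_elim auto
  qed auto
qed auto

lemma borel_measurable_AE_LIMSEQ:
  fixes f :: "nat \<Rightarrow> 'a \<Rightarrow> 'b::metric_space"
  assumes f: "\<And>i. f i \<in> borel_measurable M" and lim: "AE x in M. (\<lambda>i. f i x) \<longlonglongrightarrow> g x"
  shows "g \<in> borel_measurable M"
proof -
  obtain N where N: "{x \<in> space M. \<not> (\<lambda>i. f i x) \<longlonglongrightarrow> g x} \<subseteq> N" "N \<in> null_sets M"
    using lim by (auto elim!: AE_E3 simp: AE_iff_null_sets)
  define z where "z = g (SOME x. True)"
  define f' where "f' i x = (if x \<in> N then z else f i x)" for i x
  have "(\<lambda>x. if x \<in> N then z else g x) \<in> borel_measurable M"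
  proof (rule borel_measurable_LIMSEQ_metric)
    show "(\<lambda>x. if x \<in> N then z else f i x) \<in> borel_measurable M" for i
      using N(2) by (intro measurable_If_set f) auto
    show "(\<lambda>i. if x \<in> N then z else f i x) \<longlonglongrightarrow> (if x \<in> N then z else g x)" if "x \<in> space M" for x
      using N(1) that by auto
  qed
  then show ?thesis
    by (rule borel_measurable_AE_eq) (use AE_not_in[OF N(2)] in \<open>eventually_elim, simp\<close>)
qed

lemma strongly_measurable_imp_borel_measurable:
  assumes "strongly_measurable M f"
  shows "f \<in> borel_measurable M"
proof -
  obtain s where s: "\<And>i. simple_function M (s i)" "AE x in M. (\<lambda>i. s i x) \<longlonglongrightarrow> f x"
    using assms unfolding strongly_measurable_def by blast
  show ?thesis
    by (rule borel_measurable_AE_LIMSEQ[OF _ s(2)]) (intro borel_measurable_simple_function s)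
qed

lemma strongly_measurable_simple: "simple_function M f \<Longrightarrow> strongly_measurable M f"
  unfolding strongly_measurable_def by (intro exI[of _ "\<lambda>_. f"]) auto

lemma strongly_measurable_real:
  fixes f :: "'a \<Rightarrow> real"
  assumes "f \<in> borel_measurable M"
  shows "strongly_measurable M f"
proof -
  obtain s where "\<forall>i. simple_function M (s i)" "\<forall>x\<in>space M. (\<lambda>i. s i x) \<longlonglongrightarrow> f x"
    using borel_measurable_implies_sequence_metric[OF assms, of 0] by blast
  then show ?thesis
    unfolding strongly_measurable_def by (intro exI[of _ s]) simp
qed

lemma strongly_measurable_compose2:
  assumes f: "strongly_measurable M f" and g: "strongly_measurable M g"
    and h: "\<And>X Y a b. X \<longlonglongrightarrow> a \<Longrightarrow> Y \<longlonglongrightarrow> b \<Longrightarrow> (\<lambda>n. h (X n) (Y n)) \<longlonglongrightarrow> h a b"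
  shows "strongly_measurable M (\<lambda>x. h (f x) (g x))"
proof -
  obtain s t where s: "\<And>i. simple_function M (s i)" "AE x in M. (\<lambda>i. s i x) \<longlonglongrightarrow> f x"
    and t: "\<And>i. simple_function M (t i)" "AE x in M. (\<lambda>i. t i x) \<longlonglongrightarrow> g x"
    using f g unfolding strongly_measurable_def by blast
  have "AE x in M. (\<lambda>i. h (s i x) (t i x)) \<longlonglongrightarrow> h (f x) (g x)"
    using s(2) t(2) by eventually_elim (rule h)
  then show ?thesis
    unfolding strongly_measurable_def
    by (intro exI[of _ "\<lambda>i x. h (s i x) (t i x)"]) (auto intro: simple_function_compose2 s t)
qed

lemma strongly_measurable_add:
  "strongly_measurable M f \<Longrightarrow> strongly_measurable M g \<Longrightarrow> strongly_measurable M (\<lambda>x. f x + g x)"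
  by (rule strongly_measurable_compose2[where h="(+)"]) (auto intro: tendsto_add)

lemma strongly_measurable_diff:
  "strongly_measurable M f \<Longrightarrow> strongly_measurable M g \<Longrightarrow> strongly_measurable M (\<lambda>x. f x - g x)"
  by (rule strongly_measurable_compose2[where h="(-)"]) (auto intro: tendsto_diff)

lemma strongly_measurable_scaleR:
  fixes w :: "'a \<Rightarrow> real"
  shows "w \<in> borel_measurable M \<Longrightarrow> strongly_measurable M f \<Longrightarrow> strongly_measurable M (\<lambda>x. w x *\<^sub>R f x)"
  by (rule strongly_measurable_compose2[where h="(*\<^sub>R)"])
    (auto intro: tendsto_scaleR strongly_measurable_real)

lemma strongly_measurable_const: "strongly_measurable M (\<lambda>x. c)"
  by (intro strongly_measurable_simple) auto

lemma strongly_measurable_AE_eq: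
  assumes "strongly_measurable M f" "AE x in M. f x = g x"
  shows "strongly_measurable M g"
proof -
  obtain s where s: "\<And>i. simple_function M (s i)" "AE x in M. (\<lambda>i. s i x) \<longlonglongrightarrow> f x"
    using assms unfolding strongly_measurable_def by blast
  have "AE x in M. (\<lambda>i. s i x) \<longlonglongrightarrow> g x"
    using s(2) assms(2) by eventually_elim simp
  with s(1) show ?thesis unfolding strongly_measurable_def by blast
qed

lemma sets_nearest_eq:
  fixes f :: "'a \<Rightarrow> 'b::metric_space"
  assumes "\<And>j. (\<lambda>x. dist (f x) (y j)) \<in> borel_measurable M"
  shows "{x \<in> space M. nearest y m (f x) = j} \<in> sets M"
proof -
  note [measurable] = assms
  show ?thesis unfolding nearest_eq_iff by measurable
qed

lemma simple_function_nearest: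
  fixes f :: "'a \<Rightarrow> 'b::metric_space"
  assumes "\<And>j. (\<lambda>x. dist (f x) (y j)) \<in> borel_measurable M"
  shows "simple_function M (\<lambda>x. nearest y m (f x))"
  unfolding simple_function_def
proof (intro conjI ballI)
  show "finite ((\<lambda>x. nearest y m (f x)) ` space M)"
    by (rule finite_subset[of _ "{..m}"]) (auto simp: nearest_le)
  fix j
  have "(\<lambda>x. nearest y m (f x)) -` {j} \<inter> space M = {x \<in> space M. nearest y m (f x) = j}" by auto
  then show "(\<lambda>x. nearest y m (f x)) -` {j} \<inter> space M \<in> sets M"
    using sets_nearest_eq[OF assms] by simp
qed

lemma nearest_tendsto:
  fixes y :: "nat \<Rightarrow> 'b::metric_space"
  assumes "v \<in> closure (range y)"
  shows "(\<lambda>m. y (nearest y m v)) \<longlonglongrightarrow> v"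
proof (rule metric_LIMSEQ_I)
  fix e :: real assume "0 < e"
  then obtain j where j: "dist (y j) v < e"
    using assms unfolding closure_approachable by auto
  have "dist (y (nearest y m v)) v < e" if "m \<ge> j" for m
    using nearest_dist[OF that, of v y] j by (simp add: dist_commute)
  then show "\<exists>no. \<forall>n\<ge>no. dist (y (nearest y n v)) v < e" by blast
qed

text \<open>The sufficient half of Pettis' theorem, with measurable distances to a sequence instead
  of weak measurability: the nearest points among the first members of the sequence form simple
  functions that converge to \<open>f\<close>.\<close>

lemma strongly_measurableI:
  fixes f :: "'a \<Rightarrow> 'b::banach" and y :: "nat \<Rightarrow> 'b"
  assumes "AE x in M. f x \<in> closure (range y)" "\<And>j. (\<lambda>x. dist (f x) (y j)) \<in> borel_measurable M"
  shows "strongly_measurable M f"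
  unfolding strongly_measurable_def
proof (intro exI conjI allI)
  show "simple_function M (\<lambda>x. y (nearest y i (f x)))" for i
    using simple_function_compose1[OF simple_function_nearest[OF assms(2)]] .
  show "AE x in M. (\<lambda>i. y (nearest y i (f x))) \<longlonglongrightarrow> f x"
    using assms(1) by eventually_elim (rule nearest_tendsto)
qed

lemma strongly_measurable_separable:
  fixes f :: "'a \<Rightarrow> 'b::banach"
  assumes "strongly_measurable M f"
  obtains C where "countable C" "AE x in M. f x \<in> closure C"
proof -
  obtain s where s: "\<And>i. simple_function M (s i)" "AE x in M. (\<lambda>i. s i x) \<longlonglongrightarrow> f x"
    using assms unfolding strongly_measurable_def by blast
  show ?thesis
  proof (rule that[of "\<Union>i. s i ` space M"])
    show "countable (\<Union>i. s i ` space M)"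
      using simple_functionD(1)[OF s(1)] by (auto intro: countable_finite)
    show "AE x in M. f x \<in> closure (\<Union>i. s i ` space M)"
      using s(2) AE_space
    proof eventually_elim
      case (elim x)
      then show ?case unfolding closure_sequential by (intro exI[of _ "\<lambda>i. s i x"]) auto
    qed
  qed
qed

text \<open>A diagonal choice of simple functions is avoided: the limit has values in the closure of
  the countable union of the sets that carry the \<open>f i\<close>, and it is Borel measurable as
  an almost everywhere limit.\<close>

lemma strongly_measurable_AE_LIMSEQ:
  fixes f :: "nat \<Rightarrow> 'a \<Rightarrow> 'b::banach"
  assumes f: "\<And>i. strongly_measurable M (f i)" and lim: "AE x in M. (\<lambda>i. f i x) \<longlonglongrightarrow> g x"
  shows "strongly_measurable M g"
proof -
  have "\<exists>C. countable C \<and> (AE x in M. f i x \<in> closure C)" for i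
    using strongly_measurable_separable[OF f[of i]] by metis
  then obtain C where C: "\<And>i. countable (C i)" "\<And>i. AE x in M. f i x \<in> closure (C i)"
    by metis
  define Y where "Y = insert 0 (\<Union>i. C i)"
  have Y: "range (from_nat_into Y) = Y"
    by (rule range_from_nat_into) (use C in \<open>auto simp: Y_def\<close>)
  show ?thesis
  proof (rule strongly_measurableI)
    have "AE x in M. \<forall>i. f i x \<in> closure (C i)" using C(2) by (simp add: AE_all_countable)
    with lim show "AE x in M. g x \<in> closure (range (from_nat_into Y))"
    proof eventually_elim
      case (elim x)
      have "f i x \<in> closure Y" for i
        using elim(2) closure_mono[of "C i" Y] by (auto simp: Y_def)
      then show ?case unfolding Y by (intro closed_sequentially[OF closed_closure _ elim(1)])
    qed
    show "(\<lambda>x. dist (g x) (from_nat_into Y j)) \<in> borel_measurable M" for j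
    proof (rule borel_measurable_continuous_on[where f="\<lambda>v. dist v (from_nat_into Y j)"])
      show "g \<in> borel_measurable M"
        using borel_measurable_AE_LIMSEQ[OF strongly_measurable_imp_borel_measurable[OF f] lim] .
    qed (intro continuous_intros)
  qed
qed

section \<open>Norm estimates for simple functions and existence of the integral\<close>

lemma norm_borel_measurable: "strongly_measurable M f \<Longrightarrow> (\<lambda>x. norm (f x)) \<in> borel_measurable M"
  using borel_measurable_continuous_on[OF continuous_on_norm_id strongly_measurable_imp_borel_measurable] by blast

lemma simple_bochner_integrableI: "simple_function M s \<Longrightarrow> simple_vector_integrable M s"
  by (intro simple_bochner_integrable.intros) auto


lemma norm_simple_bochner_integral_le:
  assumes "simple_function M s"
  shows "ennreal (norm (simple_vector_integral M s)) \<le> (\<integral>\<^sup>+x. ennreal (norm (s x)) \<partial>M)"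
proof -
  have "ennreal (norm (simple_vector_integral M s))
      \<le> ennreal (simple_vector_integral M (\<lambda>x. norm (s x)))"
    by (intro ennreal_leI simple_bochner_integral_norm_bound simple_bochner_integrableI assms)
  also have "\<dots> = (\<integral>\<^sup>+x. ennreal (norm (s x)) \<partial>M)"
    by (intro simple_bochner_integral_eq_nn_integral simple_bochner_integrableI
        simple_function_compose1[OF assms]) auto
  finally show ?thesis .
qed

lemma norm_simple_bochner_integral_diff_le:
  assumes f: "strongly_measurable M f" and s: "simple_function M s" and t: "simple_function M t"
  shows "ennreal (norm (simple_vector_integral M s - simple_vector_integral M t))
    \<le> (\<integral>\<^sup>+x. ennreal (norm (f x - s x)) \<partial>M) + (\<integral>\<^sup>+x. ennreal (norm (f x - t x)) \<partial>M)"
proof -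
  have meas: "(\<lambda>x. norm (f x - s x)) \<in> borel_measurable M" "(\<lambda>x. norm (f x - t x)) \<in> borel_measurable M"
    by (intro norm_borel_measurable strongly_measurable_diff f strongly_measurable_simple s t)+
  have "ennreal (norm (simple_vector_integral M s - simple_vector_integral M t))
      = ennreal (norm (simple_vector_integral M (\<lambda>x. s x - t x)))"
    using s t by (subst simple_bochner_integral_diff) (auto intro: simple_bochner_integrableI)
  also have "\<dots> \<le> (\<integral>\<^sup>+x. ennreal (norm (s x - t x)) \<partial>M)"
    by (intro norm_simple_bochner_integral_le simple_function_compose2[OF s t])
  also have "\<dots> \<le> (\<integral>\<^sup>+x. ennreal (norm (f x - s x)) + ennreal (norm (f x - t x)) \<partial>M)"
  proof (intro nn_integral_mono)
    fix x
    have "norm (s x - t x) \<le> norm (f x - s x) + norm (f x - t x)"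
      by (metis norm_diff_triangle_le norm_minus_commute order_refl)
    then show "ennreal (norm (s x - t x)) \<le> ennreal (norm (f x - s x)) + ennreal (norm (f x - t x))"
      by (simp add: ennreal_leI flip: ennreal_plus)
  qed
  also have "\<dots> = (\<integral>\<^sup>+x. ennreal (norm (f x - s x)) \<partial>M) + (\<integral>\<^sup>+x. ennreal (norm (f x - t x)) \<partial>M)"
    using meas by (intro nn_integral_add) auto
  finally show ?thesis .
qed

lemma L1_function_iff:
  "L1_function M f \<longleftrightarrow> strongly_measurable M f \<and> integrable M (\<lambda>x. norm (f x))"
  unfolding L1_function_def integrable_iff_bounded by (auto dest: norm_borel_measurable)

lemma L1_function_bound:
  assumes "strongly_measurable M f" "integrable M w" "AE x in M. norm (f x) \<le> w x"
  shows "L1_function M f"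
  unfolding L1_function_iff
proof
  show "integrable M (\<lambda>x. norm (f x))"
    by (rule Bochner_Integration.integrable_bound[OF assms(2)])
      (use assms in \<open>auto intro: norm_borel_measurable elim!: eventually_mono\<close>)
qed fact

text \<open>The approximants take values in \<open>X\<close> so that the integral can be placed in a
  closed subspace. Convergence in norm is dominated convergence, for which the approximants are
  truncated.\<close>

lemma L1_function_simple_approximation:
  assumes f: "L1_function M f" and X: "closed X" "0 \<in> X" "AE x in M. f x \<in> X"
  obtains s where "\<And>i. simple_function M (s i)" "\<And>i x. s i x \<in> X"
    "(\<lambda>i. \<integral>\<^sup>+x. ennreal (norm (f x - s i x)) \<partial>M) \<longlonglongrightarrow> 0"
proof -
  have sm: "strongly_measurable M f" and int: "integrable M (\<lambda>x. norm (f x))"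
    using f by (auto simp: L1_function_iff)
  obtain s where s: "\<And>i. simple_function M (s i)" "AE x in M. (\<lambda>i. s i x) \<longlonglongrightarrow> f x"
    using sm unfolding strongly_measurable_def by blast
  \<comment> \<open>\<open>p\<close> moves a value into \<open>X\<close> at the cost of tripling its distance to \<open>f x \<in> X\<close>\<close>
  have "\<exists>p. p \<in> X \<and> dist p v \<le> 2 * infdist v X" for v
  proof (cases "v \<in> X")
    case False
    then have "infdist v X > 0"
      using X in_closed_iff_infdist_zero[of X v] infdist_nonneg[of v X] by force
    moreover have "infdist v X = (INF a\<in>X. dist v a)"
      using X(2) by (auto simp: infdist_def)
    ultimately have "(INF a\<in>X. dist v a) < 2 * infdist v X" by linarith
    then obtain a where "a \<in> X" "dist v a < 2 * infdist v X"
      using X by (subst (asm) cINF_less_iff) auto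
    then show ?thesis by (intro exI[of _ a]) (auto simp: dist_commute)
  qed (auto simp: infdist_nonneg)
  then obtain p where p: "\<And>v. p v \<in> X" "\<And>v. dist (p v) v \<le> 2 * infdist v X" by metis
  \<comment> \<open>Truncating at twice the norm of \<open>f x\<close> yields the majorant 3 |f x|.
    Since 2 > 1, the truncation is eventually inactive where \<open>f x \<noteq> 0\<close>, and
    where \<open>f x = 0\<close> it gives 0.\<close>
  define t where "t i x = (if norm (p (s i x)) \<le> 2 * norm (f x) then p (s i x) else 0)" for i x
  have t: "simple_function M (t i)" for i
  proof -
    have "(\<lambda>x. norm (p (s i x))) \<in> borel_measurable M"
      by (intro borel_measurable_simple_function simple_function_compose1[OF s(1)])
    with norm_borel_measurable[OF sm] have "{x \<in> space M. norm (p (s i x)) \<le> 2 * norm (f x)} \<in> sets M"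
      by measurable
    then show ?thesis unfolding t_def
      by (intro simple_function_If simple_function_compose1[OF s(1)]) auto
  qed
  have lim: "AE x in M. (\<lambda>i. norm (f x - t i x)) \<longlonglongrightarrow> 0"
    using s(2) X(3)
  proof eventually_elim
    case (elim x)
    have "(\<lambda>i. dist (s i x) (f x)) \<longlonglongrightarrow> 0" using elim(1) by (simp add: tendsto_dist_iff[symmetric])
    then have d0: "(\<lambda>i. 3 * dist (s i x) (f x)) \<longlonglongrightarrow> 0"
      using tendsto_mult_left[of _ 0 _ 3] by simp
    have "dist (p (s i x)) (f x) \<le> 3 * dist (s i x) (f x)" for i
      using p(2)[of "s i x"] infdist_le[OF elim(2), of "s i x"] dist_triangle[of "p (s i x)" "f x" "s i x"]
      by linarith
    then have "(\<lambda>i. dist (p (s i x)) (f x)) \<longlonglongrightarrow> 0"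
      by (intro tendsto_sandwich[OF _ _ tendsto_const d0]) auto
    then have plim: "(\<lambda>i. p (s i x)) \<longlonglongrightarrow> f x" by (simp add: tendsto_dist_iff[symmetric])
    have "(\<lambda>i. t i x) \<longlonglongrightarrow> f x"
    proof (cases "f x = 0")
      case True
      then have "t i x = 0" for i by (auto simp: t_def)
      then show ?thesis using True by simp
    next
      case False
      have "\<forall>\<^sub>F i in sequentially. norm (p (s i x)) < 2 * norm (f x)"
        using tendsto_norm[OF plim] by (rule order_tendstoD(2)) (use False in simp)
      then have "\<forall>\<^sub>F i in sequentially. p (s i x) = t i x"
        by eventually_elim (simp add: t_def)
      then show ?thesis by (rule Lim_transform_eventually[OF plim])
    qed
    then have "(\<lambda>i. norm (f x - t i x)) \<longlonglongrightarrow> norm (f x - f x)" by (intro tendsto_intros)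
    then show ?case by simp
  qed
  show ?thesis
  proof (rule that[of t])
    show "simple_function M (t i)" for i by (rule t)
    show "t i x \<in> X" for i x using p(1) X(2) by (simp add: t_def)
    have "(\<lambda>i. \<integral>\<^sup>+x. ennreal (norm (f x - t i x)) \<partial>M) \<longlonglongrightarrow> (\<integral>\<^sup>+x. 0 \<partial>M)"
    proof (rule nn_integral_dominated_convergence[where w="\<lambda>x. ennreal (3 * norm (f x))"])
      show "(\<lambda>x. ennreal (norm (f x - t i x))) \<in> borel_measurable M" for i
        using norm_borel_measurable[OF strongly_measurable_diff[OF sm strongly_measurable_simple[OF t]]] by simp
      show "(\<lambda>x. ennreal (3 * norm (f x))) \<in> borel_measurable M"
        using norm_borel_measurable[OF sm] by simp
      have "norm (f x - t i x) \<le> 3 * norm (f x)" for i x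
        using norm_triangle_ineq4[of "f x" "t i x"] norm_ge_zero[of "f x"]
        by (cases "norm (p (s i x)) \<le> 2 * norm (f x)") (auto simp: t_def)
      then show "AE x in M. ennreal (norm (f x - t i x)) \<le> ennreal (3 * norm (f x))" for i
        by (simp add: ennreal_leI)
      show "(\<integral>\<^sup>+x. ennreal (3 * norm (f x)) \<partial>M) < \<infinity>"
        using integrableD(2)[OF integrable_mult_right[OF int, of 3]] by (simp add: less_top)
      show "AE x in M. (\<lambda>i. ennreal (norm (f x - t i x))) \<longlonglongrightarrow> 0"
        using lim
      proof eventually_elim
        case (elim x)
        show ?case using tendsto_ennrealI[OF elim] by simp
      qed
    qed auto
    then show "(\<lambda>i. \<integral>\<^sup>+x. ennreal (norm (f x - t i x)) \<partial>M) \<longlonglongrightarrow> 0" by simp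
  qed
qed

lemma has_strong_bochner_integral_exists:
  assumes f: "L1_function M f" and X: "closed X" "subspace X" "AE x in M. f x \<in> X"
  shows "\<exists>v\<in>X. has_strong_bochner_integral M f v"
proof -
  obtain s where s: "\<And>i. simple_function M (s i)" "\<And>i x. s i x \<in> X"
    and lim: "(\<lambda>i. \<integral>\<^sup>+x. ennreal (norm (f x - s i x)) \<partial>M) \<longlonglongrightarrow> 0"
    using L1_function_simple_approximation[OF f X(1) subspace_0[OF X(2)] X(3)] by blast
  have sm: "strongly_measurable M f" using f by (simp add: L1_function_def)
  define I where "I i = simple_vector_integral M (s i)" for i
  have "Cauchy I"
  proof (rule metric_CauchyI)
    fix e :: real assume "0 < e"
    then have "\<forall>\<^sub>F i in sequentially. (\<integral>\<^sup>+x. ennreal (norm (f x - s i x)) \<partial>M) < ennreal (e / 2)"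
      by (intro order_tendstoD(2)[OF lim]) simp
    then obtain N where N: "\<And>i. i \<ge> N \<Longrightarrow> (\<integral>\<^sup>+x. ennreal (norm (f x - s i x)) \<partial>M) < ennreal (e / 2)"
      by (auto simp: eventually_sequentially)
    have "dist (I i) (I j) < e" if "i \<ge> N" "j \<ge> N" for i j
    proof -
      have "ennreal (norm (I i - I j)) \<le> (\<integral>\<^sup>+x. ennreal (norm (f x - s i x)) \<partial>M) + (\<integral>\<^sup>+x. ennreal (norm (f x - s j x)) \<partial>M)"
        unfolding I_def by (rule norm_simple_bochner_integral_diff_le[OF sm s(1) s(1)])
      also have "\<dots> < ennreal (e / 2) + ennreal (e / 2)"
        by (intro add_strict_mono N that)
      also have "\<dots> = ennreal e" using \<open>0 < e\<close> by (subst ennreal_plus[symmetric]) auto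
      finally show ?thesis using \<open>0 < e\<close> by (simp add: dist_norm ennreal_less_iff)
    qed
    then show "\<exists>N. \<forall>i\<ge>N. \<forall>j\<ge>N. dist (I i) (I j) < e" by blast
  qed
  then obtain v where v: "I \<longlonglongrightarrow> v" by (auto simp: Cauchy_convergent_iff convergent_def)
  have "I i \<in> X" for i
    unfolding I_def Bochner_Integration.simple_bochner_integral_def
    by (intro subspace_sum[OF X(2)] subspace_scale[OF X(2)]) (use s(2) in auto)
  then have "v \<in> X" using closed_sequentially[OF X(1) _ v] by blast
  moreover have "has_strong_bochner_integral M f v"
    unfolding has_strong_bochner_integral_def
    by (intro conjI sm exI[of _ s] allI simple_bochner_integrableI s(1) lim v[unfolded I_def])
  ultimately show ?thesis by blast
qed

lemma has_strong_bochner_integral_norm_le: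
  assumes "has_strong_bochner_integral M f v"
  shows "ennreal (norm v) \<le> (\<integral>\<^sup>+x. ennreal (norm (f x)) \<partial>M)"
proof -
  obtain s where sm: "strongly_measurable M f" and s: "\<And>i. simple_vector_integrable M (s i)"
    and lim: "(\<lambda>i. \<integral>\<^sup>+x. ennreal (norm (f x - s i x)) \<partial>M) \<longlonglongrightarrow> 0"
    and v: "(\<lambda>i. simple_vector_integral M (s i)) \<longlonglongrightarrow> v"
    using assms unfolding has_strong_bochner_integral_def by blast
  have sf: "simple_function M (s i)" for i using s by (rule simple_bochner_integrable.cases)
  have "ennreal (norm (simple_vector_integral M (s i)))
      \<le> (\<integral>\<^sup>+x. ennreal (norm (f x)) \<partial>M) + (\<integral>\<^sup>+x. ennreal (norm (f x - s i x)) \<partial>M)" for i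
  proof -
    have "ennreal (norm (simple_vector_integral M (s i))) \<le> (\<integral>\<^sup>+x. ennreal (norm (s i x)) \<partial>M)"
      by (rule norm_simple_bochner_integral_le[OF sf])
    also have "\<dots> \<le> (\<integral>\<^sup>+x. ennreal (norm (f x)) + ennreal (norm (f x - s i x)) \<partial>M)"
    proof (intro nn_integral_mono)
      fix x
      have "norm (s i x) \<le> norm (f x) + norm (f x - s i x)"
        using norm_triangle_ineq4[of "f x" "f x - s i x"] by simp
      then show "ennreal (norm (s i x)) \<le> ennreal (norm (f x)) + ennreal (norm (f x - s i x))"
        by (simp add: ennreal_leI flip: ennreal_plus)
    qed
    also have "\<dots> = (\<integral>\<^sup>+x. ennreal (norm (f x)) \<partial>M) + (\<integral>\<^sup>+x. ennreal (norm (f x - s i x)) \<partial>M)"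
      using norm_borel_measurable[OF sm]
        norm_borel_measurable[OF strongly_measurable_diff[OF sm strongly_measurable_simple[OF sf[of i]]]]
      by (intro nn_integral_add) auto
    finally show ?thesis .
  qed
  note le = this
  have 1: "(\<lambda>i. ennreal (norm (simple_vector_integral M (s i)))) \<longlonglongrightarrow> ennreal (norm v)"
    by (intro tendsto_ennrealI tendsto_norm v)
  have 2: "(\<lambda>i. (\<integral>\<^sup>+x. ennreal (norm (f x)) \<partial>M) + (\<integral>\<^sup>+x. ennreal (norm (f x - s i x)) \<partial>M))
      \<longlonglongrightarrow> (\<integral>\<^sup>+x. ennreal (norm (f x)) \<partial>M) + 0"
    by (intro tendsto_add tendsto_const lim)
  show ?thesis
    using LIMSEQ_le[OF 1 2] le by simp
qed

section \<open>Linearity and uniqueness of the integral\<close>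

lemma has_strong_bochner_integral_add:
  assumes "has_strong_bochner_integral M f v" "has_strong_bochner_integral M g w"
  shows "has_strong_bochner_integral M (\<lambda>x. f x + g x) (v + w)"
proof -
  obtain s where f: "strongly_measurable M f" and s: "\<And>i. simple_vector_integrable M (s i)"
    and fs: "(\<lambda>i. \<integral>\<^sup>+x. ennreal (norm (f x - s i x)) \<partial>M) \<longlonglongrightarrow> 0"
    and v: "(\<lambda>i. simple_vector_integral M (s i)) \<longlonglongrightarrow> v"
    using assms(1) unfolding has_strong_bochner_integral_def by blast
  obtain t where g: "strongly_measurable M g" and t: "\<And>i. simple_vector_integrable M (t i)"
    and gt: "(\<lambda>i. \<integral>\<^sup>+x. ennreal (norm (g x - t i x)) \<partial>M) \<longlonglongrightarrow> 0"
    and w: "(\<lambda>i. simple_vector_integral M (t i)) \<longlonglongrightarrow> w"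
    using assms(2) unfolding has_strong_bochner_integral_def by blast
  have sf: "simple_function M (s i)" "simple_function M (t i)" for i
    using s[of i] t[of i] by (auto elim: simple_bochner_integrable.cases)
  have le: "(\<integral>\<^sup>+x. ennreal (norm (f x + g x - (s i x + t i x))) \<partial>M)
      \<le> (\<integral>\<^sup>+x. ennreal (norm (f x - s i x)) \<partial>M) + (\<integral>\<^sup>+x. ennreal (norm (g x - t i x)) \<partial>M)" for i
  proof -
    have "(\<integral>\<^sup>+x. ennreal (norm (f x + g x - (s i x + t i x))) \<partial>M)
        \<le> (\<integral>\<^sup>+x. ennreal (norm (f x - s i x)) + ennreal (norm (g x - t i x)) \<partial>M)"
      by (intro nn_integral_mono) (simp add: ennreal_leI norm_diff_triangle_ineq flip: ennreal_plus)
    also have "\<dots> = (\<integral>\<^sup>+x. ennreal (norm (f x - s i x)) \<partial>M) + (\<integral>\<^sup>+x. ennreal (norm (g x - t i x)) \<partial>M)"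
      using norm_borel_measurable[OF strongly_measurable_diff[OF f strongly_measurable_simple[OF sf(1)[of i]]]]
        norm_borel_measurable[OF strongly_measurable_diff[OF g strongly_measurable_simple[OF sf(2)[of i]]]]
      by (intro nn_integral_add) auto
    finally show ?thesis .
  qed
  have lim: "(\<lambda>i. \<integral>\<^sup>+x. ennreal (norm (f x + g x - (s i x + t i x))) \<partial>M) \<longlonglongrightarrow> 0"
  proof (rule tendsto_sandwich[OF _ _ tendsto_const, rotated 2])
    show "(\<lambda>i. (\<integral>\<^sup>+x. ennreal (norm (f x - s i x)) \<partial>M) + (\<integral>\<^sup>+x. ennreal (norm (g x - t i x)) \<partial>M)) \<longlonglongrightarrow> 0"
      using tendsto_add[OF fs gt] unfolding add_0 .
  qed (rule always_eventually, rule allI, rule le zero_le)+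
  have int: "(\<lambda>i. simple_vector_integral M (\<lambda>x. s i x + t i x)) \<longlonglongrightarrow> v + w"
    using tendsto_add[OF v w] s t by (simp add: simple_bochner_integral_add)
  show ?thesis
    unfolding has_strong_bochner_integral_def
    by (intro conjI strongly_measurable_add f g exI[of _ "\<lambda>i x. s i x + t i x"] allI lim int
        simple_bochner_integrableI simple_function_compose2[OF sf])
qed

lemma has_strong_bochner_integral_bounded_linear:
  assumes "bounded_linear h" "has_strong_bochner_integral M f v"
  shows "has_strong_bochner_integral M (\<lambda>x. h (f x)) (h v)"
proof -
  interpret bounded_linear h by fact
  obtain s where f: "strongly_measurable M f" and s: "\<And>i. simple_vector_integrable M (s i)"
    and fs: "(\<lambda>i. \<integral>\<^sup>+x. ennreal (norm (f x - s i x)) \<partial>M) \<longlonglongrightarrow> 0"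
    and v: "(\<lambda>i. simple_vector_integral M (s i)) \<longlonglongrightarrow> v"
    using assms(2) unfolding has_strong_bochner_integral_def by blast
  have sf: "simple_function M (s i)" for i using s[of i] by (auto elim: simple_bochner_integrable.cases)
  obtain K where K: "K > 0" "\<And>x. norm (h x) \<le> norm x * K" using pos_bounded by blast
  have hf: "strongly_measurable M (\<lambda>x. h (f x))"
    by (rule strongly_measurable_compose2[OF f f, where h="\<lambda>a b. h a"]) (rule tendsto)
  have le: "(\<integral>\<^sup>+x. ennreal (norm (h (f x) - h (s i x))) \<partial>M) \<le> ennreal K * (\<integral>\<^sup>+x. ennreal (norm (f x - s i x)) \<partial>M)" for i
  proof -
    have "(\<integral>\<^sup>+x. ennreal (norm (h (f x) - h (s i x))) \<partial>M) \<le> (\<integral>\<^sup>+x. ennreal K * ennreal (norm (f x - s i x)) \<partial>M)"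
      using K by (intro nn_integral_mono) (simp add: diff[symmetric] ennreal_leI mult.commute flip: ennreal_mult)
    also have "\<dots> = ennreal K * (\<integral>\<^sup>+x. ennreal (norm (f x - s i x)) \<partial>M)"
      using norm_borel_measurable[OF strongly_measurable_diff[OF f strongly_measurable_simple[OF sf[of i]]]]
      by (intro nn_integral_cmult) auto
    finally show ?thesis .
  qed
  have fsK: "(\<lambda>i. ennreal K * (\<integral>\<^sup>+x. ennreal (norm (f x - s i x)) \<partial>M)) \<longlonglongrightarrow> ennreal K * 0"
    by (intro ennreal_tendsto_cmult fs) auto
  have lim: "(\<lambda>i. \<integral>\<^sup>+x. ennreal (norm (h (f x) - h (s i x))) \<partial>M) \<longlonglongrightarrow> 0"
  proof (rule tendsto_sandwich[OF _ _ tendsto_const, rotated 2])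
    show "(\<lambda>i. ennreal K * (\<integral>\<^sup>+x. ennreal (norm (f x - s i x)) \<partial>M)) \<longlonglongrightarrow> 0"
      using fsK unfolding mult_zero_right .
  qed (rule always_eventually, rule allI, rule le zero_le)+
  have int: "(\<lambda>i. simple_vector_integral M (\<lambda>x. h (s i x))) \<longlonglongrightarrow> h v"
    using tendsto[OF v] s linear_axioms by (simp add: simple_bochner_integral_linear)
  show ?thesis
    unfolding has_strong_bochner_integral_def
    by (intro conjI hf exI[of _ "\<lambda>i x. h (s i x)"] allI lim int simple_bochner_integrableI
        simple_function_compose1[OF sf])
qed

lemma has_strong_bochner_integral_unique:
  assumes "has_strong_bochner_integral M f v" "has_strong_bochner_integral M f w"
  shows "v = w"
proof -
  have "has_strong_bochner_integral M (\<lambda>x. f x + - f x) (v + - w)"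
    by (rule has_strong_bochner_integral_add[OF assms(1)
        has_strong_bochner_integral_bounded_linear[OF bounded_linear_minus[OF bounded_linear_ident] assms(2)]])
  from has_strong_bochner_integral_norm_le[OF this] have "ennreal (norm (v - w)) \<le> 0" by simp
  then show ?thesis by simp
qed

lemma bochner_integral_eqI:
  "has_strong_bochner_integral M f v \<Longrightarrow> bochner_integral M f = v"
  unfolding bochner_integral_def using has_strong_bochner_integral_unique by blast

lemma has_strong_bochner_integral_bochner_integral:
  assumes "L1_function M f"
  shows "has_strong_bochner_integral M f (bochner_integral M f)"
  using has_strong_bochner_integral_exists[OF assms, of UNIV] bochner_integral_eqI by auto

lemma bochner_integral_in_closed_subspace:
  assumes "L1_function M f" "closed X" "subspace X" "AE x in M. f x \<in> X"
  shows "bochner_integral M f \<in> X"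
  using has_strong_bochner_integral_exists[OF assms] bochner_integral_eqI by auto

lemma norm_bochner_integral_le:
  assumes "L1_function M f"
  shows "norm (bochner_integral M f) \<le> (LINT x|M. norm (f x))"
proof -
  have "integrable M (\<lambda>x. norm (f x))" using assms by (simp add: L1_function_iff)
  then have "(\<integral>\<^sup>+x. ennreal (norm (f x)) \<partial>M) = ennreal (LINT x|M. norm (f x))"
    by (intro nn_integral_eq_integral) auto
  then have "ennreal (norm (bochner_integral M f)) \<le> ennreal (LINT x|M. norm (f x))"
    using has_strong_bochner_integral_norm_le[OF has_strong_bochner_integral_bochner_integral[OF assms]] by simp
  then show ?thesis by (subst (asm) ennreal_le_iff) auto
qed

lemma L1_function_add: "L1_function M f \<Longrightarrow> L1_function M g \<Longrightarrow> L1_function M (\<lambda>x. f x + g x)"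
  using L1_function_bound[of "\<lambda>x. f x + g x" "\<lambda>x. norm (f x) + norm (g x)"]
  by (auto simp: L1_function_iff strongly_measurable_add norm_triangle_ineq)

lemma L1_function_scaleR_const: "L1_function M f \<Longrightarrow> L1_function M (\<lambda>x. c *\<^sub>R f x)"
  by (auto simp: L1_function_iff strongly_measurable_scaleR)

lemma bochner_integral_add:
  assumes "L1_function M f" "L1_function M g"
  shows "bochner_integral M (\<lambda>x. f x + g x) = bochner_integral M f + bochner_integral M g"
  by (rule bochner_integral_eqI[OF has_strong_bochner_integral_add[OF assms[THEN has_strong_bochner_integral_bochner_integral]]])

lemma bochner_integral_scaleR:
  assumes "L1_function M f"
  shows "bochner_integral M (\<lambda>x. c *\<^sub>R f x) = c *\<^sub>R bochner_integral M f"
  by (rule bochner_integral_eqI[OF has_strong_bochner_integral_bounded_linear[OF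
      bounded_linear_scaleR_right has_strong_bochner_integral_bochner_integral[OF assms]]])

lemma L1_function_diff: "L1_function M f \<Longrightarrow> L1_function M g \<Longrightarrow> L1_function M (\<lambda>x. f x - g x)"
  using L1_function_add[of f "\<lambda>x. - 1 *\<^sub>R g x"] L1_function_scaleR_const[of g "- 1"] by simp

lemma bochner_integral_diff:
  assumes "L1_function M f" "L1_function M g"
  shows "bochner_integral M (\<lambda>x. f x - g x) = bochner_integral M f - bochner_integral M g"
  using bochner_integral_add[OF assms(1) L1_function_scaleR_const[OF assms(2), of "- 1"]]
    bochner_integral_scaleR[OF assms(2), of "- 1"] by simp

lemma L1_function_zero: "L1_function M (\<lambda>x. 0)"
  by (simp add: L1_function_iff strongly_measurable_const)

lemma bochner_integral_zero: "bochner_integral M (\<lambda>x. 0) = 0"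
  using bochner_integral_scaleR[OF L1_function_zero, of 0] by simp

lemma bochner_integral_sum:
  fixes f :: "'i \<Rightarrow> 'a \<Rightarrow> 'b::banach"
  assumes "finite I" "\<And>i. i \<in> I \<Longrightarrow> L1_function M (f i)"
  shows "L1_function M (\<lambda>x. \<Sum>i\<in>I. f i x) \<and>
    bochner_integral M (\<lambda>x. \<Sum>i\<in>I. f i x) = (\<Sum>i\<in>I. bochner_integral M (f i))"
  using assms
  by (induction I rule: finite_induct)
    (auto simp: L1_function_zero bochner_integral_zero bochner_integral_add intro: L1_function_add)

lemma bochner_integral_AE_eq:
  assumes "L1_function M f" "AE x in M. f x = g x"
  shows "L1_function M g" "bochner_integral M g = bochner_integral M f"
proof -
  have "AE x in M. norm (g x) \<le> norm (f x)" using assms(2) by eventually_elim simp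
  then show g: "L1_function M g"
    using assms by (intro L1_function_bound[of g "\<lambda>x. norm (f x)"])
      (auto simp: L1_function_iff intro: strongly_measurable_AE_eq)
  have "norm (bochner_integral M g - bochner_integral M f) \<le> (LINT x|M. norm (g x - f x))"
    unfolding bochner_integral_diff[OF g assms(1), symmetric]
    by (intro norm_bochner_integral_le L1_function_diff g assms)
  also have "\<dots> = (LINT x|M. 0)"
  proof (rule integral_cong_AE)
    show "(\<lambda>x. norm (g x - f x)) \<in> borel_measurable M"
      using L1_function_diff[OF g assms(1)] by (auto simp: L1_function_iff)
  qed (use assms(2) in auto)
  finally show "bochner_integral M g = bochner_integral M f" by simp
qed

lemma norm_bochner_integral_diff_le:
  assumes "L1_function M f" "L1_function M g" "integrable M w" "AE x in M. norm (f x - g x) \<le> w x"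
  shows "norm (bochner_integral M f - bochner_integral M g) \<le> (LINT x|M. w x)"
proof -
  have "norm (bochner_integral M f - bochner_integral M g) \<le> (LINT x|M. norm (f x - g x))"
    unfolding bochner_integral_diff[OF assms(1,2), symmetric]
    by (intro norm_bochner_integral_le L1_function_diff assms)
  also have "\<dots> \<le> (LINT x|M. w x)"
    using L1_function_diff[OF assms(1,2)] assms by (intro integral_mono_AE) (auto simp: L1_function_iff)
  finally show ?thesis .
qed

end

section \<open>Strongly continuous semigroups\<close>

text \<open>Baire's theorem: the open sets \<open>G k\<close>, where some \<open>S n x\<close>
  exceeds k in norm, have empty intersection, so one of them is not dense. On a ball that misses it
  all \<open>S n\<close> are bounded by k, and scaling turns this into a bound for the operator
  norms.\<close>

lemma banach_steinhaus_sequence: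
  fixes S :: "nat \<Rightarrow> 'a::banach \<Rightarrow>\<^sub>L 'b::real_normed_vector"
  assumes "\<And>x. \<exists>B. \<forall>n. norm (S n x) \<le> B"
  shows "\<exists>B. \<forall>n. norm (S n) \<le> B"
proof -
  define G where "G k = {x. \<exists>n. norm (S n x) > real k}" for k
  have op: "open (G k)" for k
  proof -
    have "G k = (\<Union>n. {x. real k < norm (S n x)})" by (auto simp: G_def)
    moreover have "open {x. real k < norm (S n x)}" for n
      by (intro open_Collect_less continuous_intros)
    ultimately show ?thesis by auto
  qed
  have "\<exists>k. closure (G k) \<noteq> UNIV"
  proof (rule ccontr)
    assume "\<not> ?thesis"
    then have dense: "closure (G k) = UNIV" for k by blast
    have "euclidean closure_of \<Inter> (range G) = (UNIV :: 'a set)"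
      unfolding mtopology_is_euclidean[symmetric]
    proof (rule Met_TC.metric_Baire_category)
      show "openin Met_TC.mtopology X \<and> Met_TC.mtopology closure_of X = UNIV" if "X \<in> range G" for X
        using that op dense by (auto simp: mtopology_is_euclidean)
    qed (auto simp: complete_UNIV)
    then have "\<Inter> (range G) \<noteq> {}" by auto
    then obtain x where x: "\<And>k. x \<in> G k" by blast
    obtain B where B: "\<And>n. norm (S n x) \<le> B" using assms[of x] by blast
    obtain k where "B < real k" using reals_Archimedean2 by blast
    moreover obtain n where "norm (S n x) > real k" using x[of k] unfolding G_def by blast
    ultimately show False using B[of n] by simp
  qed
  then obtain k x0 where "x0 \<notin> closure (G k)" by blast
  then obtain e where e: "e > 0" "\<And>y. y \<in> G k \<Longrightarrow> \<not> dist y x0 < e"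
    unfolding closure_approachable by blast
  have bound: "norm (S n y) \<le> real k" if "dist y x0 < e" for n y
  proof (rule ccontr)
    assume "\<not> norm (S n y) \<le> real k"
    then have "y \<in> G k" by (auto simp: G_def not_le)
    with e(2) that show False by blast
  qed
  have "norm (S n) \<le> 4 * real k / e" for n
  proof (rule norm_blinfun_bound)
    show "0 \<le> 4 * real k / e" using e by simp
    fix x
    show "norm (S n x) \<le> 4 * real k / e * norm x"
    proof (cases "x = 0")
      case False
      \<comment> \<open>The factor keeps the shifted point in the ball: its distance to the center
        is e / 2. The bound 2 k for the difference, divided by \<open>c\<close>, gives the constant
        4 k / e.\<close>
      define c where "c = e / (2 * norm x)"
      have c: "c > 0" using False e by (simp add: c_def)
      have "dist (x0 + c *\<^sub>R x) x0 < e" using False e by (simp add: dist_norm c_def)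
      moreover have "dist x0 x0 < e" using e by simp
      ultimately have "norm (S n (x0 + c *\<^sub>R x)) \<le> real k" "norm (S n x0) \<le> real k"
        using bound[of "x0 + c *\<^sub>R x" n] bound[of x0 n] by blast+
      moreover have "c * norm (S n x) = norm (S n (x0 + c *\<^sub>R x) - S n x0)"
        using c by (simp add: blinfun.add_right blinfun.scaleR_right)
      ultimately have "c * norm (S n x) \<le> 2 * real k"
        using norm_triangle_ineq4[of "S n (x0 + c *\<^sub>R x)" "S n x0"] by linarith
      then have "norm (S n x) \<le> 2 * real k / c" using c by (simp add: pos_le_divide_eq mult.commute)
      also have "\<dots> = 4 * real k / e * norm x" using False e by (simp add: c_def)
      finally show ?thesis .
    qed simp
  qed
  then show ?thesis by blast
qed

text \<open>Strong continuity bounds each orbit near 0 only separately. Without a common bound,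
  operators at times tending to 0 would have unbounded norms although all their orbits converge,
  against uniform boundedness.\<close>

lemma C0_semigroup_bounded_near_0:
  assumes "C0_semigroup U"
  obtains \<delta> B where "\<delta> > 0" "B \<ge> 1" "\<And>h. 0 \<le> h \<Longrightarrow> h \<le> \<delta> \<Longrightarrow> norm (U h) \<le> B"
proof -
  have lim: "((\<lambda>t. U t x) \<longlongrightarrow> x) (at_right 0)" and U0: "U 0 = id_blinfun" for x
    using assms by (auto simp: C0_semigroup_def)
  have "\<exists>n. \<forall>h. 0 \<le> h \<and> h \<le> 1 / Suc n \<longrightarrow> norm (U h) \<le> real n"
  proof (rule ccontr)
    assume "\<not> ?thesis"
    then have "\<forall>n. \<exists>h. 0 \<le> h \<and> h \<le> 1 / Suc n \<and> \<not> norm (U h) \<le> real n" by blast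
    then obtain h where h: "\<And>n. 0 \<le> h n" "\<And>n. h n \<le> 1 / Suc n" "\<And>n. \<not> norm (U (h n)) \<le> real n" by metis
    have h0: "h \<longlonglongrightarrow> 0"
    proof (rule tendsto_sandwich[OF _ _ tendsto_const])
      show "(\<lambda>n. 1 / real (Suc n)) \<longlonglongrightarrow> 0" using LIMSEQ_inverse_real_of_nat by (simp add: inverse_eq_divide)
    qed (use h in auto)
    have "\<exists>B. \<forall>n. norm (U (h n) x) \<le> B" for x
    proof -
      have "(\<lambda>n. U (h n) x) \<longlonglongrightarrow> x"
      proof (rule tendstoI)
        fix e :: real assume "e > 0"
        then have "\<forall>\<^sub>F t in at_right 0. dist (U t x) x < e" by (rule tendstoD[OF lim])
        then obtain b where b: "b > 0" "\<And>t. 0 < t \<Longrightarrow> t < b \<Longrightarrow> dist (U t x) x < e"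
          unfolding eventually_at_right_field by blast
        have "\<forall>\<^sub>F n in sequentially. h n < b" by (rule order_tendstoD(2)[OF h0 b(1)])
        then show "\<forall>\<^sub>F n in sequentially. dist (U (h n) x) x < e"
        proof eventually_elim
          case (elim n)
          show ?case
          proof (cases "h n = 0")
            case True then show ?thesis using U0 \<open>e > 0\<close> by simp
          next
            case False
            then show ?thesis using b(2)[of "h n"] h(1)[of n] elim by simp
          qed
        qed
      qed
      then have "Bseq (\<lambda>n. U (h n) x)" by (rule convergent_imp_Bseq[OF convergentI])
      then show ?thesis unfolding Bseq_def by blast
    qed
    then obtain B where B: "\<And>n. norm (U (h n)) \<le> B"
      using banach_steinhaus_sequence[of "\<lambda>n. U (h n)"] by blast
    obtain n where "B < real n" using reals_Archimedean2 by blast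
    with B[of n] h(3)[of n] show False by simp
  qed
  then obtain n where n: "\<And>h. 0 \<le> h \<Longrightarrow> h \<le> 1 / Suc n \<Longrightarrow> norm (U h) \<le> real n" by blast
  show ?thesis
  proof (rule that[of "1 / Suc n" "max 1 (real n)"])
    show "norm (U h) \<le> max 1 (real n)" if "0 \<le> h" "h \<le> 1 / Suc n" for h
      using n[OF that] by simp
  qed auto
qed

text \<open>Splitting off steps of length \<delta> bounds the norm by a power of \<open>B\<close>.
  Only this makes the supremum that defines \<open>M\<close> in the theorem an actual bound.\<close>

lemma C0_semigroup_bdd:
  assumes "C0_semigroup U"
  shows "bdd_above ((\<lambda>t. norm (U t)) ` {0..T})"
proof -
  obtain \<delta> B where \<delta>: "\<delta> > 0" and B: "B \<ge> 1" "\<And>h. 0 \<le> h \<Longrightarrow> h \<le> \<delta> \<Longrightarrow> norm (U h) \<le> B"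
    using C0_semigroup_bounded_near_0[OF assms] by blast
  have U: "U (s + t) = U s o\<^sub>L U t" if "s \<ge> 0" "t \<ge> 0" for s t
    using assms that by (auto simp: C0_semigroup_def)
  have *: "norm (U t) \<le> B ^ Suc n" if "0 \<le> t" "t \<le> real (Suc n) * \<delta>" for n t
    using that
  proof (induction n arbitrary: t)
    case 0
    then show ?case using B by simp
  next
    case (Suc n)
    show ?case
    proof (cases "t \<le> \<delta>")
      case True
      then have "norm (U t) \<le> B" using B(2) Suc.prems by blast
      also have "\<dots> \<le> B ^ Suc (Suc n)" using B(1) self_le_power[of B "Suc (Suc n)"] by simp
      finally show ?thesis .
    next
      case False
      then have t: "0 \<le> t - \<delta>" "t - \<delta> \<le> real (Suc n) * \<delta>" using Suc.prems by (auto simp: algebra_simps)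
      have "U t = U \<delta> o\<^sub>L U (t - \<delta>)" using U[of \<delta> "t - \<delta>"] t \<delta> by simp
      then have "norm (U t) \<le> norm (U \<delta>) * norm (U (t - \<delta>))" by (simp add: norm_blinfun_compose)
      also have "\<dots> \<le> B * B ^ Suc n"
        using B \<delta> Suc.IH[OF t] by (intro mult_mono) auto
      finally show ?thesis by simp
    qed
  qed
  obtain n where n: "T / \<delta> < real n" using reals_Archimedean2 by blast
  have "norm (U t) \<le> B ^ Suc n" if "t \<in> {0..T}" for t
  proof (rule *)
    have "t \<le> T" using that by simp
    also have "T \<le> real n * \<delta>" using n \<delta> by (simp add: pos_divide_less_eq)
    also have "\<dots> \<le> real (Suc n) * \<delta>" using \<delta> by (intro mult_right_mono) auto
    finally show "t \<le> real (Suc n) * \<delta>" .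
  qed (use that in auto)
  then show ?thesis by (intro bdd_aboveI2)
qed

locale semigroup_on_interval =
  fixes U :: "real \<Rightarrow> 'e::banach \<Rightarrow>\<^sub>L 'e" and T M :: real
  assumes T_pos: "T > 0" and C0: "C0_semigroup U"
    and norm_U: "\<And>t. 0 \<le> t \<Longrightarrow> t \<le> T \<Longrightarrow> norm (U t) \<le> M" and M_pos: "M > 0"
begin

sublocale lebesgue: finite_complete_measure "lebesgue_on {0..T}"
  by (rule finite_complete_measure_lebesgue_on)

lemma norm_U_apply: "0 \<le> t \<Longrightarrow> t \<le> T \<Longrightarrow> norm (U t x) \<le> M * norm x"
  using norm_blinfun[of "U t" x] norm_U[of t] by (meson mult_right_mono norm_ge_zero order_trans)

lemma U_add: "s \<ge> 0 \<Longrightarrow> t \<ge> 0 \<Longrightarrow> U (s + t) x = U s (U t x)"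
  using C0 by (auto simp: C0_semigroup_def)

lemma U_0: "U 0 x = x"
  using C0 by (auto simp: C0_semigroup_def)

text \<open>Right continuity at 0 gives continuity from both sides: for t \<le> s the difference is
  \<open>U t\<close> applied to \<open>U (s - t) x - x\<close>, and \<open>U t\<close> is bounded by
  \<open>M\<close>.\<close>

lemma U_modulus:
  assumes "e > 0"
  obtains \<delta> where "\<delta> > 0"
    "\<And>s t. 0 \<le> s \<Longrightarrow> s \<le> T \<Longrightarrow> 0 \<le> t \<Longrightarrow> t \<le> T \<Longrightarrow> \<bar>s - t\<bar> < \<delta> \<Longrightarrow> norm (U s x - U t x) \<le> e"
proof -
  have "((\<lambda>t. U t x) \<longlongrightarrow> x) (at_right 0)" using C0 by (auto simp: C0_semigroup_def)
  then have "\<forall>\<^sub>F t in at_right 0. dist (U t x) x < e / M"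
    by (rule tendstoD) (use assms M_pos in simp)
  then obtain b where b: "b > 0" "\<And>t. 0 < t \<Longrightarrow> t < b \<Longrightarrow> dist (U t x) x < e / M"
    unfolding eventually_at_right_field by blast
  have b': "norm (U h x - x) \<le> e / M" if "0 \<le> h" "h < b" for h
    using b(2)[of h] that assms M_pos by (cases "h = 0") (auto simp: U_0 dist_norm)
  have *: "norm (U s x - U t x) \<le> e" if "0 \<le> t" "t \<le> s" "s \<le> T" "s - t < b" for s t
  proof -
    have "U s x - U t x = U t (U (s - t) x - x)"
      using U_add[of t "s - t" x] that by (simp add: blinfun.diff_right)
    then have "norm (U s x - U t x) \<le> M * norm (U (s - t) x - x)"
      using norm_U_apply[of t "U (s - t) x - x"] that by simp
    also have "\<dots> \<le> M * (e / M)" using b'[of "s - t"] that M_pos by (intro mult_left_mono) auto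
    finally show ?thesis using M_pos by simp
  qed
  show ?thesis
  proof (rule that[OF b(1)])
    fix s t assume "0 \<le> s" "s \<le> T" "0 \<le> t" "t \<le> T" "\<bar>s - t\<bar> < b"
    then show "norm (U s x - U t x) \<le> e"
      using *[of t s] *[of s t] by (cases "t \<le> s") (auto simp: norm_minus_commute)
  qed
qed

lemma U_tendsto:
  assumes "s \<longlonglongrightarrow> t" "\<And>n. 0 \<le> s n \<and> s n \<le> T" "0 \<le> t" "t \<le> T"
  shows "(\<lambda>n. U (s n) x) \<longlonglongrightarrow> U t x"
proof (rule LIMSEQ_I)
  fix e :: real assume "e > 0"
  then obtain \<delta> where \<delta>: "\<delta> > 0"
    "\<And>s t. 0 \<le> s \<Longrightarrow> s \<le> T \<Longrightarrow> 0 \<le> t \<Longrightarrow> t \<le> T \<Longrightarrow> \<bar>s - t\<bar> < \<delta> \<Longrightarrow> norm (U s x - U t x) \<le> e / 2"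
    using U_modulus[of "e / 2" x] by auto
  obtain N where "\<And>n. n \<ge> N \<Longrightarrow> norm (s n - t) < \<delta>" using LIMSEQ_D[OF assms(1) \<delta>(1)] by blast
  then have "norm (U (s n) x - U t x) < e" if "n \<ge> N" for n
    using \<delta>(2)[of "s n" t] assms that \<open>e > 0\<close> by (smt (verit) field_sum_of_halves real_norm_def)
  then show "\<exists>N. \<forall>n\<ge>N. norm (U (s n) x - U t x) < e" by blast
qed

text \<open>The extension by 0 to the whole interval lets all t share one measure space, so that
  integrals for different t can be compared.\<close>

definition kernel :: "(real \<Rightarrow> 'e) \<Rightarrow> real \<Rightarrow> real \<Rightarrow> 'e" where
  "kernel f t s = (if s \<le> t then U (t - s) (f s) else 0)"

definition mild :: "(real \<Rightarrow> 'e) \<Rightarrow> real \<Rightarrow> 'e" where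
  "mild f t = bochner_integral (lebesgue_on {0..T}) (kernel f t)"

lemma norm_kernel: "0 \<le> s \<Longrightarrow> t \<le> T \<Longrightarrow> norm (kernel f t s) \<le> M * norm (f s)"
  unfolding kernel_def using norm_U_apply[of "t - s" "f s"] M_pos by auto

text \<open>The semigroup is continuous in the strong sense only, so s \<mapsto>
  \<open>U (t - s)\<close> need not be approximable by step functions in operator norm. Rounding the
  time and approximating \<open>f\<close> at once gives simple functions; they converge because
  \<open>U\<close> is uniformly bounded and its orbits are continuous.\<close>

lemma kernel_measurable:
  assumes f: "strongly_measurable (lebesgue_on {0..T}) f" and t: "0 \<le> t" "t \<le> T"
  shows "strongly_measurable (lebesgue_on {0..T}) (kernel f t)"
proof -
  obtain s where s: "\<And>i. simple_function (lebesgue_on {0..T}) (s i)"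
    "AE x in lebesgue_on {0..T}. (\<lambda>i. s i x) \<longlonglongrightarrow> f x"
    using f unfolding strongly_measurable_def by blast
  \<comment> \<open>rounding \<open>t - x\<close> down preserves its sign, hence the cut-off at \<open>x = t\<close>\<close>
  define \<tau> where "\<tau> n x = real_of_int \<lfloor>real (Suc n) * (t - x)\<rfloor> / real (Suc n)" for n :: nat and x :: real
  have \<tau>: "simple_function (lebesgue_on {0..T}) (\<tau> n)" for n
  proof (rule simple_function_borel_measurable)
    show "\<tau> n \<in> borel_measurable (lebesgue_on {0..T})"
    proof (intro measurable_restrict_space1 measurable_completion)
      have "\<tau> n \<in> borel_measurable borel" unfolding \<tau>_def by measurable
      then show "\<tau> n \<in> borel_measurable lborel" by simp
    qed
    have "\<lfloor>real (Suc n) * (t - x)\<rfloor> \<in> {\<lfloor>real (Suc n) * (t - T)\<rfloor>..\<lfloor>real (Suc n) * t\<rfloor>}" if "x \<in> {0..T}" for x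
      using that by (auto intro!: floor_mono mult_left_mono)
    then have "\<tau> n ` space (lebesgue_on {0..T}) \<subseteq>
        (\<lambda>k. real_of_int k / real (Suc n)) ` {\<lfloor>real (Suc n) * (t - T)\<rfloor>..\<lfloor>real (Suc n) * t\<rfloor>}"
      unfolding \<tau>_def by auto
    then show "finite (\<tau> n ` space (lebesgue_on {0..T}))"
      by (rule finite_subset) auto
  qed
  have \<tau>_le: "\<tau> n x \<le> t - x" and \<tau>_ge: "t - x - 1 / real (Suc n) \<le> \<tau> n x" for n x
  proof -
    have "real_of_int \<lfloor>real (Suc n) * (t - x)\<rfloor> \<le> real (Suc n) * (t - x)" by linarith
    then show "\<tau> n x \<le> t - x" unfolding \<tau>_def by (subst pos_divide_le_eq) (auto simp: mult.commute)
    have "real (Suc n) * (t - x) - 1 \<le> real_of_int \<lfloor>real (Suc n) * (t - x)\<rfloor>" by linarith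
    moreover have "(t - x - 1 / real (Suc n)) * real (Suc n) = real (Suc n) * (t - x) - 1"
      by (simp add: field_simps del: of_nat_Suc)
    ultimately show "t - x - 1 / real (Suc n) \<le> \<tau> n x"
      unfolding \<tau>_def by (subst pos_le_divide_eq) auto
  qed
  have \<tau>_nonneg: "0 \<le> \<tau> n x" if "x \<le> t" for n x
    using that unfolding \<tau>_def by simp
  have \<tau>_lim: "(\<lambda>n. \<tau> n x) \<longlonglongrightarrow> t - x" for x
  proof (rule tendsto_sandwich[of "\<lambda>n. t - x - 1 / real (Suc n)" _ _ "\<lambda>_. t - x"])
    have "(\<lambda>n. t - x - inverse (real (Suc n))) \<longlonglongrightarrow> t - x - 0"
      by (intro tendsto_diff tendsto_const LIMSEQ_inverse_real_of_nat)
    then show "(\<lambda>n. t - x - 1 / real (Suc n)) \<longlonglongrightarrow> t - x" by (simp add: inverse_eq_divide)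
  qed (use \<tau>_le \<tau>_ge in auto)
  have "AE x in lebesgue_on {0..T}. (\<lambda>n. if \<tau> n x < 0 then 0 else U (\<tau> n x) (s n x)) \<longlonglongrightarrow> kernel f t x"
    using s(2) AE_space
  proof eventually_elim
    case (elim x)
    then have x: "0 \<le> x" "x \<le> T" by auto
    show ?case
    proof (cases "x \<le> t")
      case True
      have 1: "(\<lambda>n. U (\<tau> n x) (f x)) \<longlonglongrightarrow> U (t - x) (f x)"
      proof (rule U_tendsto[OF \<tau>_lim])
        show "0 \<le> \<tau> n x \<and> \<tau> n x \<le> T" for n
          using \<tau>_nonneg[OF True] \<tau>_le[of n x] x t by auto
      qed (use x t True in auto)
      have "(\<lambda>n. M * norm (s n x - f x)) \<longlonglongrightarrow> M * norm (f x - f x)"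
        by (intro tendsto_intros elim(1))
      then have M0: "(\<lambda>n. M * norm (s n x - f x)) \<longlonglongrightarrow> 0" by simp
      have 2: "(\<lambda>n. U (\<tau> n x) (s n x) - U (\<tau> n x) (f x)) \<longlonglongrightarrow> 0"
      proof (rule Lim_null_comparison[OF _ M0], rule always_eventually, rule allI)
        fix n
        have "0 \<le> \<tau> n x" "\<tau> n x \<le> T" using \<tau>_nonneg[OF True] \<tau>_le[of n x] x t by (blast, linarith)
        then show "norm (U (\<tau> n x) (s n x) - U (\<tau> n x) (f x)) \<le> M * norm (s n x - f x)"
          using norm_U_apply[of "\<tau> n x" "s n x - f x"] by (simp add: blinfun.diff_right)
      qed
      have "(\<lambda>n. U (\<tau> n x) (s n x)) \<longlonglongrightarrow> U (t - x) (f x)"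
        using tendsto_add[OF 2 1] by simp
      moreover have "\<not> \<tau> n x < 0" for n using \<tau>_nonneg[OF True, of n] by simp
      ultimately show ?thesis using True by (simp add: kernel_def)
    next
      case False
      have "\<tau> n x < 0" for n using \<tau>_le[of n x] False by linarith
      then show ?thesis using False by (simp add: kernel_def)
    qed
  qed
  then show ?thesis
    unfolding strongly_measurable_def
    by (intro exI[of _ "\<lambda>n x. if \<tau> n x < 0 then 0 else U (\<tau> n x) (s n x)"] conjI allI
        simple_function_compose2[OF \<tau> s(1), where h="\<lambda>a b. if a < 0 then 0 else U a b"])
qed

lemma kernel_L1:
  assumes f: "L1_function (lebesgue_on {0..T}) f" and t: "0 \<le> t" "t \<le> T"
  shows "L1_function (lebesgue_on {0..T}) (kernel f t)"
proof (rule lebesgue.L1_function_bound)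
  show "strongly_measurable (lebesgue_on {0..T}) (kernel f t)"
    using f t by (intro kernel_measurable) (auto simp: L1_function_def)
  show "integrable (lebesgue_on {0..T}) (\<lambda>s. M * norm (f s))"
    using f by (simp add: lebesgue.L1_function_iff)
  show "AE s in lebesgue_on {0..T}. norm (kernel f t s) \<le> M * norm (f s)"
    using norm_kernel t by (intro AE_I2) auto
qed

lemma kernel_diff: "kernel (\<lambda>s. f s - g s) t s = kernel f t s - kernel g t s"
  by (simp add: kernel_def blinfun.diff_right)

lemma mild_sum:
  assumes "finite I" "\<And>i. i \<in> I \<Longrightarrow> L1_function (lebesgue_on {0..T}) (f i)" "0 \<le> t" "t \<le> T"
  shows "mild (\<lambda>s. \<Sum>i\<in>I. c i *\<^sub>R f i s) t = (\<Sum>i\<in>I. c i *\<^sub>R mild (f i) t)"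
proof -
  have "kernel (\<lambda>s. \<Sum>i\<in>I. c i *\<^sub>R f i s) t = (\<lambda>s. \<Sum>i\<in>I. c i *\<^sub>R kernel (f i) t s)"
    by (rule ext) (simp add: kernel_def blinfun.sum_right blinfun.scaleR_right)
  then have "mild (\<lambda>s. \<Sum>i\<in>I. c i *\<^sub>R f i s) t = bochner_integral (lebesgue_on {0..T}) (\<lambda>s. \<Sum>i\<in>I. c i *\<^sub>R kernel (f i) t s)"
    by (simp only: mild_def)
  also have "\<dots> = (\<Sum>i\<in>I. bochner_integral (lebesgue_on {0..T}) (\<lambda>s. c i *\<^sub>R kernel (f i) t s))"
    using lebesgue.bochner_integral_sum[of I "\<lambda>i s. c i *\<^sub>R kernel (f i) t s"] assms
    by (blast intro: lebesgue.L1_function_scaleR_const kernel_L1)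
  also have "\<dots> = (\<Sum>i\<in>I. c i *\<^sub>R mild (f i) t)"
    unfolding mild_def using assms by (intro sum.cong lebesgue.bochner_integral_scaleR kernel_L1) auto
  finally show ?thesis .
qed

lemma norm_mild_diff_le:
  assumes f: "L1_function (lebesgue_on {0..T}) f" and g: "L1_function (lebesgue_on {0..T}) g"
    and h: "integrable (lebesgue_on {0..T}) h" "AE s in lebesgue_on {0..T}. norm (f s - g s) \<le> h s"
    and t: "0 \<le> t" "t \<le> T"
  shows "norm (mild f t - mild g t) \<le> M * (LINT s|lebesgue_on {0..T}. h s)"
proof -
  have "norm (mild f t - mild g t) \<le> (LINT s|lebesgue_on {0..T}. M * h s)"
    unfolding mild_def
  proof (rule lebesgue.norm_bochner_integral_diff_le)
    show "AE s in lebesgue_on {0..T}. norm (kernel f t s - kernel g t s) \<le> M * h s"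
      using h(2) AE_space
    proof eventually_elim
      case (elim s)
      have "norm (kernel f t s - kernel g t s) \<le> M * norm (f s - g s)"
        using norm_kernel[of s t "\<lambda>s. f s - g s"] elim(2) t by (simp add: kernel_diff)
      also have "\<dots> \<le> M * h s" using elim(1) M_pos by (intro mult_left_mono) auto
      finally show ?case .
    qed
  qed (use f g h t kernel_L1 in auto)
  then show ?thesis using h by simp
qed

text \<open>The bound on \<open>f\<close> is required for s \<le> t only and the integral stops at
  t; this Volterra form is what lets an exponential envelope reproduce itself.\<close>

lemma norm_mild_le:
  assumes f: "L1_function (lebesgue_on {0..T}) f" and t: "0 \<le> t" "t \<le> T"
    and h: "integrable (lebesgue_on {0..T}) h"
      "AE s in lebesgue_on {0..T}. s \<le> t \<longrightarrow> norm (f s) \<le> h s" "AE s in lebesgue_on {0..T}. 0 \<le> h s"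
  shows "norm (mild f t) \<le> M * (LINT s|lebesgue_on {0..T}. indicator {0..t} s * h s)"
proof -
  have ind: "integrable (lebesgue_on {0..T}) (\<lambda>s. indicator {0..t} s * h s)"
  proof -
    have "{0..t} \<in> sets (lebesgue_on {0..T})"
      using t by (subst sets_restrict_space_iff) auto
    then show ?thesis
      using integrable_mult_indicator[of "{0..t}" "lebesgue_on {0..T}" h] h(1) by simp
  qed
  have "norm (mild f t) \<le> (LINT s|lebesgue_on {0..T}. norm (kernel f t s))"
    unfolding mild_def by (intro lebesgue.norm_bochner_integral_le kernel_L1 f t)
  also have "\<dots> \<le> (LINT s|lebesgue_on {0..T}. M * (indicator {0..t} s * h s))"
  proof (rule integral_mono_AE)
    show "integrable (lebesgue_on {0..T}) (\<lambda>s. norm (kernel f t s))"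
      using kernel_L1[OF f t] by (simp add: lebesgue.L1_function_iff)
    show "AE s in lebesgue_on {0..T}. norm (kernel f t s) \<le> M * (indicator {0..t} s * h s)"
      using h(2) AE_space
    proof eventually_elim
      case (elim s)
      show ?case
      proof (cases "s \<le> t")
        case True
        have "norm (kernel f t s) \<le> M * norm (f s)" using elim t by (intro norm_kernel) auto
        also have "\<dots> \<le> M * h s" using elim True M_pos by (intro mult_left_mono) auto
        finally show ?thesis using True elim by simp
      qed (simp add: kernel_def)
    qed
  qed (use ind in simp)
  finally show ?thesis using ind by simp
qed

lemma mild_continuous:
  assumes f: "L1_function (lebesgue_on {0..T}) f"
  shows "continuous_on {0..T} (mild f)"
  unfolding continuous_on_sequentially
proof (intro allI ballI impI)
  fix x t assume t: "t \<in> {0..T}" and x: "(\<forall>n. x n \<in> {0..T}) \<and> x \<longlonglongrightarrow> t"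
  let ?L = "lebesgue_on {0..T}"
  have L1: "L1_function ?L (kernel f (x n))" "L1_function ?L (kernel f t)" for n
    using x t by (intro kernel_L1 f; auto)+
  have "(\<lambda>n. LINT s|?L. norm (kernel f (x n) s - kernel f t s)) \<longlonglongrightarrow> (LINT s|?L. 0)"
  proof (rule integral_dominated_convergence)
    show "integrable ?L (\<lambda>s. 2 * (M * norm (f s)))" using f by (simp add: lebesgue.L1_function_iff)
    show "(\<lambda>s. norm (kernel f (x n) s - kernel f t s)) \<in> borel_measurable ?L" for n
      using L1 by (intro lebesgue.norm_borel_measurable lebesgue.strongly_measurable_diff) (auto simp: L1_function_def)
    show "AE s in ?L. norm (norm (kernel f (x n) s - kernel f t s)) \<le> 2 * (M * norm (f s))" for n
    proof (rule AE_I2)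
      fix s assume "s \<in> space ?L"
      then have "norm (kernel f (x n) s) \<le> M * norm (f s)" "norm (kernel f t s) \<le> M * norm (f s)"
        using x t by (auto intro!: norm_kernel)
      then show "norm (norm (kernel f (x n) s - kernel f t s)) \<le> 2 * (M * norm (f s))"
        using norm_triangle_ineq4[of "kernel f (x n) s" "kernel f t s"] by simp
    qed
    \<comment> \<open>At s = t the limit of the kernels depends on the side from which
      \<open>x n\<close> approaches t; a single point is a null set.\<close>
    have "AE s in ?L. s \<noteq> t"
    proof (rule AE_not_in[of "{t}", simplified])
      show "{t} \<in> null_sets ?L" using t by (auto simp: null_sets_restrict_space)
    qed
    then show "AE s in ?L. (\<lambda>n. norm (kernel f (x n) s - kernel f t s)) \<longlonglongrightarrow> 0"
      using AE_space
    proof eventually_elim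
      case (elim s)
      then have s: "0 \<le> s" "s \<le> T" by auto
      have "(\<lambda>n. kernel f (x n) s) \<longlonglongrightarrow> kernel f t s"
      proof (cases "s < t")
        case True
        have ev: "\<forall>\<^sub>F n in sequentially. s < x n" using x True by (auto dest: order_tendstoD(1))
        \<comment> \<open>The maximum with 0 affects only finitely many n and keeps the argument in
          the interval on which \<open>U\<close> is controlled.\<close>
        have "(\<lambda>n. U (max 0 (x n - s)) (f s)) \<longlonglongrightarrow> U (t - s) (f s)"
        proof (rule U_tendsto)
          have "(\<lambda>n. max 0 (x n - s)) \<longlonglongrightarrow> max 0 (t - s)" using x by (intro tendsto_intros) auto
          then show "(\<lambda>n. max 0 (x n - s)) \<longlonglongrightarrow> t - s" using True by simp
          have "x n \<le> T" for n using x by auto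
          then show "0 \<le> max 0 (x n - s) \<and> max 0 (x n - s) \<le> T" for n
            using T_pos s(1) by (smt (verit))
        qed (use True s t in auto)
        moreover have "\<forall>\<^sub>F n in sequentially. U (max 0 (x n - s)) (f s) = kernel f (x n) s"
          using ev by eventually_elim (simp add: kernel_def)
        ultimately have "(\<lambda>n. kernel f (x n) s) \<longlonglongrightarrow> U (t - s) (f s)" by (rule Lim_transform_eventually)
        then show ?thesis using True by (simp add: kernel_def)
      next
        case False
        then have "t < s" using elim(1) by simp
        then have ev: "\<forall>\<^sub>F n in sequentially. x n < s" using x by (auto dest: order_tendstoD(2))
        have "\<forall>\<^sub>F n in sequentially. 0 = kernel f (x n) s" using ev by eventually_elim (simp add: kernel_def)
        then have "(\<lambda>n. kernel f (x n) s) \<longlonglongrightarrow> 0" by (rule Lim_transform_eventually[OF tendsto_const])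
        then show ?thesis using \<open>t < s\<close> by (simp add: kernel_def)
      qed
      then have "(\<lambda>n. norm (kernel f (x n) s - kernel f t s)) \<longlonglongrightarrow> norm (kernel f t s - kernel f t s)"
        by (intro tendsto_intros)
      then show ?case by simp
    qed
  qed auto
  then have lim: "(\<lambda>n. LINT s|?L. norm (kernel f (x n) s - kernel f t s)) \<longlonglongrightarrow> 0" by simp
  have "norm (mild f (x n) - mild f t) \<le> (LINT s|?L. norm (kernel f (x n) s - kernel f t s))" for n
    unfolding mild_def lebesgue.bochner_integral_diff[OF L1, symmetric]
    by (intro lebesgue.norm_bochner_integral_le lebesgue.L1_function_diff L1)
  then have "(\<lambda>n. mild f (x n) - mild f t) \<longlonglongrightarrow> 0"
    by (intro Lim_null_comparison[OF _ lim]) auto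
  then show "(mild f \<circ> x) \<longlonglongrightarrow> mild f t"
    by (simp add: LIM_zero_iff comp_def)
qed

end

section \<open>Convex combinations of tails\<close>

text \<open>Weights are sequences on all of \<open>nat\<close> rather than tuples, so that weights
  of different lengths can be averaged and subtracted, and one weight can act on several sequences
  at once.\<close>

definition tail_weights :: "nat \<Rightarrow> (nat \<Rightarrow> real) set" where
  "tail_weights n = {w. (\<forall>i. 0 \<le> w i) \<and> (\<forall>i<n. w i = 0) \<and> (\<exists>N. (\<forall>i\<ge>N. w i = 0) \<and> (\<Sum>i<N. w i) = 1)}"

definition wsum :: "(nat \<Rightarrow> real) \<Rightarrow> (nat \<Rightarrow> 'b::real_vector) \<Rightarrow> 'b" where
  "wsum w u = (\<Sum>i | w i \<noteq> 0. w i *\<^sub>R u i)"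

lemma wsum_eq: "\<forall>i\<ge>N. w i = 0 \<Longrightarrow> wsum w u = (\<Sum>i<N. w i *\<^sub>R u i)"
  unfolding wsum_def
  by (rule sum.mono_neutral_left) (auto simp: not_le[symmetric])

lemma tail_weightsE:
  assumes "w \<in> tail_weights n"
  obtains N where "\<And>i. 0 \<le> w i" "\<And>i. i < n \<Longrightarrow> w i = 0" "\<forall>i\<ge>N. w i = 0" "(\<Sum>i<N. w i) = 1"
  using assms unfolding tail_weights_def by blast

lemma tail_weights_antimono: "m \<le> n \<Longrightarrow> tail_weights n \<subseteq> tail_weights m"
  unfolding tail_weights_def by auto

lemma sum_lessThan_eq:
  fixes w :: "nat \<Rightarrow> real"
  assumes "\<forall>i\<ge>N. w i = 0" "N \<le> N'"
  shows "(\<Sum>i<N'. w i) = (\<Sum>i<N. w i)"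
  using assms by (intro sum.mono_neutral_right) auto

lemma tail_weights_common:
  assumes "v \<in> tail_weights n" "w \<in> tail_weights n"
  obtains N where "\<forall>i\<ge>N. v i = 0" "\<forall>i\<ge>N. w i = 0" "(\<Sum>i<N. v i) = 1" "(\<Sum>i<N. w i) = 1"
proof -
  obtain N1 where 1: "\<forall>i\<ge>N1. v i = 0" "(\<Sum>i<N1. v i) = 1" using assms(1) by (rule tail_weightsE)
  obtain N2 where 2: "\<forall>i\<ge>N2. w i = 0" "(\<Sum>i<N2. w i) = 1" using assms(2) by (rule tail_weightsE)
  show ?thesis
    by (rule that[of "max N1 N2"])
      (use 1 2 sum_lessThan_eq[OF 1(1), of "max N1 N2"] sum_lessThan_eq[OF 2(1), of "max N1 N2"] in auto)
qed

lemma tail_weights_midpoint: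
  assumes "v \<in> tail_weights n" "w \<in> tail_weights n"
  shows "(\<lambda>i. (v i + w i) / 2) \<in> tail_weights n"
proof -
  obtain N where N: "\<forall>i\<ge>N. v i = 0" "\<forall>i\<ge>N. w i = 0" "(\<Sum>i<N. v i) = 1" "(\<Sum>i<N. w i) = 1"
    using tail_weights_common[OF assms] by blast
  have "(\<Sum>i<N. (v i + w i) / 2) = 1"
    using N by (simp add: sum.distrib flip: sum_divide_distrib)
  then show ?thesis
    using N assms unfolding tail_weights_def by (auto intro!: exI[of _ N])
qed

lemma tail_weights_nonempty: "(\<lambda>i. if i = n then 1 else 0) \<in> tail_weights n"
  unfolding tail_weights_def by (auto intro!: exI[of _ "Suc n"])

text \<open>Almost minimal elements of the convex hulls of the tails form a Cauchy sequence for a quadratic form,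
  exactly as in the projection theorem in Hilbert space.\<close>

lemma parallelogram_minimizers_cauchy:
  fixes q :: "(nat \<Rightarrow> real) \<Rightarrow> real"
  assumes nonneg: "\<And>w. 0 \<le> q w"
    and par: "\<And>v w. v \<in> tail_weights 0 \<Longrightarrow> w \<in> tail_weights 0 \<Longrightarrow>
      4 * q (\<lambda>i. (v i + w i) / 2) + q (\<lambda>i. v i - w i) = 2 * q v + 2 * q w"
    and bdd: "\<And>w. w \<in> tail_weights 0 \<Longrightarrow> q w \<le> B"
  obtains v where "\<And>n. v n \<in> tail_weights n"
    "\<And>e. e > 0 \<Longrightarrow> \<exists>N. \<forall>n\<ge>N. \<forall>m\<ge>n. q (\<lambda>i. v n i - v m i) < e"
proof -
  define d where "d n = Inf (q ` tail_weights n)" for n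
  have bb: "bdd_below (q ` tail_weights n)" for n using nonneg by (intro bdd_belowI[of _ 0]) auto
  have ne: "tail_weights n \<noteq> {}" for n using tail_weights_nonempty by blast
  have sub0: "w \<in> tail_weights 0" if "w \<in> tail_weights n" for n w
    using that tail_weights_antimono[of 0 n] by auto
  have d_le: "d n \<le> q w" if "w \<in> tail_weights n" for n w
    unfolding d_def using that bb by (intro cInf_lower) auto
  have "incseq d"
  proof (rule incseq_SucI)
    fix n show "d n \<le> d (Suc n)" unfolding d_def
      by (rule cInf_superset_mono) (use bb ne tail_weights_antimono[of n "Suc n"] in auto)
  qed
  moreover have "d n \<le> B" for n
    using d_le[OF tail_weights_nonempty] bdd[OF sub0[OF tail_weights_nonempty]] by (rule order_trans)
  ultimately obtain l where l: "d \<longlonglongrightarrow> l" "\<And>n. d n \<le> l"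
    using incseq_convergent[of d B] by metis
  have "\<exists>w. w \<in> tail_weights n \<and> q w < d n + 1 / Suc n" for n
  proof -
    have "d n < d n + 1 / Suc n" by simp
    then have "Inf (q ` tail_weights n) < d n + 1 / Suc n" by (simp only: d_def)
    moreover have "q ` tail_weights n \<noteq> {}" using ne[of n] by simp
    ultimately obtain z where z: "z \<in> q ` tail_weights n" "z < d n + 1 / Suc n"
      using cInf_lessD by metis
    from z(1) obtain w where "w \<in> tail_weights n" "z = q w" by (rule imageE)
    with z(2) show ?thesis by (intro exI[of _ w]) simp
  qed
  then obtain v where v: "\<And>n. v n \<in> tail_weights n" "\<And>n. q (v n) < d n + 1 / Suc n" by metis
  show ?thesis
  proof (rule that[of v])
    show "v n \<in> tail_weights n" for n by (rule v)
    fix e :: real assume "e > 0"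
    have "\<forall>\<^sub>F n in sequentially. l - e / 8 < d n" by (rule order_tendstoD(1)[OF l(1)]) (use \<open>e > 0\<close> in simp)
    moreover have "\<forall>\<^sub>F n in sequentially. 1 / real (Suc n) < e / 8"
      using LIMSEQ_inverse_real_of_nat \<open>e > 0\<close>
      by (intro order_tendstoD(2)[of "\<lambda>n. 1 / real (Suc n)" 0]) (auto simp: inverse_eq_divide)
    ultimately have "\<forall>\<^sub>F n in sequentially. l - e / 8 < d n \<and> 1 / real (Suc n) < e / 8"
      by eventually_elim simp
    then obtain N where N: "\<And>n. n \<ge> N \<Longrightarrow> l - e / 8 < d n \<and> 1 / real (Suc n) < e / 8"
      by (auto simp: eventually_sequentially)
    \<comment> \<open>The midpoint belongs to the n-th tail, so its value is at least
      \<open>d n\<close>. The parallelogram law then leaves 2 (d m - d n) plus twice each of the two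
      defects, which is less than 6 e / 8.\<close>
    have "q (\<lambda>i. v n i - v m i) < e" if "n \<ge> N" "m \<ge> n" for n m
    proof -
      have "v m \<in> tail_weights n" using v(1)[of m] tail_weights_antimono[OF \<open>m \<ge> n\<close>] by auto
      then have "d n \<le> q (\<lambda>i. (v n i + v m i) / 2)" by (intro d_le tail_weights_midpoint v)
      moreover have "4 * q (\<lambda>i. (v n i + v m i) / 2) + q (\<lambda>i. v n i - v m i) = 2 * q (v n) + 2 * q (v m)"
        by (intro par sub0[OF v(1)])
      moreover have "l - e / 8 < d n" "1 / real (Suc n) < e / 8" "1 / real (Suc m) < e / 8"
        using N[of n] N[of m] that by auto
      ultimately show ?thesis using v(2)[of n] v(2)[of m] l(2)[of m] \<open>e > 0\<close> by linarith
    qed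
    then show "\<exists>N. \<forall>n\<ge>N. \<forall>m\<ge>n. q (\<lambda>i. v n i - v m i) < e" by blast
  qed
qed

text \<open>Each term of the series bounds one increment of \<open>f\<close> by a constant times
  2^-k, so the increments are absolutely summable.\<close>

lemma suminf_ennreal_bound_imp_convergent:
  fixes f :: "nat \<Rightarrow> real"
  assumes "(\<Sum>k. ennreal (4 ^ k * (f k - f (Suc k))\<^sup>2)) \<noteq> \<infinity>"
  shows "convergent f"
proof -
  define c where "c = (\<Sum>k. ennreal (4 ^ k * (f k - f (Suc k))\<^sup>2))"
  have "norm (f (Suc k) - f k) \<le> sqrt (enn2real c) * (1 / 2) ^ k" for k
  proof -
    have "(\<Sum>j\<in>{k}. ennreal (4 ^ j * (f j - f (Suc j))\<^sup>2)) \<le> c"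
      unfolding c_def by (rule sum_le_suminf) auto
    then have "enn2real (ennreal (4 ^ k * (f k - f (Suc k))\<^sup>2)) \<le> enn2real c"
      using assms by (intro enn2real_mono) (auto simp: c_def less_top)
    then have "4 ^ k * (f k - f (Suc k))\<^sup>2 \<le> enn2real c" by simp
    then have "sqrt (4 ^ k * (f k - f (Suc k))\<^sup>2) \<le> sqrt (enn2real c)" by (rule real_sqrt_le_mono)
    moreover have "sqrt (4 ^ k * (f k - f (Suc k))\<^sup>2) = 2 ^ k * \<bar>f k - f (Suc k)\<bar>"
    proof -
      have "4 ^ k = (2 ^ k * 2 ^ k :: real)" by (simp flip: power_mult_distrib)
      then have "4 ^ k * (f k - f (Suc k))\<^sup>2 = (2 ^ k * (f k - f (Suc k)))\<^sup>2"
        by (simp add: power2_eq_square)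
      then show ?thesis by (simp add: abs_mult)
    qed
    ultimately have "2 ^ k * \<bar>f k - f (Suc k)\<bar> \<le> sqrt (enn2real c)" by (simp only:)
    then have "\<bar>f k - f (Suc k)\<bar> \<le> sqrt (enn2real c) / 2 ^ k"
      by (subst pos_le_divide_eq) (simp_all add: mult.commute)
    moreover have "norm (f (Suc k) - f k) = \<bar>f k - f (Suc k)\<bar>" by (simp add: abs_minus_commute)
    moreover have "sqrt (enn2real c) * (1 / 2) ^ k = sqrt (enn2real c) / 2 ^ k" by (simp add: power_divide)
    ultimately show ?thesis by (simp only:)
  qed
  moreover have "summable (\<lambda>k. sqrt (enn2real c) * (1 / 2 :: real) ^ k)"
    by (intro summable_mult summable_geometric) simp
  ultimately have "summable (\<lambda>k. f (Suc k) - f k)"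
    using summable_comparison_test'[of "\<lambda>k. sqrt (enn2real c) * (1 / 2) ^ k" 0 "\<lambda>k. f (Suc k) - f k"]
    by blast
  then have "convergent (\<lambda>n. \<Sum>k<n. f (Suc k) - f k)" by (simp add: summable_iff_convergent)
  then have "convergent (\<lambda>n. f n - f 0)" by (simp add: sum_lessThan_telescope)
  then have "convergent (\<lambda>n. (f n - f 0) + f 0)" by (intro convergent_add convergent_const)
  then show ?thesis by simp
qed

text \<open>A Hilbert space version of Mazur's theorem for countably many sequences at once. The
  squared L^2 norms are added with factors 2^-p into one quadratic form, so that one choice of
  weights serves every p. Almost minimizers over the tails are Cauchy for it, and a fast subsequence
  turns this into convergence almost everywhere.\<close>

lemma (in finite_measure) convex_combinations_converge_AE:
  fixes a :: "nat \<Rightarrow> nat \<Rightarrow> 'a \<Rightarrow> real"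
  assumes meas: "\<And>p i. a p i \<in> borel_measurable M" and bound: "\<And>p i x. \<bar>a p i x\<bar> \<le> 1"
  obtains w where "\<And>n. w n \<in> tail_weights n"
    "\<And>p. AE x in M. convergent (\<lambda>n. wsum (w n) (\<lambda>i. a p i x))"
proof -
  note [measurable] = meas
  define E where "E w p x = wsum w (\<lambda>i. a p i x)" for w p x
  define G where "G w x = (\<Sum>p. ennreal ((1/2) ^ p * (E w p x)\<^sup>2))" for w x
  define Q where "Q w = (\<integral>\<^sup>+x. G w x \<partial>M)" for w
  have E_meas[measurable]: "E w p \<in> borel_measurable M" for w p
    unfolding E_def wsum_def by measurable
  have G_meas[measurable]: "G w \<in> borel_measurable M" for w
    unfolding G_def by measurable
  \<comment> \<open>The bound 2 instead of 1 also covers differences of two weights; 8 is the sum of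
    the numbers 4 / 2^p.\<close>
  have Q_fin: "Q w \<le> ennreal (8 * measure M (space M))" if E2: "\<And>p x. \<bar>E w p x\<bar> \<le> 2" for w
  proof -
    have "(\<lambda>p. 4 * (1/2::real) ^ p) sums (4 * (1 / (1 - 1/2)))"
      by (intro sums_mult geometric_sums) simp
    then have 8: "(\<Sum>p. ennreal (4 * (1/2) ^ p)) = ennreal 8"
      by (intro suminf_ennreal_eq) auto
    have "G w x \<le> ennreal 8" for x
      unfolding G_def 8[symmetric]
    proof (intro suminf_le ennreal_leI)
      fix p
      have "(E w p x)\<^sup>2 \<le> 2\<^sup>2" using E2[of p x] by (subst power2_le_iff_abs_le) auto
      then show "(1/2) ^ p * (E w p x)\<^sup>2 \<le> 4 * (1/2) ^ p" by simp
    qed auto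
    then have "Q w \<le> (\<integral>\<^sup>+x. ennreal 8 \<partial>M)" unfolding Q_def by (intro nn_integral_mono)
    also have "\<dots> = ennreal (8 * measure M (space M))"
      by (simp add: emeasure_eq_measure ennreal_mult)
    finally show ?thesis .
  qed
  have E1: "\<bar>E w p x\<bar> \<le> 1" if w: "w \<in> tail_weights n" for w n p x
  proof -
    obtain N where N: "\<forall>i. 0 \<le> w i" "\<forall>i\<ge>N. w i = 0" "(\<Sum>i<N. w i) = 1"
      using w unfolding tail_weights_def by blast
    have "\<bar>\<Sum>i<N. w i * a p i x\<bar> \<le> (\<Sum>i<N. \<bar>w i * a p i x\<bar>)" by (rule sum_abs)
    also have "\<dots> \<le> (\<Sum>i<N. w i)"
      using N(1) bound by (intro sum_mono) (simp add: abs_mult mult_left_le)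
    finally show ?thesis unfolding E_def wsum_eq[OF N(2)] using N(3) by simp
  qed
  have E_lin: "E (\<lambda>i. c * v i + c' * w i) p x = c * E v p x + c' * E w p x"
    if v: "v \<in> tail_weights 0" and w: "w \<in> tail_weights 0" for v w c c' p x
  proof -
    obtain N where N: "\<forall>i\<ge>N. v i = 0" "\<forall>i\<ge>N. w i = 0" "(\<Sum>i<N. v i) = 1" "(\<Sum>i<N. w i) = 1"
      by (rule tail_weights_common[OF v w])
    then have N': "\<forall>i\<ge>N. c * v i + c' * w i = 0" by simp
    show ?thesis
      unfolding E_def wsum_eq[OF N(1)] wsum_eq[OF N(2)] wsum_eq[OF N']
    proof -
      have "(\<Sum>i<N. (c * v i + c' * w i) *\<^sub>R a p i x) = (\<Sum>i<N. c * (v i *\<^sub>R a p i x) + c' * (w i *\<^sub>R a p i x))"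
        by (intro sum.cong refl) (simp add: algebra_simps)
      then show "(\<Sum>i<N. (c * v i + c' * w i) *\<^sub>R a p i x) = c * (\<Sum>i<N. v i *\<^sub>R a p i x) + c' * (\<Sum>i<N. w i *\<^sub>R a p i x)"
        by (simp only: sum.distrib sum_distrib_left)
    qed
  qed
  have E_diff: "E (\<lambda>i. v i - w i) p x = E v p x - E w p x"
    and E_mid: "E (\<lambda>i. (v i + w i) / 2) p x = (E v p x + E w p x) / 2"
    if v: "v \<in> tail_weights 0" and w: "w \<in> tail_weights 0" for v w p x
  proof -
    show "E (\<lambda>i. v i - w i) p x = E v p x - E w p x"
      using E_lin[OF v w, of 1 "-1" p x] by simp
    show "E (\<lambda>i. (v i + w i) / 2) p x = (E v p x + E w p x) / 2"
      using E_lin[OF v w, of "1/2" "1/2" p x] by (simp add: add_divide_distrib)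
  qed
  have sub0: "w \<in> tail_weights 0" if "w \<in> tail_weights n" for n w
    using that tail_weights_antimono[of 0 n] by auto
  have fin0: "Q w \<le> ennreal (8 * measure M (space M))" if "w \<in> tail_weights 0" for w
  proof (rule Q_fin)
    fix p x show "\<bar>E w p x\<bar> \<le> 2" using E1[OF that, of p x] by linarith
  qed
  have fin_diff: "Q (\<lambda>i. v i - w i) \<le> ennreal (8 * measure M (space M))"
    if v: "v \<in> tail_weights 0" and w: "w \<in> tail_weights 0" for v w
  proof (rule Q_fin)
    fix p x show "\<bar>E (\<lambda>i. v i - w i) p x\<bar> \<le> 2"
      unfolding E_diff[OF v w] using E1[OF v, of p x] E1[OF w, of p x] by linarith
  qed
  have par: "4 * Q (\<lambda>i. (v i + w i) / 2) + Q (\<lambda>i. v i - w i) = 2 * Q v + 2 * Q w"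
    if v: "v \<in> tail_weights 0" and w: "w \<in> tail_weights 0" for v w
  proof -
    have "4 * G (\<lambda>i. (v i + w i) / 2) x + G (\<lambda>i. v i - w i) x = 2 * G v x + 2 * G w x" for x
    proof -
      have "4 * ennreal ((1/2) ^ p * (E (\<lambda>i. (v i + w i) / 2) p x)\<^sup>2) + ennreal ((1/2) ^ p * (E (\<lambda>i. v i - w i) p x)\<^sup>2)
          = 2 * ennreal ((1/2) ^ p * (E v p x)\<^sup>2) + 2 * ennreal ((1/2) ^ p * (E w p x)\<^sup>2)" for p
      proof -
        have eq: "4 * ((1/2) ^ p * (E (\<lambda>i. (v i + w i) / 2) p x)\<^sup>2) + (1/2) ^ p * (E (\<lambda>i. v i - w i) p x)\<^sup>2
            = 2 * ((1/2) ^ p * (E v p x)\<^sup>2) + 2 * ((1/2) ^ p * (E w p x)\<^sup>2)"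
        proof -
          have "4 * (P * ((y + z) / 2)\<^sup>2) + P * (y - z)\<^sup>2 = 2 * (P * y\<^sup>2) + 2 * (P * z\<^sup>2)" for P y z :: real
            by (simp add: power2_eq_square algebra_simps add_divide_distrib)
          then show ?thesis unfolding E_diff[OF v w] E_mid[OF v w] .
        qed
        have "ennreal (4 * ((1/2) ^ p * (E (\<lambda>i. (v i + w i) / 2) p x)\<^sup>2) + (1/2) ^ p * (E (\<lambda>i. v i - w i) p x)\<^sup>2)
            = ennreal (2 * ((1/2) ^ p * (E v p x)\<^sup>2) + 2 * ((1/2) ^ p * (E w p x)\<^sup>2))"
          by (simp only: eq)
        then show ?thesis by (simp add: ennreal_plus ennreal_mult)
      qed
      then have "(\<Sum>p. 4 * ennreal ((1/2) ^ p * (E (\<lambda>i. (v i + w i) / 2) p x)\<^sup>2) + ennreal ((1/2) ^ p * (E (\<lambda>i. v i - w i) p x)\<^sup>2))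
          = (\<Sum>p. 2 * ennreal ((1/2) ^ p * (E v p x)\<^sup>2) + 2 * ennreal ((1/2) ^ p * (E w p x)\<^sup>2))"
        by simp
      then show ?thesis
        unfolding G_def by (simp add: suminf_add[symmetric] ennreal_suminf_cmult)
    qed
    then have "(\<integral>\<^sup>+x. 4 * G (\<lambda>i. (v i + w i) / 2) x + G (\<lambda>i. v i - w i) x \<partial>M) = (\<integral>\<^sup>+x. 2 * G v x + 2 * G w x \<partial>M)"
      by simp
    then show ?thesis
      unfolding Q_def by (simp add: nn_integral_add nn_integral_cmult)
  qed
  define q where "q w = enn2real (Q w)" for w
  have Qq: "Q w = ennreal (q w)" if "Q w \<le> ennreal (8 * measure M (space M))" for w
    unfolding q_def using that le_less_trans[OF that ennreal_less_top] by simp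
  obtain v where v: "\<And>n. v n \<in> tail_weights n"
    and cauchy: "\<And>e. e > 0 \<Longrightarrow> \<exists>N. \<forall>n\<ge>N. \<forall>m\<ge>n. q (\<lambda>i. v n i - v m i) < e"
  proof (rule parallelogram_minimizers_cauchy[of q "8 * measure M (space M)"])
    show "0 \<le> q w" for w by (simp add: q_def)
    show "4 * q (\<lambda>i. (v i + w i) / 2) + q (\<lambda>i. v i - w i) = 2 * q v + 2 * q w"
      if v: "v \<in> tail_weights 0" and w: "w \<in> tail_weights 0" for v w
    proof -
      have nn: "0 \<le> q u" for u by (simp add: q_def)
      have "4 * ennreal (q (\<lambda>i. (v i + w i) / 2)) + ennreal (q (\<lambda>i. v i - w i)) = 2 * ennreal (q v) + 2 * ennreal (q w)"
        using par[OF v w] unfolding Qq[OF fin0[OF v]] Qq[OF fin0[OF w]] Qq[OF fin_diff[OF v w]]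
          Qq[OF fin0[OF tail_weights_midpoint[OF v w]]] .
      moreover have "4 * ennreal a + ennreal b = ennreal (4 * a + b)"
        "2 * ennreal a + 2 * ennreal b = ennreal (2 * a + 2 * b)" if "0 \<le> a" "0 \<le> b" for a b
        using that by (simp_all add: ennreal_plus ennreal_mult)
      ultimately have "ennreal (4 * q (\<lambda>i. (v i + w i) / 2) + q (\<lambda>i. v i - w i)) = ennreal (2 * q v + 2 * q w)"
        by (metis nn)
      then show ?thesis using nn[of "\<lambda>i. (v i + w i) / 2"] nn[of "\<lambda>i. v i - w i"] nn[of v] nn[of w]
        by (subst (asm) ennreal_inj) (auto intro: add_nonneg_nonneg)
    qed
    show "q w \<le> 8 * measure M (space M)" if "w \<in> tail_weights 0" for w
      using enn2real_mono[OF fin0[OF that]] by (simp add: q_def)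
  qed blast
  have "\<exists>N. \<forall>n\<ge>N. \<forall>m\<ge>n. q (\<lambda>i. v n i - v m i) < (1/8) ^ k" for k :: nat
    by (rule cauchy) simp
  then obtain N where N: "\<And>k n m. N k \<le> n \<Longrightarrow> n \<le> m \<Longrightarrow> q (\<lambda>i. v n i - v m i) < (1/8) ^ k" by metis
  \<comment> \<open>The sum makes \<open>r\<close> increasing and at least \<open>N k\<close>, and
    the summand k puts \<open>w k\<close> into the k-th tail.\<close>
  define r where "r k = k + (\<Sum>j\<le>k. N j)" for k
  have r: "N k \<le> r k" "k \<le> r k" "r k \<le> r (Suc k)" for k
    unfolding r_def by (auto intro: trans_le_add2 member_le_sum)
  define w where "w k = v (r k)" for k
  have w0: "w k \<in> tail_weights 0" for k using v sub0 by (auto simp: w_def)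
  show ?thesis
  proof (rule that[of w])
    show "w n \<in> tail_weights n" for n
      using v[of "r n"] tail_weights_antimono[OF r(2)[of n]] by (auto simp: w_def)
    have "(\<integral>\<^sup>+x. (\<Sum>k. ennreal (4 ^ k) * G (\<lambda>i. w k i - w (Suc k) i) x) \<partial>M) = (\<Sum>k. ennreal (4 ^ k) * Q (\<lambda>i. w k i - w (Suc k) i))"
      unfolding Q_def by (simp add: nn_integral_suminf nn_integral_cmult)
    \<comment> \<open>The decay (1/8)^k of the form pays for the factor 4^k, and a series with terms
      2^-k remains. The factor is what makes finiteness at almost every x imply convergence
      there.\<close>
    also have "\<dots> \<le> (\<Sum>k. ennreal ((1/2) ^ k))"
    proof (intro suminf_le)
      fix k
      have "ennreal (4 ^ k) * Q (\<lambda>i. w k i - w (Suc k) i) = ennreal (4 ^ k * q (\<lambda>i. w k i - w (Suc k) i))"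
        using Qq[OF fin_diff[OF w0 w0]] by (simp add: ennreal_mult q_def)
      also have "\<dots> \<le> ennreal (4 ^ k * (1/8) ^ k)"
        using N[OF r(1) r(3), of k] by (intro ennreal_leI mult_left_mono) (auto simp: w_def)
      also have "4 ^ k * (1/8) ^ k = (1/2 :: real) ^ k" by (simp flip: power_mult_distrib)
      finally show "ennreal (4 ^ k) * Q (\<lambda>i. w k i - w (Suc k) i) \<le> ennreal ((1/2) ^ k)" .
    qed auto
    also have "\<dots> = ennreal 2"
      using geometric_sums[of "1/2::real"] by (intro suminf_ennreal_eq) auto
    finally have "(\<integral>\<^sup>+x. (\<Sum>k. ennreal (4 ^ k) * G (\<lambda>i. w k i - w (Suc k) i) x) \<partial>M) \<noteq> \<infinity>"
      by (auto simp: top_unique)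
    then have AE: "AE x in M. (\<Sum>k. ennreal (4 ^ k) * G (\<lambda>i. w k i - w (Suc k) i) x) \<noteq> \<infinity>"
      by (intro nn_integral_noteq_infinite) measurable
    show "AE x in M. convergent (\<lambda>n. wsum (w n) (\<lambda>i. a p i x))" for p
      using AE
    proof eventually_elim
      case (elim x)
      have le: "ennreal ((1/2) ^ p) * (\<Sum>k. ennreal (4 ^ k * (E (w k) p x - E (w (Suc k)) p x)\<^sup>2))
          \<le> (\<Sum>k. ennreal (4 ^ k) * G (\<lambda>i. w k i - w (Suc k) i) x)"
        unfolding ennreal_suminf_cmult[symmetric]
      proof (intro suminf_le)
        fix k
        have "(\<Sum>p\<in>{p}. ennreal ((1/2) ^ p * (E (\<lambda>i. w k i - w (Suc k) i) p x)\<^sup>2)) \<le> G (\<lambda>i. w k i - w (Suc k) i) x"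
          unfolding G_def by (rule sum_le_suminf) auto
        then have "ennreal (4 ^ k) * ennreal ((1/2) ^ p * (E (w k) p x - E (w (Suc k)) p x)\<^sup>2)
            \<le> ennreal (4 ^ k) * G (\<lambda>i. w k i - w (Suc k) i) x"
          by (intro mult_left_mono) (auto simp: E_diff[OF w0 w0])
        then show "ennreal ((1/2) ^ p) * ennreal (4 ^ k * (E (w k) p x - E (w (Suc k)) p x)\<^sup>2)
            \<le> ennreal (4 ^ k) * G (\<lambda>i. w k i - w (Suc k) i) x"
          by (simp add: mult.left_commute flip: ennreal_mult)
      qed auto
      have "(\<Sum>k. ennreal (4 ^ k * (E (w k) p x - E (w (Suc k)) p x)\<^sup>2)) \<noteq> \<infinity>"
      proof
        assume "(\<Sum>k. ennreal (4 ^ k * (E (w k) p x - E (w (Suc k)) p x)\<^sup>2)) = \<infinity>"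
        then have "ennreal ((1/2) ^ p) * (\<Sum>k. ennreal (4 ^ k * (E (w k) p x - E (w (Suc k)) p x)\<^sup>2)) = \<infinity>"
          by (simp add: ennreal_mult_top)
        with le elim show False by (simp add: top_unique)
      qed
      from suminf_ennreal_bound_imp_convergent[OF this] show ?case by (simp add: E_def)
    qed
  qed
qed

section \<open>Compactness of the mild solution operator\<close>

lemma ball_cover_finite_classes:
  assumes "finite (\<kappa> ` S)" "\<And>v w. v \<in> S \<Longrightarrow> w \<in> S \<Longrightarrow> \<kappa> v = \<kappa> w \<Longrightarrow> dist (\<Phi> v) (\<Phi> w) < \<delta>"
  shows "ball_cover (\<Phi> ` S) \<delta>"
proof (rule ball_coverI)
  show "finite (\<Phi> ` inv_into S \<kappa> ` \<kappa> ` S)" using assms(1) by simp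
  show "\<Phi> ` S \<subseteq> (\<Union>c\<in>\<Phi> ` inv_into S \<kappa> ` \<kappa> ` S. ball c \<delta>)"
  proof
    fix x assume "x \<in> \<Phi> ` S"
    then obtain v where v: "v \<in> S" "x = \<Phi> v" by blast
    have "inv_into S \<kappa> (\<kappa> v) \<in> S" "\<kappa> (inv_into S \<kappa> (\<kappa> v)) = \<kappa> v"
      using v(1) by (auto intro: inv_into_into f_inv_into_f)
    then have "dist (\<Phi> (inv_into S \<kappa> (\<kappa> v))) x < \<delta>"
      unfolding v(2) by (intro assms(2) v(1))
    then show "x \<in> (\<Union>c\<in>\<Phi> ` inv_into S \<kappa> ` \<kappa> ` S. ball c \<delta>)"
      using v(1) by auto
  qed
qed

lemma ball_cover_finite_sums:
  fixes A :: "nat \<Rightarrow> 'b::real_normed_vector set"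
  assumes "\<And>j \<delta>. j < n \<Longrightarrow> \<delta> > 0 \<Longrightarrow> ball_cover (A j) \<delta>" "\<delta> > 0"
  shows "ball_cover {\<Sum>j<n. a j |a. \<forall>j<n. a j \<in> A j} \<delta>"
  using assms
proof (induction n arbitrary: \<delta>)
  case 0
  have "{\<Sum>j<0. a j |a. \<forall>j<0. a j \<in> A j} = {0}" by auto
  then show ?case using 0 by (simp add: ball_cover_finite)
next
  case (Suc n)
  have "ball_cover {x + y |x y. x \<in> {\<Sum>j<n. a j |a. \<forall>j<n. a j \<in> A j} \<and> y \<in> A n} (\<delta> / 2 + \<delta> / 2)"
    by (intro ball_cover_sums Suc.IH Suc.prems) (use Suc.prems in auto)
  moreover have "{\<Sum>j<Suc n. a j |a. \<forall>j<Suc n. a j \<in> A j}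
      \<subseteq> {x + y |x y. x \<in> {\<Sum>j<n. a j |a. \<forall>j<n. a j \<in> A j} \<and> y \<in> A n}"
  proof clarify
    fix a assume "\<forall>j<Suc n. a j \<in> A j"
    then show "\<exists>x y. (\<Sum>j<Suc n. a j) = x + y \<and> x \<in> {\<Sum>j<n. a j |a. \<forall>j<n. a j \<in> A j} \<and> y \<in> A n"
      by (intro exI[of _ "\<Sum>j<n. a j"] exI[of _ "a n"]) auto
  qed
  ultimately show ?case
    using ball_cover_mono[of _ "\<delta> / 2 + \<delta> / 2" _ \<delta>] by simp
qed

lemma (in finite_complete_measure) bochner_integral_real:
  fixes f :: "'a \<Rightarrow> real"
  assumes "integrable M f"
  shows "has_strong_bochner_integral M f (integral\<^sup>L M f)"
proof -
  have L1: "L1_function M f"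
    using assms by (intro L1_function_bound[of f "\<lambda>x. \<bar>f x\<bar>"] strongly_measurable_real) auto
  obtain v where v: "has_strong_bochner_integral M f v" using has_strong_bochner_integral_bochner_integral[OF L1] by blast
  then have "has_bochner_integral M f v"
    unfolding has_strong_bochner_integral_def
    using borel_measurable_integrable[OF assms] by (blast intro: has_bochner_integral.intros)
  then have "integral\<^sup>L M f = v" by (rule has_bochner_integral_integral_eq)
  then show ?thesis using v by simp
qed

lemma (in finite_complete_measure) bochner_integral_scaleR_left:
  fixes w :: "'a \<Rightarrow> real" and c :: "'b::banach"
  assumes "integrable M w"
  shows "L1_function M (\<lambda>x. w x *\<^sub>R c)" "bochner_integral M (\<lambda>x. w x *\<^sub>R c) = integral\<^sup>L M w *\<^sub>R c"
proof -
  show "L1_function M (\<lambda>x. w x *\<^sub>R c)"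
    using assms by (intro L1_function_bound[of _ "\<lambda>x. \<bar>w x\<bar> * norm c"] strongly_measurable_scaleR strongly_measurable_const) auto
  show "bochner_integral M (\<lambda>x. w x *\<^sub>R c) = integral\<^sup>L M w *\<^sub>R c"
    by (rule bochner_integral_eqI[OF has_strong_bochner_integral_bounded_linear[OF
          bounded_linear_scaleR_left bochner_integral_real[OF assms]]])
qed

section \<open>Total boundedness of sets of mild solutions in the space of continuous
  functions\<close>

context semigroup_on_interval
begin

definition clampT :: "real \<Rightarrow> real" where "clampT t = max 0 (min T t)"

lemma clampT: "0 \<le> clampT t" "clampT t \<le> T"
  using T_pos by (auto simp: clampT_def)

lemma clampT_id: "0 \<le> t \<Longrightarrow> t \<le> T \<Longrightarrow> clampT t = t"
  by (simp add: clampT_def)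

text \<open>The constant extension beyond the end points embeds the continuous functions on the
  interval isometrically into the type of bounded continuous functions, where norm, convexity and
  completeness come with the type; \<open>C_space\<close> is a metric without linear
  structure.\<close>

definition extC :: "(real \<Rightarrow> 'e) \<Rightarrow> real \<Rightarrow>\<^sub>C 'e" where
  "extC \<phi> = Bcontfun (\<lambda>t. \<phi> (clampT t))"

lemma extC_apply:
  assumes "continuous_on {0..T} \<phi>"
  shows "extC \<phi> t = \<phi> (clampT t)"
proof -
  have "continuous_on UNIV (\<lambda>t. \<phi> (clampT t))"
    by (rule continuous_on_compose2[OF assms])
      (use T_pos in \<open>auto simp: clampT_def[abs_def] intro!: continuous_intros\<close>)
  moreover have "bounded (range (\<lambda>t. \<phi> (clampT t)))"
    by (rule bounded_subset[OF compact_imp_bounded[OF compact_continuous_image[OF assms compact_Icc]]])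
      (auto simp: clampT)
  ultimately show ?thesis unfolding extC_def by (subst Bcontfun_inverse) (auto simp: bcontfun_def)
qed

lemma dist_extC_le:
  assumes "continuous_on {0..T} \<phi>" "continuous_on {0..T} \<psi>"
    "\<And>t. 0 \<le> t \<Longrightarrow> t \<le> T \<Longrightarrow> norm (\<phi> t - \<psi> t) \<le> b"
  shows "dist (extC \<phi>) (extC \<psi>) \<le> b"
  by (rule dist_bound) (use assms(3)[OF clampT] in \<open>simp add: extC_apply assms dist_norm\<close>)

lemma orbit_continuous: "continuous_on {0..T} (\<lambda>t. U t b)"
  unfolding continuous_on_sequentially comp_def by (auto intro!: U_tendsto)

text \<open>The grid is the same for all t, which later allows finitely many cell integrals to
  control a whole function of t. On cells to the left of t the orbit varies little, uniformly in t;
  only the cell around t escapes, and it is short.\<close>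

lemma kernel_step_approximation:
  assumes "\<epsilon> > 0"
  obtains N :: nat and y :: "real \<Rightarrow> nat \<Rightarrow> 'e" where "N > 0"
    "\<forall>t\<in>{0..T}. \<forall>i. norm (y t i) \<le> M * norm z"
    "\<forall>t\<in>{0..T}. \<exists>b. integrable (lebesgue_on {0..T}) b \<and> (LINT s|lebesgue_on {0..T}. b s) \<le> \<epsilon> \<and>
      (\<forall>s\<in>{0..T}. norm (kernel (\<lambda>_. z) t s - y t (nat \<lfloor>s / (T / N)\<rfloor>)) \<le> b s)"
proof -
  obtain \<delta> where \<delta>: "\<delta> > 0"
    "\<And>s t. 0 \<le> s \<Longrightarrow> s \<le> T \<Longrightarrow> 0 \<le> t \<Longrightarrow> t \<le> T \<Longrightarrow> \<bar>s - t\<bar> < \<delta> \<Longrightarrow> norm (U s z - U t z) \<le> \<epsilon> / (2 * T)"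
    using U_modulus[of "\<epsilon> / (2 * T)" z] assms T_pos by auto
  \<comment> \<open>The first bound serves the modulus of continuity; the second makes the
    contribution of the cell around t, at most M |z| h, no larger than \<epsilon> / 2.\<close>
  define \<eta> where "\<eta> = min \<delta> (\<epsilon> / (2 * (M * norm z + 1)))"
  have Mz: "M * norm z \<ge> 0" using M_pos by simp
  then have "\<eta> > 0" unfolding \<eta>_def using \<delta>(1) assms by (simp add: add_nonneg_pos)
  then obtain N :: nat where N: "T / \<eta> < real N" using reals_Archimedean2 by blast
  have "0 < T / \<eta>" using T_pos \<open>\<eta> > 0\<close> by simp
  then have N0: "N > 0" using N by (intro gr0I) simp
  define h where "h = T / real N"
  have h: "h > 0" using T_pos N0 by (simp add: h_def)
  have h\<eta>: "h < \<eta>" unfolding h_def using N N0 \<open>\<eta> > 0\<close> by (simp add: pos_divide_less_eq mult.commute)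
  \<comment> \<open>A cell gets a nonzero value only if it ends no later than t. Points s \<le> t of
    the remaining cell lie in \<open>B\<close>, where the crude bound M |z| is used.\<close>
  define y where "y t i = (if (real i + 1) * h \<le> t then U (t - real i * h) z else 0)" for t and i :: nat
  show ?thesis
  proof (rule that[OF N0, of y]; intro ballI allI)
    fix t i assume "t \<in> {0..T}"
    then have t: "0 \<le> t" "t \<le> T" by auto
    show "norm (y t i) \<le> M * norm z"
    proof (cases "(real i + 1) * h \<le> t")
      case True
      have "real i * h \<le> (real i + 1) * h" "0 \<le> real i * h" using h by (auto simp: algebra_simps)
      then show ?thesis using True t norm_U_apply[of "t - real i * h" z] by (simp add: y_def)
    qed (use Mz in \<open>simp add: y_def\<close>)
  next
    fix t assume "t \<in> {0..T}"
    then have t: "0 \<le> t" "t \<le> T" by auto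
    let ?L = "lebesgue_on {0..T}"
    define B where "B = {max 0 (t - h)..t}"
    have B: "B \<subseteq> {0..T}" "B \<in> sets ?L"
      using t by (auto simp: B_def sets_restrict_space_iff)
    have mB: "measure ?L B \<le> h"
      using B(1) t h by (simp add: B_def measure_restrict_space)
    define b where "b s = \<epsilon> / (2 * T) + M * norm z * indicator B s" for s
    have intB: "integrable ?L (indicator B :: real \<Rightarrow> real)"
      using B by (simp add: lebesgue.emeasure_finite less_top[symmetric])
    have "(LINT s|?L. b s) = \<epsilon> / (2 * T) * measure ?L (space ?L) + M * norm z * measure ?L B"
      unfolding b_def using intB B by (subst Bochner_Integration.integral_add) (auto simp: Int_absorb2 Int_absorb1)
    also have "\<dots> \<le> \<epsilon> / 2 + \<epsilon> / 2"
    proof (rule add_mono)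
      show "\<epsilon> / (2 * T) * measure ?L (space ?L) \<le> \<epsilon> / 2"
        using T_pos by (simp add: measure_restrict_space)
      have "M * norm z * measure ?L B \<le> M * norm z * (\<epsilon> / (2 * (M * norm z + 1)))"
        using mB h\<eta> Mz by (intro mult_left_mono) (auto simp: \<eta>_def)
      also have "\<dots> \<le> \<epsilon> / 2"
        using Mz assms by (simp add: field_simps add_nonneg_pos)
      finally show "M * norm z * measure ?L B \<le> \<epsilon> / 2" .
    qed
    finally have "(LINT s|?L. b s) \<le> \<epsilon>" by simp
    moreover have "integrable ?L b" unfolding b_def using intB by simp
    moreover have "\<forall>s\<in>{0..T}. norm (kernel (\<lambda>_. z) t s - y t (nat \<lfloor>s / (T / N)\<rfloor>)) \<le> b s"
    proof
      fix s assume s: "s \<in> {0..T}"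
      define i where "i = nat \<lfloor>s / h\<rfloor>"
      have "real i \<le> s / h" "s / h < real i + 1"
        using s h by (auto simp: i_def intro: order_trans[OF _ of_int_floor_le])
      then have i: "real i * h \<le> s" "s < (real i + 1) * h"
        using h by (simp_all add: pos_le_divide_eq pos_divide_less_eq)
      have e0: "0 \<le> \<epsilon> / (2 * T)" using assms T_pos by simp
      have "norm (kernel (\<lambda>_. z) t s - y t i) \<le> b s"
      proof (cases "(real i + 1) * h \<le> t")
        case True
        have ih: "0 \<le> real i * h" using h by simp
        have "norm (U (t - s) z - U (t - real i * h) z) \<le> \<epsilon> / (2 * T)"
        proof (rule \<delta>(2))
          have "(real i + 1) * h = real i * h + h" by (simp add: algebra_simps)
          then have "s < real i * h + h" "real i * h + h \<le> t" using i True by auto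
          moreover have "h < \<delta>" "0 \<le> s" using h\<eta> s by (auto simp: \<eta>_def)
          ultimately show "0 \<le> t - s" "t - s \<le> T" "0 \<le> t - real i * h" "t - real i * h \<le> T"
            "\<bar>t - s - (t - real i * h)\<bar> < \<delta>"
            using i(1) t ih h by linarith+
        qed
        moreover have "0 \<le> M * norm z * indicator B s" using Mz by simp
        ultimately show ?thesis using True i by (simp add: y_def kernel_def b_def)
      next
        case False
        show ?thesis
        proof (cases "s \<le> t")
          case True
          have "s \<in> B" using True s i False by (auto simp: B_def algebra_simps)
          then show ?thesis
            using True False norm_U_apply[of "t - s" z] s t e0 by (simp add: y_def kernel_def b_def)
        next
          case False2: False
          show ?thesis using False False2 e0 Mz by (simp add: y_def kernel_def b_def)
        qed
      qed
      then show "norm (kernel (\<lambda>_. z) t s - y t (nat \<lfloor>s / (T / N)\<rfloor>)) \<le> b s"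
        by (simp add: i_def h_def)
    qed
    ultimately show "\<exists>b. integrable ?L b \<and> (LINT s|?L. b s) \<le> \<epsilon> \<and>
      (\<forall>s\<in>{0..T}. norm (kernel (\<lambda>_. z) t s - y t (nat \<lfloor>s / (T / N)\<rfloor>)) \<le> b s)" by blast
  qed
qed

definition unit_weights :: "(real \<Rightarrow> real) set" where
  "unit_weights = {w \<in> borel_measurable (lebesgue_on {0..T}). \<forall>s. 0 \<le> w s \<and> w s \<le> 1}"

lemma integrable_unit_weights_mult:
  assumes "w \<in> unit_weights" "integrable (lebesgue_on {0..T}) b"
  shows "integrable (lebesgue_on {0..T}) (\<lambda>s. w s * b s)"
proof (rule Bochner_Integration.integrable_bound[OF assms(2)])
  show "(\<lambda>s. w s * b s) \<in> borel_measurable (lebesgue_on {0..T})"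
    using assms by (auto simp: unit_weights_def)
  show "AE s in lebesgue_on {0..T}. norm (w s * b s) \<le> norm (b s)"
    using assms(1) by (intro AE_I2) (simp add: unit_weights_def abs_mult mult_left_le_one_le)
qed

lemma integrable_unit_weights: "w \<in> unit_weights \<Longrightarrow> integrable (lebesgue_on {0..T}) w"
  using integrable_unit_weights_mult[of w "\<lambda>_. 1"] by simp

lemma L1_unit_weights: "w \<in> unit_weights \<Longrightarrow> L1_function (lebesgue_on {0..T}) (\<lambda>s. w s *\<^sub>R z)"
  by (intro lebesgue.bochner_integral_scaleR_left integrable_unit_weights)

text \<open>Compactness of a Volterra operator: up to \<delta> / 4 the value at t is the combination
  of the vectors \<open>y t i\<close> with coefficients \<open>a w i\<close>, the integrals of w
  over the cells. These numbers do not depend on t, so rounding them splits all weights into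
  finitely many classes.\<close>

lemma ball_cover_mild_scalar:
  assumes "\<delta> > 0"
  shows "ball_cover ((\<lambda>w. extC (mild (\<lambda>s. w s *\<^sub>R z))) ` unit_weights) \<delta>"
proof -
  let ?L = "lebesgue_on {0..T}"
  have "\<delta> / 4 > 0" using assms by simp
  then obtain N :: nat and y :: "real \<Rightarrow> nat \<Rightarrow> 'e" where N: "N > 0"
    and y: "\<forall>t\<in>{0..T}. \<forall>i. norm (y t i) \<le> M * norm z"
    and b: "\<forall>t\<in>{0..T}. \<exists>b. integrable ?L b \<and> (LINT s|?L. b s) \<le> \<delta> / 4 \<and>
      (\<forall>s\<in>{0..T}. norm (kernel (\<lambda>_. z) t s - y t (nat \<lfloor>s / (T / N)\<rfloor>)) \<le> b s)"
    by (rule kernel_step_approximation[of "\<delta> / 4" z])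
  define idx where "idx s = nat \<lfloor>s / (T / N)\<rfloor>" for s
  define cell where "cell i s = (if idx s = i then 1 else 0 :: real)" for i s
  \<comment> \<open>The cells are numbered 0 to N, the last one being hit by s = T only, hence
    \<open>Suc N\<close> summands. \<open>K\<close> makes the rounding error C / K at most \<delta>
    / 4; with the two approximation errors the total is 3 \<delta> / 4.\<close>
  define C where "C = M * norm z * real (Suc N) + 1"
  have C: "C > 0" using M_pos by (simp add: C_def add_nonneg_pos)
  obtain K :: nat where K: "4 * C / \<delta> < real K" using reals_Archimedean2 by blast
  have "0 < 4 * C / \<delta>" using C assms by simp
  then have K0: "real K > 0" using K by linarith
  define a where "a w i = (LINT s|?L. w s * cell i s)" for w i
  define \<kappa> where "\<kappa> w = (\<lambda>i\<in>{..N}. \<lfloor>real K * a w i\<rfloor>)" for w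
  have cell_meas: "cell i \<in> borel_measurable ?L" for i
  proof -
    have "cell i \<in> borel_measurable borel" unfolding cell_def idx_def by measurable
    then show ?thesis by (intro measurable_restrict_space1 measurable_completion) simp
  qed
  have cell_W: "cell i \<in> unit_weights" for i
    using cell_meas by (auto simp: unit_weights_def cell_def)
  have prod_W: "(\<lambda>s. w s * cell i s) \<in> unit_weights" if "w \<in> unit_weights" for w i
  proof -
    have "(\<lambda>s. w s * cell i s) \<in> borel_measurable ?L"
      using that cell_meas by (intro borel_measurable_times) (auto simp: unit_weights_def)
    then show ?thesis using that by (auto simp: unit_weights_def cell_def)
  qed
  have idx_le: "idx s \<le> N" if "s \<in> {0..T}" for s
  proof -
    have "s / (T / N) \<le> real N" using that T_pos N by (simp add: divide_le_eq)
    then have "\<lfloor>s / (T / N)\<rfloor> \<le> int N" by linarith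
    then show ?thesis by (simp add: idx_def)
  qed
  have a_range: "0 \<le> a w i" "a w i \<le> T" if w: "w \<in> unit_weights" for w i
  proof -
    show "0 \<le> a w i" unfolding a_def using prod_W[OF w, of i]
      by (intro Bochner_Integration.integral_nonneg) (auto simp: unit_weights_def)
    have "a w i \<le> (LINT s|?L. 1)" unfolding a_def
      using prod_W[OF w, of i] by (intro integral_mono integrable_unit_weights) (auto simp: unit_weights_def)
    then show "a w i \<le> T" using T_pos by (simp add: measure_restrict_space)
  qed
  show ?thesis
  proof (rule ball_cover_finite_classes[where \<kappa> = \<kappa>])
    have "\<kappa> ` unit_weights \<subseteq> ({..N} \<rightarrow>\<^sub>E {0..\<lfloor>real K * T\<rfloor>})"
    proof (intro subsetI, elim imageE, simp only: \<kappa>_def, intro restrict_PiE_iff[THEN iffD2] ballI)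
      fix w i assume w: "w \<in> unit_weights"
      show "\<lfloor>real K * a w i\<rfloor> \<in> {0..\<lfloor>real K * T\<rfloor>}"
        using a_range[OF w, of i] K0 by (auto intro!: floor_mono mult_left_mono)
    qed
    then show "finite (\<kappa> ` unit_weights)"
      by (rule finite_subset) (intro finite_PiE; simp)
    fix v w assume v: "v \<in> unit_weights" and w: "w \<in> unit_weights" and eq: "\<kappa> v = \<kappa> w"
    have a_diff: "\<bar>a v i - a w i\<bar> \<le> 1 / real K" if "i \<le> N" for i
    proof -
      have "\<lfloor>real K * a v i\<rfloor> = \<lfloor>real K * a w i\<rfloor>"
        using fun_cong[OF eq, of i] that by (simp add: \<kappa>_def)
      then have "\<bar>real K * a v i - real K * a w i\<bar> \<le> 1" by linarith
      then have "real K * \<bar>a v i - a w i\<bar> \<le> 1" using K0 by (simp add: abs_mult right_diff_distrib[symmetric])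
      then show ?thesis using K0 by (simp add: pos_le_divide_eq mult.commute)
    qed
    have cont: "continuous_on {0..T} (mild (\<lambda>s. v s *\<^sub>R z))" "continuous_on {0..T} (mild (\<lambda>s. w s *\<^sub>R z))"
      by (intro mild_continuous L1_unit_weights v w)+
    have "dist (extC (mild (\<lambda>s. v s *\<^sub>R z))) (extC (mild (\<lambda>s. w s *\<^sub>R z))) \<le> 3 / 4 * \<delta>"
    proof (rule dist_extC_le[OF cont])
      fix t assume t: "0 \<le> t" "t \<le> T"
      obtain b where bi: "integrable ?L b" "(LINT s|?L. b s) \<le> \<delta> / 4"
        and bb: "\<forall>s\<in>{0..T}. norm (kernel (\<lambda>_. z) t s - y t (idx s)) \<le> b s"
      proof -
        have "t \<in> {0..T}" using t by simp
        from bspec[OF b this] show ?thesis using that unfolding idx_def by blast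
      qed
      define st where "st u = (\<lambda>s. \<Sum>i\<le>N. (u s * cell i s) *\<^sub>R y t i)" for u :: "real \<Rightarrow> real"
      have st_eq: "st u s = u s *\<^sub>R y t (idx s)" if "s \<in> {0..T}" for u s
      proof -
        have "st u s = (\<Sum>i\<in>{idx s}. (u s * cell i s) *\<^sub>R y t i)"
          unfolding st_def using idx_le[OF that] by (intro sum.mono_neutral_right) (auto simp: cell_def)
        then show ?thesis by (simp add: cell_def)
      qed
      have st: "L1_function ?L (st u)" "bochner_integral ?L (st u) = (\<Sum>i\<le>N. a u i *\<^sub>R y t i)"
        if u: "u \<in> unit_weights" for u
      proof -
        have i: "integrable ?L (\<lambda>s. u s * cell i s)" for i
          by (intro integrable_unit_weights prod_W u)
        show "L1_function ?L (st u)" "bochner_integral ?L (st u) = (\<Sum>i\<le>N. a u i *\<^sub>R y t i)"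
          using lebesgue.bochner_integral_sum[of "{..N}" "\<lambda>i s. (u s * cell i s) *\<^sub>R y t i",
              OF _ lebesgue.bochner_integral_scaleR_left(1)[OF i]]
          by (simp_all add: st_def a_def lebesgue.bochner_integral_scaleR_left(2)[OF i])
      qed
      have near: "norm (mild (\<lambda>s. u s *\<^sub>R z) t - (\<Sum>i\<le>N. a u i *\<^sub>R y t i)) \<le> \<delta> / 4"
        if u: "u \<in> unit_weights" for u
      proof -
        have "norm (mild (\<lambda>s. u s *\<^sub>R z) t - (\<Sum>i\<le>N. a u i *\<^sub>R y t i)) \<le> (LINT s|?L. b s)"
          unfolding mild_def st(2)[OF u, symmetric]
        proof (rule lebesgue.norm_bochner_integral_diff_le)
          show "AE s in ?L. norm (kernel (\<lambda>s. u s *\<^sub>R z) t s - st u s) \<le> b s"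
          proof (rule AE_I2)
            fix s assume "s \<in> space ?L"
            then have s: "s \<in> {0..T}" by simp
            have "kernel (\<lambda>s. u s *\<^sub>R z) t s - st u s = u s *\<^sub>R (kernel (\<lambda>_. z) t s - y t (idx s))"
              by (simp add: st_eq[OF s] kernel_def blinfun.scaleR_right scaleR_diff_right)
            then have "norm (kernel (\<lambda>s. u s *\<^sub>R z) t s - st u s) \<le> norm (kernel (\<lambda>_. z) t s - y t (idx s))"
              using u by (simp add: unit_weights_def mult_left_le_one_le)
            also have "\<dots> \<le> b s" using bb s by blast
            finally show "norm (kernel (\<lambda>s. u s *\<^sub>R z) t s - st u s) \<le> b s" .
          qed
        qed (use bi st u t in \<open>auto intro: kernel_L1 L1_unit_weights\<close>)
        then show ?thesis using bi by simp
      qed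
      have "norm ((\<Sum>i\<le>N. a v i *\<^sub>R y t i) - (\<Sum>i\<le>N. a w i *\<^sub>R y t i)) = norm (\<Sum>i\<le>N. (a v i - a w i) *\<^sub>R y t i)"
        by (simp add: sum_subtractf scaleR_diff_left)
      also have "\<dots> \<le> (\<Sum>i\<le>N. 1 / real K * (M * norm z))"
      proof (intro order_trans[OF norm_sum] sum_mono)
        fix i assume "i \<in> {..N}"
        then have "\<bar>a v i - a w i\<bar> * norm (y t i) \<le> 1 / real K * (M * norm z)"
          using a_diff[of i] y t K0 by (intro mult_mono) auto
        then show "norm ((a v i - a w i) *\<^sub>R y t i) \<le> 1 / real K * (M * norm z)" by simp
      qed
      also have "\<dots> = M * norm z * real (Suc N) / real K" by simp
      also have "\<dots> \<le> C / real K" using K0 by (intro divide_right_mono) (auto simp: C_def)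
      also have "\<dots> \<le> \<delta> / 4" using K K0 assms by (simp add: field_simps)
      finally have "norm ((\<Sum>i\<le>N. a v i *\<^sub>R y t i) - (\<Sum>i\<le>N. a w i *\<^sub>R y t i)) \<le> \<delta> / 4" .
      then show "norm (mild (\<lambda>s. v s *\<^sub>R z) t - mild (\<lambda>s. w s *\<^sub>R z) t) \<le> 3 / 4 * \<delta>"
        using near[OF v] near[OF w]
          norm_triangle_ineq4[of "mild (\<lambda>s. v s *\<^sub>R z) t - (\<Sum>i\<le>N. a v i *\<^sub>R y t i)" "mild (\<lambda>s. w s *\<^sub>R z) t - (\<Sum>i\<le>N. a w i *\<^sub>R y t i)"]
          norm_triangle_ineq[of "(mild (\<lambda>s. v s *\<^sub>R z) t - (\<Sum>i\<le>N. a v i *\<^sub>R y t i)) - (mild (\<lambda>s. w s *\<^sub>R z) t - (\<Sum>i\<le>N. a w i *\<^sub>R y t i))"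
            "(\<Sum>i\<le>N. a v i *\<^sub>R y t i) - (\<Sum>i\<le>N. a w i *\<^sub>R y t i)"]
        by (simp add: algebra_simps)
    qed
    then show "dist (extC (mild (\<lambda>s. v s *\<^sub>R z))) (extC (mild (\<lambda>s. w s *\<^sub>R z))) < \<delta>"
      using assms by simp
  qed
qed

text \<open>A pointwise estimate becomes one in the space of continuous functions. Replacing
  \<open>f s\<close> by the nearest point of a finite net of \<open>C\<close> costs at most
  \<open>e s + \<delta>'\<close>, and the new functions are sums of finitely many scalar weights
  times fixed vectors, to which \<open>ball_cover_mild_scalar\<close> applies.\<close>

lemma ball_cover_mild:
  assumes \<Phi>: "\<And>f. f \<in> \<Phi> \<Longrightarrow> L1_function (lebesgue_on {0..T}) f"
    and e: "integrable (lebesgue_on {0..T}) e" and C: "compact C" "C \<noteq> {}"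
    and near: "\<And>f. f \<in> \<Phi> \<Longrightarrow> AE s in lebesgue_on {0..T}. \<exists>v\<in>C. norm (f s - v) \<le> e s"
    and "\<delta> > 0"
  shows "ball_cover ((\<lambda>f. extC (mild f)) ` \<Phi>) (M * (LINT s|lebesgue_on {0..T}. e s) + \<delta>)"
proof -
  let ?L = "lebesgue_on {0..T}"
  define \<delta>' where "\<delta>' = \<delta> / (2 * M * T)"
  have \<delta>': "\<delta>' > 0" using \<open>\<delta> > 0\<close> M_pos T_pos by (simp add: \<delta>'_def)
  obtain Z where Z: "finite Z" "C \<subseteq> (\<Union>c\<in>Z. ball c \<delta>')"
    using compact_imp_ball_cover[OF C(1) \<delta>'] by (rule ball_coverE)
  then have "Z \<noteq> {}" using C(2) by auto
  then have "card Z > 0" using Z(1) by (simp add: card_gt_0_iff)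
  then obtain l where l: "card Z = Suc l" using gr0_implies_Suc by blast
  obtain zz where zz: "Z = zz ` {i::nat. i < Suc l}"
    using finite_imp_nat_seg_image_inj_on[OF Z(1)] l by (metis card_Collect_less_nat card_image)
  define w where "w f j s = (if nearest zz l (f s) = j then 1 else 0 :: real)" for f :: "real \<Rightarrow> 'e" and j s
  have wW: "w f j \<in> unit_weights" if "f \<in> \<Phi>" for f j
  proof -
    have "(\<lambda>s. dist (f s) (zz j)) \<in> borel_measurable ?L" for j
      using lebesgue.norm_borel_measurable[OF lebesgue.strongly_measurable_diff[OF _ lebesgue.strongly_measurable_const[of "zz j"]]]
        \<Phi>[OF that] by (simp add: L1_function_def dist_norm)
    from lebesgue.sets_nearest_eq[OF this] have "{s \<in> space ?L. nearest zz l (f s) = j} \<in> sets ?L" .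
    then have "w f j \<in> borel_measurable ?L" unfolding w_def by (intro measurable_If) auto
    then show ?thesis by (auto simp: unit_weights_def w_def)
  qed
  define f' where "f' f s = (\<Sum>j<Suc l. w f j s *\<^sub>R zz j)" for f s
  have f'_eq: "f' f s = zz (nearest zz l (f s))" for f s
  proof -
    have "f' f s = (\<Sum>j\<in>{nearest zz l (f s)}. w f j s *\<^sub>R zz j)"
      unfolding f'_def using nearest_le[of zz l "f s"] by (intro sum.mono_neutral_right) (auto simp: w_def)
    then show ?thesis by (simp add: w_def)
  qed
  have f'_L1: "L1_function ?L (f' f)" if "f \<in> \<Phi>" for f
    unfolding f'_def[abs_def] using lebesgue.bochner_integral_sum[of "{..<Suc l}" "\<lambda>j s. w f j s *\<^sub>R zz j"] L1_unit_weights[OF wW[OF that]]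
    by blast
  have "ball_cover {\<Sum>j<Suc l. a j |a. \<forall>j<Suc l. a j \<in> (\<lambda>w. extC (mild (\<lambda>s. w s *\<^sub>R zz j))) ` unit_weights} (\<delta> / 2)"
    by (intro ball_cover_finite_sums ball_cover_mild_scalar) (use \<open>\<delta> > 0\<close> in auto)
  moreover have "M * (LINT s|?L. e s + \<delta>') = M * (LINT s|?L. e s) + \<delta> / 2"
  proof -
    have "(LINT s|?L. e s + \<delta>') = (LINT s|?L. e s) + \<delta>' * T"
      using e T_pos by (subst Bochner_Integration.integral_add) (auto simp: measure_restrict_space)
    then show ?thesis using M_pos T_pos by (simp add: \<delta>'_def distrib_left)
  qed
  ultimately have "ball_cover ((\<lambda>f. extC (mild f)) ` \<Phi>) (\<delta> / 2 + M * (LINT s|?L. e s + \<delta>'))"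
  proof (elim ball_cover_near)
    fix x assume "x \<in> (\<lambda>f. extC (mild f)) ` \<Phi>"
    then obtain f where f: "f \<in> \<Phi>" "x = extC (mild f)" by blast
    have cont: "continuous_on {0..T} (mild (\<lambda>s. w f j s *\<^sub>R zz j))" for j
      by (intro mild_continuous L1_unit_weights wW f)
    have "extC (mild (f' f)) = (\<Sum>j<Suc l. extC (mild (\<lambda>s. w f j s *\<^sub>R zz j)))"
    proof (rule bcontfun_eqI)
      fix t
      have sum_apply: "apply_bcontfun (\<Sum>j\<in>J. F j) t = (\<Sum>j\<in>J. apply_bcontfun (F j) t)"
        if "finite J" for J :: "nat set" and F :: "nat \<Rightarrow> real \<Rightarrow>\<^sub>C 'e"
        using that by (induction J rule: finite_induct) (auto simp: plus_bcontfun.rep_eq zero_bcontfun.rep_eq)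
      have "mild (f' f) (clampT t) = (\<Sum>j<Suc l. mild (\<lambda>s. w f j s *\<^sub>R zz j) (clampT t))"
        unfolding f'_def[abs_def] using mild_sum[of "{..<Suc l}" "\<lambda>j s. w f j s *\<^sub>R zz j" "clampT t" "\<lambda>_. 1",
            OF _ L1_unit_weights[OF wW[OF f(1)]] clampT] by (simp del: sum.lessThan_Suc)
      then show "apply_bcontfun (extC (mild (f' f))) t = apply_bcontfun (\<Sum>j<Suc l. extC (mild (\<lambda>s. w f j s *\<^sub>R zz j))) t"
        by (simp add: sum_apply extC_apply cont mild_continuous f'_L1 f del: sum.lessThan_Suc)
    qed
    then have "extC (mild (f' f)) \<in> {\<Sum>j<Suc l. a j |a. \<forall>j<Suc l. a j \<in> (\<lambda>w. extC (mild (\<lambda>s. w s *\<^sub>R zz j))) ` unit_weights}"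
      using wW[OF f(1)] by blast
    moreover have "dist x (extC (mild (f' f))) \<le> M * (LINT s|?L. e s + \<delta>')"
      unfolding f(2)
    proof (rule dist_extC_le)
      fix t assume t: "0 \<le> t" "t \<le> T"
      show "norm (mild f t - mild (f' f) t) \<le> M * (LINT s|?L. e s + \<delta>')"
      proof (rule norm_mild_diff_le)
        show "AE s in ?L. norm (f s - f' f s) \<le> e s + \<delta>'"
          using near[OF f(1)]
        proof eventually_elim
          case (elim s)
          then obtain v where v: "v \<in> C" "norm (f s - v) \<le> e s" by blast
          then obtain c where c: "c \<in> Z" "dist c v < \<delta>'" using Z(2) by auto
          from c(1) have "c \<in> zz ` {i. i < Suc l}" by (simp only: zz)
          then obtain j where "c = zz j" "j < Suc l" by blast
          then have j: "j \<le> l" "c = zz j" by auto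
          have "dist (f s) (zz (nearest zz l (f s))) \<le> dist (f s) (zz j)" by (rule nearest_dist[OF j(1)])
          also have "\<dots> \<le> dist (f s) v + dist (zz j) v" by (rule dist_triangle2)
          finally show ?case using v(2) c(2) by (simp add: f'_eq dist_norm j(2))
        qed
      qed (use \<Phi> f f'_L1 e t in auto)
    qed (intro mild_continuous \<Phi> f'_L1 f)+
    ultimately show "\<exists>b\<in>{\<Sum>j<Suc l. a j |a. \<forall>j<Suc l. a j \<in> (\<lambda>w. extC (mild (\<lambda>s. w s *\<^sub>R zz j))) ` unit_weights}.
        dist x b \<le> M * (LINT s|?L. e s + \<delta>')" by blast
  qed
  moreover note \<open>M * (LINT s|?L. e s + \<delta>') = M * (LINT s|?L. e s) + \<delta> / 2\<close>
  ultimately show ?thesis by (simp add: algebra_simps)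
qed

end

section \<open>Reduction to a separable subspace\<close>

text \<open>The inequality \<open>x * exp x \<le> (1 + x) * (exp x - 1)\<close> compares the two sides on a short interval, so no
  differentiation of the absolutely continuous function \<open>m\<close> is needed.\<close>

lemma integral_exp_le:
  fixes \<mu> :: "real \<Rightarrow> real"
  assumes \<mu>: "\<mu> absolutely_integrable_on {0..T}" "\<And>t. 0 \<le> \<mu> t" and c: "0 \<le> c" and t: "0 \<le> t" "t \<le> T"
  defines "m \<equiv> \<lambda>t. integral {0..t} \<mu>"
  shows "(\<lambda>s. \<mu> s * exp (c * m s)) absolutely_integrable_on {0..T}"
    "c * integral {0..t} (\<lambda>s. \<mu> s * exp (c * m s)) \<le> exp (c * m t) - 1"
proof -
  have \<mu>_int: "\<mu> integrable_on {a..b}" if "0 \<le> a" "b \<le> T" for a b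
    by (rule integrable_on_subinterval[of _ "{0..T}"])
      (use \<mu>(1) that in \<open>auto intro: set_lebesgue_integral_eq_integral(1)\<close>)
  have m_cont: "continuous_on {0..T} m"
    unfolding m_def by (intro indefinite_integral_continuous_1 \<mu>_int) auto
  have m_add: "m b - m a = integral {a..b} \<mu>" if "0 \<le> a" "a \<le> b" "b \<le> T" for a b
    using Henstock_Kurzweil_Integration.integral_combine[of 0 a b \<mu>] \<mu>_int[of 0 b] that by (simp add: m_def)
  have m_mono: "m a \<le> m b" if "0 \<le> a" "a \<le> b" "b \<le> T" for a b
    using m_add[OF that] integral_nonneg[OF \<mu>_int[of a b]] \<mu>(2) that by simp
  have m0: "m 0 = 0" by (simp add: m_def)
  define \<phi> where "\<phi> s = \<mu> s * exp (c * m s)" for s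
  have cont: "continuous_on {0..T} (\<lambda>s. exp (c * m s))" by (intro continuous_intros m_cont)
  have "bounded ((\<lambda>s. exp (c * m s)) ` {0..T})"
    by (intro compact_imp_bounded compact_continuous_image cont compact_Icc)
  then have "(\<lambda>s. exp (c * m s) * \<mu> s) absolutely_integrable_on {0..T}"
    by (intro absolutely_integrable_bounded_measurable_product_real \<mu>
        continuous_imp_measurable_on_sets_lebesgue cont) auto
  then show abs: "(\<lambda>s. \<mu> s * exp (c * m s)) absolutely_integrable_on {0..T}"
    by (simp add: mult.commute)
  have \<phi>_int: "\<phi> integrable_on {a..b}" if "0 \<le> a" "b \<le> T" for a b
    unfolding \<phi>_def by (rule integrable_on_subinterval[of _ "{0..T}"])
      (use abs that in \<open>auto intro: set_lebesgue_integral_eq_integral(1)\<close>)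
  have piece: "c * integral {a..b} \<phi> \<le> (1 + c * \<delta>) * (exp (c * m b) - exp (c * m a))"
    if ab: "0 \<le> a" "a \<le> b" "b \<le> T" and \<delta>: "m b - m a \<le> \<delta>" for a b \<delta>
  proof -
    define x where "x = c * (m b - m a)"
    have x: "0 \<le> x" "x \<le> c * \<delta>" unfolding x_def using m_mono[OF ab] \<delta> c by (auto intro: mult_left_mono)
    have "integral {a..b} \<phi> \<le> integral {a..b} (\<lambda>s. \<mu> s * exp (c * m b))"
    proof (rule integral_le)
      show "\<phi> integrable_on {a..b}" using ab by (intro \<phi>_int) auto
      show "(\<lambda>s. \<mu> s * exp (c * m b)) integrable_on {a..b}"
        using ab by (intro integrable_on_mult_left \<mu>_int) auto
      show "\<phi> s \<le> \<mu> s * exp (c * m b)" if "s \<in> {a..b}" for s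
        unfolding \<phi>_def using that ab m_mono[of s b] c \<mu>(2) by (intro mult_left_mono) (auto intro: mult_left_mono)
    qed
    also have "\<dots> = (m b - m a) * exp (c * m b)" using m_add[OF ab] by simp
    finally have "c * integral {a..b} \<phi> \<le> c * ((m b - m a) * exp (c * m b))"
      using c by (rule mult_left_mono)
    also have "\<dots> = x * exp x * exp (c * m a)"
      by (simp add: x_def algebra_simps flip: exp_add)
    also have "\<dots> \<le> (1 + x) * (exp x - 1) * exp (c * m a)"
    proof (rule mult_right_mono)
      have "1 + x \<le> exp x" by (rule exp_ge_add_one_self)
      then show "x * exp x \<le> (1 + x) * (exp x - 1)" by (simp add: algebra_simps)
    qed simp
    also have "\<dots> \<le> (1 + c * \<delta>) * (exp x - 1) * exp (c * m a)"
      using x by (intro mult_right_mono) auto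
    also have "\<dots> = (1 + c * \<delta>) * (exp (c * m b) - exp (c * m a))"
    proof -
      have "exp x * exp (c * m a) = exp (c * m b)" by (simp add: x_def algebra_simps flip: exp_add)
      then show ?thesis by (simp add: left_diff_distrib mult.assoc)
    qed
    finally show ?thesis .
  qed
  \<comment> \<open>A partition on whose pieces \<open>m\<close> varies by less than \<delta> gives
    all pieces the same factor, so the exponentials telescope; letting \<delta> tend to 0 removes
    the factor.\<close>
  have approx: "c * integral {0..t} \<phi> \<le> (1 + c * \<delta>) * (exp (c * m t) - 1)" if "\<delta> > 0" for \<delta>
  proof -
    have "uniformly_continuous_on {0..T} m"
      by (intro compact_uniformly_continuous m_cont compact_Icc)
    then obtain d where d: "d > 0" "\<And>a b. a \<in> {0..T} \<Longrightarrow> b \<in> {0..T} \<Longrightarrow> dist b a < d \<Longrightarrow> dist (m b) (m a) < \<delta>"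
      using \<open>\<delta> > 0\<close> unfolding uniformly_continuous_on_def by meson
    obtain n :: nat where n: "t / d < real n" using reals_Archimedean2 by blast
    have "0 \<le> t / d" using t d by simp
    then have n0: "n > 0" using n by (intro gr0I) simp
    define p where "p i = real i * (t / real n)" for i
    have p: "0 \<le> p i" "p i \<le> t" if "i \<le> n" for i
    proof -
      show "0 \<le> p i" using t by (simp add: p_def)
      have "p i \<le> real n * (t / real n)" unfolding p_def using that t by (intro mult_right_mono) auto
      then show "p i \<le> t" using n0 by simp
    qed
    have p_step: "p (Suc i) - p i = t / real n" for i by (simp add: p_def algebra_simps add_divide_distrib)
    have tn: "t / real n < d" using n n0 d by (simp add: pos_divide_less_eq mult.commute)
    have tn0: "0 \<le> t / real n" using t by simp
    have "c * integral {0..p i} \<phi> \<le> (1 + c * \<delta>) * (exp (c * m (p i)) - 1)" if "i \<le> n" for i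
      using that
    proof (induction i)
      case 0
      then show ?case by (simp add: p_def m0)
    next
      case (Suc i)
      have le: "p i \<le> p (Suc i)" using p_step[of i] tn0 by linarith
      have bd: "0 \<le> p i" "p (Suc i) \<le> T" using p(1)[of i] p(2)[of "Suc i"] Suc.prems t by auto
      have "dist (m (p (Suc i))) (m (p i)) < \<delta>"
        using bd le p_step[of i] tn tn0 by (intro d(2)) (auto simp: dist_real_def)
      then have "c * integral {p i..p (Suc i)} \<phi> \<le> (1 + c * \<delta>) * (exp (c * m (p (Suc i))) - exp (c * m (p i)))"
        using bd le by (intro piece) (auto simp: dist_real_def)
      moreover have "integral {0..p (Suc i)} \<phi> = integral {0..p i} \<phi> + integral {p i..p (Suc i)} \<phi>"
        using Henstock_Kurzweil_Integration.integral_combine[of 0 "p i" "p (Suc i)" \<phi>] \<phi>_int[of 0 "p (Suc i)"] bd le by simp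
      moreover have "c * integral {0..p i} \<phi> \<le> (1 + c * \<delta>) * (exp (c * m (p i)) - 1)"
        using Suc by simp
      ultimately show ?case by (simp add: algebra_simps)
    qed
    from this[of n] show ?thesis using n0 by (simp add: p_def)
  qed
  have "((\<lambda>\<delta>. (1 + c * \<delta>) * (exp (c * m t) - 1)) \<longlongrightarrow> (1 + c * 0) * (exp (c * m t) - 1)) (at_right 0)"
    by (intro tendsto_intros)
  moreover have "\<forall>\<^sub>F \<delta> in at_right 0. c * integral {0..t} \<phi> \<le> (1 + c * \<delta>) * (exp (c * m t) - 1)"
    using approx by (auto simp: eventually_at_right_field intro: exI[of _ 1])
  ultimately have "c * integral {0..t} \<phi> \<le> (1 + c * 0) * (exp (c * m t) - 1)"
    by (intro tendsto_lowerbound) auto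
  then show "c * integral {0..t} (\<lambda>s. \<mu> s * exp (c * m s)) \<le> exp (c * m t) - 1"
    by (simp add: \<phi>_def[abs_def])
qed

text \<open>Countably many rounds suffice because each list has finitely many entries. Lists admit
  operations of any arity together, in particular the formation of interpolants with arbitrarily
  many nodes.\<close>

lemma countable_closure_exists:
  fixes ops :: "'a list \<Rightarrow> 'a set"
  assumes "\<And>l. countable (ops l)"
  obtains D where "countable D" "\<And>l. set l \<subseteq> D \<Longrightarrow> ops l \<subseteq> D"
proof -
  define St where "St D = D \<union> (\<Union>l\<in>lists D. ops l)" for D
  define Dn where "Dn n = (St ^^ n) {}" for n
  have Dn_Suc: "Dn (Suc n) = Dn n \<union> (\<Union>l\<in>lists (Dn n). ops l)" for n by (simp add: Dn_def St_def)
  have cnt: "countable (Dn n)" for n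
  proof (induction n)
    case 0 show ?case by (simp add: Dn_def)
  next
    case (Suc n)
    have "countable (lists (Dn n))" using Suc by (rule countable_lists)
    then show ?case unfolding Dn_Suc using Suc assms by (intro countable_Un countable_UN) auto
  qed
  have mono: "Dn i \<subseteq> Dn j" if "i \<le> j" for i j
    using that by (rule lift_Suc_mono_le[rotated]) (simp add: Dn_Suc)
  show ?thesis
  proof (rule that[of "\<Union>n. Dn n"])
    show "countable (\<Union>n. Dn n)" using cnt by simp
    fix l assume l: "set l \<subseteq> (\<Union>n. Dn n)"
    have "\<exists>n. set l \<subseteq> Dn n"
      using l
    proof (induction l)
      case (Cons a l)
      then obtain n m where "set l \<subseteq> Dn n" "a \<in> Dn m" by auto
      then have "set (a # l) \<subseteq> Dn (max m n)" using mono[of n "max m n"] mono[of m "max m n"] by auto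
      then show ?case by blast
    qed simp
    then obtain n where "set l \<subseteq> Dn n" by blast
    then have "l \<in> lists (Dn n)" by (simp add: in_lists_conv_set subset_iff)
    then have "ops l \<subseteq> Dn (Suc n)" unfolding Dn_Suc by blast
    then show "ops l \<subseteq> (\<Union>n. Dn n)" by blast
  qed
qed

lemma subspace_closure_rational_combinations:
  fixes D :: "'b::real_normed_vector set"
  assumes D0: "0 \<in> D" and D_lin: "\<And>q a b. a \<in> D \<Longrightarrow> b \<in> D \<Longrightarrow> real_of_rat q *\<^sub>R a + b \<in> D"
  shows "subspace (closure D)"
proof -
  have inv0: "(\<lambda>n. 1 / real (Suc n)) \<longlonglongrightarrow> 0"
    using LIMSEQ_inverse_real_of_nat by (simp add: inverse_eq_divide)
  have lin: "c *\<^sub>R x + y \<in> closure D" if "x \<in> closure D" "y \<in> closure D" for c x y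
  proof -
    obtain a b where a: "\<And>n. a n \<in> D" "a \<longlonglongrightarrow> x" and b: "\<And>n. b n \<in> D" "b \<longlonglongrightarrow> y"
      using \<open>x \<in> closure D\<close> \<open>y \<in> closure D\<close> unfolding closure_sequential by blast
    have "\<exists>q. c < real_of_rat q \<and> real_of_rat q < c + 1 / real (Suc n)" for n
      by (rule of_rat_dense) simp
    then obtain q where q: "\<And>n. c < real_of_rat (q n)" "\<And>n. real_of_rat (q n) < c + 1 / real (Suc n)" by metis
    have upper: "(\<lambda>n. c + 1 / real (Suc n)) \<longlonglongrightarrow> c" using tendsto_add[OF tendsto_const inv0, of c] by simp
    have "(\<lambda>n. real_of_rat (q n)) \<longlonglongrightarrow> c"
      by (rule tendsto_sandwich[OF _ _ tendsto_const upper]) (intro always_eventually allI less_imp_le q)+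
    then have "(\<lambda>n. real_of_rat (q n) *\<^sub>R a n + b n) \<longlonglongrightarrow> c *\<^sub>R x + y"
      by (intro tendsto_intros a b)
    then show ?thesis unfolding closure_sequential
      by (intro exI[of _ "\<lambda>n. real_of_rat (q n) *\<^sub>R a n + b n"] conjI allI D_lin a b)
  qed
  have D_cl: "0 \<in> closure D" using D0 closure_subset by blast
  show ?thesis
    unfolding subspace_def using lin[of _ _ 1] lin[of _ 0] D_cl by force
qed

definition hat :: "nat \<Rightarrow> real \<Rightarrow> real" where "hat i s = max 0 (1 - \<bar>s - real i\<bar>)"

text \<open>A partition of unity by hat functions with nodes i T / length l, normalized so that the
  values are convex combinations of the entries. It encodes continuous functions by finite lists, so
  countably many entries produce only countably many functions.\<close>

definition interpolant :: "real \<Rightarrow> 'b::real_vector list \<Rightarrow> real \<Rightarrow> 'b" where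
  "interpolant T l t = (\<Sum>i<length l. (hat i (real (length l) * t / T) / (\<Sum>j<length l. hat j (real (length l) * t / T))) *\<^sub>R l ! i)"

lemma hat_sum_pos:
  assumes "0 < n" "0 \<le> s" "s < real n"
  shows "0 < (\<Sum>j<n. hat j s)"
proof (rule sum_pos2[of _ "nat \<lfloor>s\<rfloor>"])
  show "nat \<lfloor>s\<rfloor> \<in> {..<n}" using assms by (simp add: nat_less_iff floor_less_iff)
  have "real (nat \<lfloor>s\<rfloor>) = of_int \<lfloor>s\<rfloor>" using assms by simp
  then show "0 < hat (nat \<lfloor>s\<rfloor>) s" unfolding hat_def by linarith
qed (auto simp: hat_def)

lemma interpolant_dense:
  fixes x :: "real \<Rightarrow> 'b::real_normed_vector"
  assumes "T > 0" and x: "continuous_on {0..T} x" "\<And>t. t \<in> {0..T} \<Longrightarrow> x t \<in> closure D" and "e > 0"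
  obtains l where "set l \<subseteq> D" "continuous_on {0..T} (interpolant (2 * T) l)"
    "\<And>t. t \<in> {0..T} \<Longrightarrow> norm (interpolant (2 * T) l t - x t) \<le> e"
proof -
  have "uniformly_continuous_on {0..T} x"
    by (intro compact_uniformly_continuous x compact_Icc)
  then obtain d where d: "d > 0" "\<And>s t. s \<in> {0..T} \<Longrightarrow> t \<in> {0..T} \<Longrightarrow> dist t s < d \<Longrightarrow> dist (x t) (x s) < e / 2"
    using \<open>e > 0\<close> unfolding uniformly_continuous_on_def by (meson half_gt_zero)
  obtain n :: nat where n: "2 * T / d < real n" using reals_Archimedean2 by blast
  have "0 < 2 * T / d" using d \<open>T > 0\<close> by simp
  then have n0: "n > 0" using n by (intro gr0I) simp
  \<comment> \<open>The interpolant is formed for an interval of length 2 T because all hats vanish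
    at the right end of their range; nodes beyond T are moved to T.\<close>
  define node where "node i = min T (real i * (2 * T) / real n)" for i
  have node: "node i \<in> {0..T}" for i using \<open>T > 0\<close> by (simp add: node_def)
  have "\<exists>c\<in>D. dist c (x (node i)) < e / 2" for i
    using x(2)[OF node] half_gt_zero[OF \<open>e > 0\<close>] unfolding closure_approachable by blast
  then obtain c where c: "\<And>i. c i \<in> D" "\<And>i. dist (c i) (x (node i)) < e / 2" by metis
  define l where "l = map c [0..<n]"
  have l: "length l = n" "\<And>i. i < n \<Longrightarrow> l ! i = c i" by (simp_all add: l_def)
  have pos: "0 < (\<Sum>j<n. hat j (real n * t / (2 * T)))" if "t \<in> {0..T}" for t
    using that \<open>T > 0\<close> n0 by (intro hat_sum_pos) (auto simp: divide_less_eq)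
  show ?thesis
  proof (rule that[of l])
    show "set l \<subseteq> D" using c by (auto simp: l_def)
    have hc: "continuous_on {0..T} (\<lambda>t. hat i (real n * t / (2 * T)))" for i
      unfolding hat_def using \<open>T > 0\<close> by (intro continuous_intros) auto
    have "\<forall>t\<in>{0..T}. (\<Sum>j<n. hat j (real n * t / (2 * T))) \<noteq> 0" using pos by force
    then show "continuous_on {0..T} (interpolant (2 * T) l)"
      unfolding interpolant_def[abs_def] l by (intro continuous_intros hc)
    fix t assume t: "t \<in> {0..T}"
    define S where "S = (\<Sum>j<n. hat j (real n * t / (2 * T)))"
    define a where "a i = hat i (real n * t / (2 * T)) / S" for i
    have S: "S > 0" using pos[OF t] by (simp add: S_def)
    have a: "0 \<le> a i" for i using S by (simp add: a_def hat_def)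
    have a1: "(\<Sum>i<n. a i) = 1" using S by (simp add: a_def S_def flip: sum_divide_distrib)
    have "interpolant (2 * T) l t = (\<Sum>i<n. a i *\<^sub>R c i)"
      unfolding interpolant_def l(1) a_def S_def using l(2) by (intro sum.cong) auto
    then have "interpolant (2 * T) l t - x t = (\<Sum>i<n. a i *\<^sub>R c i) - (\<Sum>i<n. a i) *\<^sub>R x t" by (simp add: a1)
    also have "\<dots> = (\<Sum>i<n. a i *\<^sub>R (c i - x t))"
      by (simp add: scaleR_sum_left scaleR_diff_right sum_subtractf)
    also have "norm \<dots> \<le> (\<Sum>i<n. norm (a i *\<^sub>R (c i - x t)))" by (rule norm_sum)
    also have "\<dots> \<le> (\<Sum>i<n. a i * e)"
    proof (rule sum_mono)
      fix i assume "i \<in> {..<n}"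
      show "norm (a i *\<^sub>R (c i - x t)) \<le> a i * e"
      proof (cases "a i = 0")
        case False
        then have "\<bar>real n * t / (2 * T) - real i\<bar> < 1" by (auto simp: a_def hat_def)
        then have "\<bar>real n * t / (2 * T) - real i\<bar> * (2 * T / real n) < 1 * (2 * T / real n)"
          using \<open>T > 0\<close> n0 by (intro mult_strict_right_mono) auto
        moreover have "\<bar>real n * t / (2 * T) - real i\<bar> * (2 * T / real n) = \<bar>t - real i * (2 * T) / real n\<bar>"
        proof -
          have "(real n * t / (2 * T) - real i) * (2 * T / real n) = t - real i * (2 * T) / real n"
            using \<open>T > 0\<close> n0 by (simp add: field_simps)
          then show ?thesis using \<open>T > 0\<close> n0 by (metis abs_mult abs_of_pos divide_pos_pos mult_pos_pos of_nat_0_less_iff zero_less_numeral)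
        qed
        moreover have "2 * T / real n < d" using n n0 d by (simp add: pos_divide_less_eq mult.commute)
        ultimately have "\<bar>t - real i * (2 * T) / real n\<bar> < d" by linarith
        then have "dist t (node i) < d" using t by (auto simp: node_def dist_real_def)
        then have "dist (x t) (x (node i)) < e / 2" by (intro d(2) node t)
        with c(2)[of i] have "dist (c i) (x t) < e" using dist_triangle2[of "c i" "x t" "x (node i)"] by linarith
        then show ?thesis using a[of i] by (simp add: dist_norm mult_left_mono)
      qed simp
    qed
    also have "\<dots> = e" using a1 by (simp flip: sum_distrib_right)
    finally show "norm (interpolant (2 * T) l t - x t) \<le> e" .
  qed
qed

text \<open>The growth and the compactness condition hold outside a null set that may depend on the point \<open>x\<close> and
  on the set \<open>\<Omega>\<close>, so they may only be used for countably many \<open>x\<close> and \<open>\<Omega>\<close>. The constant \<open>\<kappa>\<close> is the price of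
  moving the centers of balls that cover a subset of a separable space into one fixed sequence: \<open>1\<close> in the
  presence of norm one projections, and \<open>2\<close> in general. The map \<open>G\<close> is \<open>g\<close>, transported to functions on the
  whole line that are considered on \<open>{0..T}\<close> only.\<close>

locale nonlocal_inclusion = semigroup_on_interval U T M
  for U :: "real \<Rightarrow> 'e::banach \<Rightarrow>\<^sub>L 'e" and T M +
  fixes F :: "real \<Rightarrow> 'e \<Rightarrow> 'e set" and G :: "(real \<Rightarrow>\<^sub>C 'e) \<Rightarrow> 'e"
    and \<mu> \<eta> :: "real \<Rightarrow> real" and L k r \<kappa> :: real
  assumes F_convex: "\<And>t x. t \<in> {0..T} \<Longrightarrow> convex (F t x)"
    and F_selection: "\<And>x. \<exists>f. strongly_measurable (lebesgue_on {0..T}) f \<and> (\<forall>t\<in>{0..T}. f t \<in> F t x)"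
    and F_closed: "AE t in lebesgue_on {0..T}. \<forall>xs ys x y. (\<forall>n. ys n \<in> F t (xs n)) \<longrightarrow>
      xs \<longlonglongrightarrow> x \<longrightarrow> ys \<longlonglongrightarrow> y \<longrightarrow> y \<in> F t x"
    and \<mu>: "integrable (lebesgue_on {0..T}) \<mu>" "\<And>t. 0 \<le> \<mu> t"
    and F_growth: "\<And>x. AE t in lebesgue_on {0..T}. \<forall>y\<in>F t x. norm y \<le> \<mu> t * (1 + norm x)"
    and \<eta>: "integrable (lebesgue_on {0..T}) \<eta>" "\<And>t. 0 \<le> \<eta> t"
    and F_mnc: "\<And>\<Omega> \<rho>. bounded \<Omega> \<Longrightarrow> \<rho> > 0 \<Longrightarrow> ball_cover \<Omega> \<rho> \<Longrightarrow>
      AE t in lebesgue_on {0..T}. \<forall>\<delta>>0. ball_cover (\<Union>x\<in>\<Omega>. F t x) (\<eta> t * \<rho> + \<delta>)"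
    and L: "L \<ge> 0"
    and G_cong: "\<And>x y. (\<And>t. t \<in> {0..T} \<Longrightarrow> apply_bcontfun x t = apply_bcontfun y t) \<Longrightarrow> G x = G y"
    and G_Lipschitz: "\<And>x y. norm (G x - G y) \<le> L * dist x y"
    and k: "k > 0"
    and G_mnc: "\<And>\<Omega> \<rho> \<delta>. bounded \<Omega> \<Longrightarrow> \<rho> > 0 \<Longrightarrow> ball_cover \<Omega> \<rho> \<Longrightarrow> \<delta> > 0 \<Longrightarrow> ball_cover (G ` \<Omega>) (k * \<rho> + \<delta>)"
    and r: "r > 0"
    and growth: "(1 + M * (L * r + norm (G 0))) * exp (M * (LINT t|lebesgue_on {0..T}. \<mu> t)) < 1 + r"
    and \<kappa>: "\<kappa> \<ge> 1"
      "\<And>C. countable C \<Longrightarrow> \<exists>y::nat \<Rightarrow> 'e. \<forall>A \<rho> \<rho>'. A \<subseteq> closure C \<longrightarrow> ball_cover A \<rho> \<longrightarrow> \<kappa> * \<rho> < \<rho>' \<longrightarrow>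
        (\<exists>m. A \<subseteq> (\<Union>j\<le>m. ball (y j) \<rho>'))"
    and contraction: "M * (k + \<kappa> * (LINT t|lebesgue_on {0..T}. \<eta> t)) < 1"
begin

text \<open>The sequence enumerates a countable set closed under rational combinations,
  \<open>U\<close> at rational times, \<open>G\<close> at interpolants, and the countable sets that
  essentially carry the selections. Continuity of each operation extends the invariance to the
  closure; for \<open>G\<close> this is the density of the interpolants.\<close>

lemma separable_reduction:
  obtains d :: "nat \<Rightarrow> 'e" and f :: "nat \<Rightarrow> real \<Rightarrow> 'e" where
    "subspace (closure (range d))"
    "\<And>t x. 0 \<le> t \<Longrightarrow> t \<le> T \<Longrightarrow> x \<in> closure (range d) \<Longrightarrow> U t x \<in> closure (range d)"
    "\<And>x. (\<And>t. t \<in> {0..T} \<Longrightarrow> apply_bcontfun x t \<in> closure (range d)) \<Longrightarrow> G x \<in> closure (range d)"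
    "\<And>j. strongly_measurable (lebesgue_on {0..T}) (f j)"
    "\<And>j t. t \<in> {0..T} \<Longrightarrow> f j t \<in> F t (d j)"
    "\<And>j. AE t in lebesgue_on {0..T}. f j t \<in> closure (range d)"
proof -
  obtain sel where sel: "\<And>x. strongly_measurable (lebesgue_on {0..T}) (sel x)"
    "\<And>x t. t \<in> {0..T} \<Longrightarrow> sel x t \<in> F t x"
    using F_selection by metis
  have "\<exists>C. countable C \<and> (AE t in lebesgue_on {0..T}. sel x t \<in> closure C)" for x
    using lebesgue.strongly_measurable_separable[OF sel(1)[of x]] by metis
  then obtain C where C: "\<And>x. countable (C x)" "\<And>x. AE t in lebesgue_on {0..T}. sel x t \<in> closure (C x)"
    by metis
  \<comment> \<open>Entries \<open>l ! 0\<close> and \<open>l ! 1\<close> of lists that are too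
    short are unspecified, as is \<open>U\<close> at negative times; such values merely add further
    points to the countable set.\<close>
  define ops where "ops l = {0, G (extC (interpolant (2 * T) l))} \<union> range (\<lambda>q. real_of_rat q *\<^sub>R (l ! 0) + l ! 1)
      \<union> range (\<lambda>q. U (real_of_rat q) (l ! 0)) \<union> C (l ! 0)" for l
  have "countable (ops l)" for l unfolding ops_def using C(1) by auto
  then obtain D where D: "countable D" "\<And>l. set l \<subseteq> D \<Longrightarrow> ops l \<subseteq> D"
    using countable_closure_exists[of ops] by blast
  have D0: "0 \<in> D" using D(2)[of "[]"] by (auto simp: ops_def)
  define d where "d = from_nat_into D"
  have range_d: "range d = D" unfolding d_def using D0 D(1) by (intro range_from_nat_into) auto
  have D_lin: "real_of_rat q *\<^sub>R a + b \<in> D" if "a \<in> D" "b \<in> D" for q a b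
    using D(2)[of "[a, b]"] that by (auto simp: ops_def)
  have D_U: "U (real_of_rat q) a \<in> D" if "a \<in> D" for q a
    using D(2)[of "[a]"] that by (auto simp: ops_def)
  have D_C: "C a \<subseteq> D" if "a \<in> D" for a
    using D(2)[of "[a]"] that by (auto simp: ops_def)
  have D_G: "G (extC (interpolant (2 * T) l)) \<in> D" if "set l \<subseteq> D" for l
    using D(2)[OF that] by (auto simp: ops_def)
  have inv0: "(\<lambda>n. 1 / real (Suc n)) \<longlonglongrightarrow> 0"
    using LIMSEQ_inverse_real_of_nat by (simp add: inverse_eq_divide)
  have sub: "subspace (closure D)" using D0 D_lin by (rule subspace_closure_rational_combinations)
  have U_D: "U t a \<in> closure D" if "a \<in> D" "0 \<le> t" "t \<le> T" for t a
  proof (cases "t = 0")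
    case True
    then show ?thesis using that closure_subset by (auto simp: U_0)
  next
    case False
    then have "t > 0" using that by simp
    \<comment> \<open>The rational times approach t from below and stay positive, hence inside the
      interval on which orbits are known to be continuous.\<close>
    then have "\<exists>q. max 0 (t - 1 / real (Suc n)) < real_of_rat q \<and> real_of_rat q < t" for n
      by (intro of_rat_dense) simp
    then obtain q where q: "\<And>n. max 0 (t - 1 / real (Suc n)) < real_of_rat (q n)" "\<And>n. real_of_rat (q n) < t" by metis
    have lower: "(\<lambda>n. t - 1 / real (Suc n)) \<longlonglongrightarrow> t" using tendsto_diff[OF tendsto_const inv0, of t] by simp
    have "(\<lambda>n. real_of_rat (q n)) \<longlonglongrightarrow> t"
    proof (rule tendsto_sandwich[OF _ _ lower tendsto_const])
      have "t - 1 / real (Suc n) \<le> real_of_rat (q n)" for n using q(1)[of n] by simp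
      then show "\<forall>\<^sub>F n in sequentially. t - 1 / real (Suc n) \<le> real_of_rat (q n)" by simp
      show "\<forall>\<^sub>F n in sequentially. real_of_rat (q n) \<le> t" using q(2) by (intro always_eventually allI less_imp_le)
    qed
    moreover have "0 \<le> real_of_rat (q n) \<and> real_of_rat (q n) \<le> T" for n
      using q(1)[of n] q(2)[of n] that by simp
    ultimately have "(\<lambda>n. U (real_of_rat (q n)) a) \<longlonglongrightarrow> U t a"
      using that by (intro U_tendsto) auto
    then show ?thesis unfolding closure_sequential
      by (intro exI[of _ "\<lambda>n. U (real_of_rat (q n)) a"] conjI allI D_U that)
  qed
  show ?thesis
  proof (rule that[of d "\<lambda>j. sel (d j)"]; (unfold range_d)?)
    show "subspace (closure D)" by (rule sub)
    show "U t x \<in> closure D" if tx: "0 \<le> t" "t \<le> T" "x \<in> closure D" for t x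
    proof -
      obtain a where a: "\<And>n. a n \<in> D" "a \<longlonglongrightarrow> x" using tx(3) unfolding closure_sequential by blast
      have "(\<lambda>n. U t (a n)) \<longlonglongrightarrow> U t x" by (intro tendsto_intros a)
      then show ?thesis
        by (rule closed_sequentially[OF closed_closure, rotated]) (intro U_D a tx)
    qed
    show "G x \<in> closure D" if x: "\<And>t. t \<in> {0..T} \<Longrightarrow> apply_bcontfun x t \<in> closure D" for x
      unfolding closure_approachable
    proof (intro allI impI)
      fix e :: real assume "e > 0"
      define e' where "e' = e / (2 * (L + 1))"
      have e': "e' > 0" using \<open>e > 0\<close> L by (simp add: e'_def)
      have cx: "continuous_on {0..T} (apply_bcontfun x)" by simp
      obtain l where l: "set l \<subseteq> D" "continuous_on {0..T} (interpolant (2 * T) l)"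
        "\<And>t. t \<in> {0..T} \<Longrightarrow> norm (interpolant (2 * T) l t - x t) \<le> e'"
        by (rule interpolant_dense[OF T_pos cx x e']) auto
      have "G x = G (extC (apply_bcontfun x))"
        by (rule G_cong) (simp add: extC_apply[OF cx] clampT_id)
      moreover have "dist (extC (interpolant (2 * T) l)) (extC (apply_bcontfun x)) \<le> e'"
        using l by (intro dist_extC_le cx) auto
      then have "L * dist (extC (interpolant (2 * T) l)) (extC (apply_bcontfun x)) \<le> L * e'"
        using L by (rule mult_left_mono)
      then have "norm (G (extC (interpolant (2 * T) l)) - G (extC (apply_bcontfun x))) \<le> L * e'"
        using G_Lipschitz[of "extC (interpolant (2 * T) l)" "extC (apply_bcontfun x)"] by linarith
      moreover have "L * e' \<le> (L + 1) * e'" using e' by (intro mult_right_mono) auto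
      moreover have "(L + 1) * e' = e / 2" using L by (simp add: e'_def field_simps)
      ultimately have "dist (G (extC (interpolant (2 * T) l))) (G x) < e"
        using \<open>e > 0\<close> by (simp add: dist_norm)
      then show "\<exists>y\<in>D. dist y (G x) < e" using D_G[OF l(1)] by blast
    qed
    show "strongly_measurable (lebesgue_on {0..T}) (sel (d j))" for j by (rule sel)
    show "sel (d j) t \<in> F t (d j)" if "t \<in> {0..T}" for j t by (rule sel(2)[OF that])
    have "d j \<in> D" for j using range_d by blast
    then have "closure (C (d j)) \<subseteq> closure D" for j by (intro closure_mono D_C)
    then show "AE t in lebesgue_on {0..T}. sel (d j) t \<in> closure D" for j
      using C(2)[of "d j"] by (auto elim!: eventually_mono)
  qed
qed

end

section \<open>Approximate solutions\<close>

lemma convex_thickening: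
  fixes S :: "'a::real_normed_vector set"
  assumes "convex S"
  shows "convex {u. \<exists>v\<in>S. norm (u - v) \<le> e}"
proof -
  have "{u. \<exists>v\<in>S. norm (u - v) \<le> e} = (\<Union>x\<in>cball 0 e. \<Union>y\<in>S. {x + y})"
  proof (intro set_eqI iffI)
    fix u assume "u \<in> {u. \<exists>v\<in>S. norm (u - v) \<le> e}"
    then obtain v where "v \<in> S" "norm (u - v) \<le> e" by blast
    then show "u \<in> (\<Union>x\<in>cball 0 e. \<Union>y\<in>S. {x + y})"
      by (intro UN_I[of "u - v"] UN_I[of v]) auto
  next
    fix u assume "u \<in> (\<Union>x\<in>cball 0 e. \<Union>y\<in>S. {x + y})"
    then obtain x y where "norm x \<le> e" "y \<in> S" "u = x + y" by auto
    then show "u \<in> {u. \<exists>v\<in>S. norm (u - v) \<le> e}" by (intro CollectI bexI[of _ y]) auto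
  qed
  then show ?thesis using assms by (simp add: convex_sums)
qed

text \<open>The members of \<open>y\<close> are the fixed centers for subsets of \<open>X\<close>,
  at the cost of the factor \<open>\<kappa>\<close>. The number \<open>\<epsilon>\<^sub>0\<close>
  uses up part of the strict growth inequality: values attached to \<open>x s\<close> come from
  points \<open>d j\<close> at distance less than \<epsilon>, so the growth bound turns into
  \<open>\<mu> s\<close> times 1 + \<epsilon> + |x s|.\<close>

locale reduced_inclusion = nonlocal_inclusion U T M F G \<mu> \<eta> L k r \<kappa>
  for U :: "real \<Rightarrow> 'e::banach \<Rightarrow>\<^sub>L 'e" and T M F G \<mu> \<eta> L k r \<kappa> +
  fixes d :: "nat \<Rightarrow> 'e" and f :: "nat \<Rightarrow> real \<Rightarrow> 'e" and X :: "'e set" and y :: "nat \<Rightarrow> 'e" and \<epsilon>\<^sub>0 :: real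
  assumes X_def: "X = closure (range d)"
    and X_subspace: "subspace X"
    and U_X: "\<And>t x. 0 \<le> t \<Longrightarrow> t \<le> T \<Longrightarrow> x \<in> X \<Longrightarrow> U t x \<in> X"
    and G_X: "\<And>x. (\<And>t. t \<in> {0..T} \<Longrightarrow> apply_bcontfun x t \<in> X) \<Longrightarrow> G x \<in> X"
    and f_measurable: "\<And>j. strongly_measurable (lebesgue_on {0..T}) (f j)"
    and f_F: "\<And>j t. t \<in> {0..T} \<Longrightarrow> f j t \<in> F t (d j)"
    and f_X: "\<And>j. AE t in lebesgue_on {0..T}. f j t \<in> X"
    and y: "\<And>A \<rho> \<rho>'. A \<subseteq> X \<Longrightarrow> ball_cover A \<rho> \<Longrightarrow> \<kappa> * \<rho> < \<rho>' \<Longrightarrow> \<exists>m. A \<subseteq> (\<Union>j\<le>m. ball (y j) \<rho>')"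
    and \<epsilon>\<^sub>0: "\<epsilon>\<^sub>0 > 0"
      "(1 + \<epsilon>\<^sub>0 + M * (L * r + norm (G 0))) * exp (M * (LINT t|lebesgue_on {0..T}. \<mu> t)) \<le> 1 + \<epsilon>\<^sub>0 + r"
begin

abbreviation "\<L> \<equiv> lebesgue_on {0..T}"

lemma X_closed: "closed X" by (simp add: X_def)

lemma f_bound: "AE t in \<L>. \<forall>j. norm (f j t) \<le> \<mu> t * (1 + norm (d j))"
  unfolding AE_all_countable
proof
  fix j
  show "AE t in \<L>. norm (f j t) \<le> \<mu> t * (1 + norm (d j))"
    using F_growth[of "d j"] AE_space
  proof eventually_elim
    case (elim t)
    then show ?case using f_F[of t j] by auto
  qed
qed

lemma f_in_X: "AE t in \<L>. \<forall>j. f j t \<in> X"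
  unfolding AE_all_countable using f_X by blast

lemma f_L1: "L1_function \<L> (f j)"
proof (rule lebesgue.L1_function_bound[OF f_measurable])
  show "integrable \<L> (\<lambda>t. \<mu> t * (1 + norm (d j)))" using \<mu> by simp
  show "AE t in \<L>. norm (f j t) \<le> \<mu> t * (1 + norm (d j))" using f_bound by eventually_elim simp
qed

text \<open>Instead of arbitrary selections of \<open>F\<close> only convex combinations of the countably many
  \<open>f j s \<in> F s (d j)\<close> with \<open>d j\<close> close to \<open>x s\<close> are admitted.\<close>

definition near_values :: "real \<Rightarrow> 'e \<Rightarrow> real \<Rightarrow> 'e set" where
  "near_values \<epsilon> v s = {f j s |j. norm (v - d j) < \<epsilon>}"

text \<open>Measurability in s is built in through the weights, so that no measurable selection has
  to be made. One n must serve all s; \<open>continuous_selection\<close> finds it by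
  compactness.\<close>

definition sels :: "real \<Rightarrow> (real \<Rightarrow>\<^sub>C 'e) \<Rightarrow> (real \<Rightarrow> 'e) set" where
  "sels \<epsilon> x = {(\<lambda>s. \<Sum>j<n. w j s *\<^sub>R f j s) |n w. (\<forall>j<n. w j \<in> unit_weights) \<and>
     (\<forall>s\<in>{0..T}. (\<Sum>j<n. w j s) = 1 \<and> (\<forall>j<n. w j s \<noteq> 0 \<longrightarrow> norm (x s - d j) < \<epsilon>))}"

lemma sels_mono: "\<epsilon> \<le> \<epsilon>' \<Longrightarrow> sels \<epsilon> x \<subseteq> sels \<epsilon>' x"
proof
  fix h assume "\<epsilon> \<le> \<epsilon>'" "h \<in> sels \<epsilon> x"
  then obtain n w where h: "h = (\<lambda>s. \<Sum>j<n. w j s *\<^sub>R f j s)" and w: "\<forall>j<n. w j \<in> unit_weights"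
    and s: "\<forall>s\<in>{0..T}. (\<Sum>j<n. w j s) = 1 \<and> (\<forall>j<n. w j s \<noteq> 0 \<longrightarrow> norm (x s - d j) < \<epsilon>)"
    unfolding sels_def by blast
  have "\<forall>s\<in>{0..T}. (\<Sum>j<n. w j s) = 1 \<and> (\<forall>j<n. w j s \<noteq> 0 \<longrightarrow> norm (x s - d j) < \<epsilon>')"
    using s \<open>\<epsilon> \<le> \<epsilon>'\<close> by (meson less_le_trans)
  then show "h \<in> sels \<epsilon>' x" unfolding sels_def using h w by blast
qed

lemma sels_hull:
  assumes "h \<in> sels \<epsilon> x" "s \<in> {0..T}"
  shows "h s \<in> convex hull (near_values \<epsilon> (x s) s)"
proof -
  obtain n w where h: "h = (\<lambda>s. \<Sum>j<n. w j s *\<^sub>R f j s)" and w: "\<forall>j<n. w j \<in> unit_weights"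
    and s: "(\<Sum>j<n. w j s) = 1" "\<forall>j<n. w j s \<noteq> 0 \<longrightarrow> norm (x s - d j) < \<epsilon>"
    using assms unfolding sels_def by blast
  define J where "J = {j. j < n \<and> w j s \<noteq> 0}"
  have "h s = (\<Sum>j\<in>J. w j s *\<^sub>R f j s)"
    unfolding h J_def by (intro sum.mono_neutral_right) auto
  also have "\<dots> \<in> convex hull (near_values \<epsilon> (x s) s)"
  proof (rule convex_sum)
    have "(\<Sum>j\<in>J. w j s) = (\<Sum>j<n. w j s)" unfolding J_def by (intro sum.mono_neutral_left) auto
    then show "(\<Sum>j\<in>J. w j s) = 1" using s by simp
    show "0 \<le> w j s" if "j \<in> J" for j using that w by (auto simp: J_def unit_weights_def)
    show "f j s \<in> convex hull (near_values \<epsilon> (x s) s)" if "j \<in> J" for j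
      using that s(2) by (intro hull_inc) (auto simp: J_def near_values_def)
  qed (auto simp: J_def)
  finally show ?thesis .
qed

lemma near_values_bound:
  assumes "\<forall>j. norm (f j s) \<le> \<mu> s * (1 + norm (d j))" "h \<in> convex hull (near_values \<epsilon> v s)"
  shows "norm h \<le> \<mu> s * (1 + \<epsilon> + norm v)"
proof -
  have "near_values \<epsilon> v s \<subseteq> cball 0 (\<mu> s * (1 + \<epsilon> + norm v))"
  proof
    fix u assume "u \<in> near_values \<epsilon> v s"
    then obtain j where j: "u = f j s" "norm (v - d j) < \<epsilon>" by (auto simp: near_values_def)
    have "norm (d j) \<le> norm v + \<epsilon>" using norm_triangle_ineq4[of v "v - d j"] j by simp
    then have "\<mu> s * (1 + norm (d j)) \<le> \<mu> s * (1 + \<epsilon> + norm v)" using \<mu>(2) by (intro mult_left_mono) auto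
    then have "norm u \<le> \<mu> s * (1 + \<epsilon> + norm v)" using assms(1) j(1) by (blast intro: order_trans)
    then show "u \<in> cball 0 (\<mu> s * (1 + \<epsilon> + norm v))" by simp
  qed
  then have "convex hull (near_values \<epsilon> v s) \<subseteq> cball 0 (\<mu> s * (1 + \<epsilon> + norm v))"
    by (intro hull_minimal) auto
  then show ?thesis using assms(2) by auto
qed

lemma sels_bound:
  assumes "h \<in> sels \<epsilon> x"
  shows "AE s in \<L>. norm (h s) \<le> \<mu> s * (1 + \<epsilon> + norm (x s))"
  using f_bound AE_space
proof eventually_elim
  case (elim s)
  then show ?case using near_values_bound sels_hull[OF assms, of s] by auto
qed

lemma sels_X:
  assumes "h \<in> sels \<epsilon> x"
  shows "AE s in \<L>. h s \<in> X"
  using f_in_X AE_space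
proof eventually_elim
  case (elim s)
  have "near_values \<epsilon> (x s) s \<subseteq> X" using elim(1) by (auto simp: near_values_def)
  then have "convex hull (near_values \<epsilon> (x s) s) \<subseteq> X"
    by (intro hull_minimal subspace_imp_convex X_subspace)
  then show ?case using sels_hull[OF assms, of s] elim(2) by auto
qed

lemma sels_L1:
  assumes "h \<in> sels \<epsilon> x"
  shows "L1_function \<L> h"
proof -
  obtain n w where h: "h = (\<lambda>s. \<Sum>j<n. w j s *\<^sub>R f j s)" and w: "\<forall>j<n. w j \<in> unit_weights"
    using assms unfolding sels_def by blast
  have "L1_function \<L> (\<lambda>s. w j s *\<^sub>R f j s)" if "j < n" for j
  proof (rule lebesgue.L1_function_bound)
    show "strongly_measurable \<L> (\<lambda>s. w j s *\<^sub>R f j s)"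
      using w that by (intro lebesgue.strongly_measurable_scaleR f_measurable) (auto simp: unit_weights_def)
    show "integrable \<L> (\<lambda>s. norm (f j s))" using f_L1 by (simp add: lebesgue.L1_function_iff)
    show "AE s in \<L>. norm (w j s *\<^sub>R f j s) \<le> norm (f j s)"
      using w that by (intro AE_I2) (auto simp: unit_weights_def mult_left_le_one_le)
  qed
  then show ?thesis
    unfolding h using lebesgue.bochner_integral_sum[of "{..<n}" "\<lambda>j s. w j s *\<^sub>R f j s"] by blast
qed

section \<open>The invariant set and the solution maps\<close>

definition m :: "real \<Rightarrow> real" where "m t = integral {0..t} \<mu>"
definition a :: real where "a = 1 + \<epsilon>\<^sub>0 + M * (L * r + norm (G 0))"
text \<open>The envelope a exp (M m(t)) solves the Gronwall equation \<phi>(t) = a + M times the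
  integral of \<mu> \<phi> over [0, t], and therefore reproduces itself under the integral term. A
  ball of radius r would require a stronger smallness of \<mu>.\<close>

definition K :: "(real \<Rightarrow>\<^sub>C 'e) set" where
  "K = {x. \<forall>t. apply_bcontfun x t \<in> X \<and> 1 + \<epsilon>\<^sub>0 + norm (x t) \<le> a * exp (M * m (clampT t))}"

lemma a_ge: "a \<ge> 1 + \<epsilon>\<^sub>0"
  using M_pos L r by (simp add: a_def)

lemma \<mu>_abs: "\<mu> absolutely_integrable_on {0..T}"
  using \<mu>(1) by (simp add: set_integrable_def integrable_restrict_space)

lemma LINT_eq_integral:
  fixes h :: "real \<Rightarrow> real"
  assumes "h absolutely_integrable_on {0..T}" "0 \<le> t" "t \<le> T"
  shows "integrable \<L> h" "(LINT s|\<L>. indicator {0..t} s * h s) = integral {0..t} h"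
proof -
  show int: "integrable \<L> h"
    using assms(1) by (simp add: set_integrable_def integrable_restrict_space)
  have eq: "(\<lambda>s. indicator {0..t} s * h s) = (\<lambda>s. if s \<in> {0..t} then h s else 0)"
    by (auto simp: indicator_def)
  have "{0..t} \<in> sets \<L>" using assms by (subst sets_restrict_space_iff) auto
  then have "integrable \<L> (\<lambda>s. indicator {0..t} s * h s)"
    using integrable_mult_indicator[of "{0..t}" \<L> h] int by simp
  then have "(LINT s|\<L>. indicator {0..t} s * h s) = integral {0..T} (\<lambda>s. indicator {0..t} s * h s)"
    by (intro lebesgue_integral_eq_integral) auto
  also have "\<dots> = integral ({0..t} \<inter> {0..T}) h"
    unfolding eq using integral_restrict_Int[of "{0..T}" "{0..t}" h] by (simp add: Int_commute)
  also have "{0..t} \<inter> {0..T} = {0..t}" using assms by auto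
  finally show "(LINT s|\<L>. indicator {0..t} s * h s) = integral {0..t} h" .
qed

lemma m_T: "m T = (LINT t|\<L>. \<mu> t)"
proof -
  have "(LINT t|\<L>. \<mu> t) = integral {0..T} \<mu>"
    using \<mu>(1) by (intro lebesgue_integral_eq_integral) auto
  then show ?thesis by (simp add: m_def)
qed

lemma m_le: "0 \<le> t \<Longrightarrow> t \<le> T \<Longrightarrow> 0 \<le> m t \<and> m t \<le> m T"
proof -
  assume t: "0 \<le> t" "t \<le> T"
  have int: "\<mu> integrable_on {0..b}" if "b \<le> T" for b
    by (rule integrable_on_subinterval[of _ "{0..T}"])
      (use \<mu>_abs that in \<open>auto intro: set_lebesgue_integral_eq_integral(1)\<close>)
  show ?thesis
    unfolding m_def using t int \<mu>(2) by (auto intro!: integral_nonneg integral_subset_le)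
qed

lemma K_norm: "x \<in> K \<Longrightarrow> norm (apply_bcontfun x t) \<le> r"
proof -
  assume "x \<in> K"
  then have "1 + \<epsilon>\<^sub>0 + norm (x t) \<le> a * exp (M * m (clampT t))" by (auto simp: K_def)
  also have "\<dots> \<le> a * exp (M * m T)"
    using m_le[OF clampT] a_ge \<epsilon>\<^sub>0(1) M_pos by (intro mult_left_mono) auto
  also have "\<dots> \<le> 1 + \<epsilon>\<^sub>0 + r" using \<epsilon>\<^sub>0(2) by (simp add: m_T a_def)
  finally show ?thesis by simp
qed

lemma K_dist: "x \<in> K \<Longrightarrow> dist x 0 \<le> r"
  by (rule dist_bound) (simp add: K_norm)

lemma K_bounded: "bounded K"
  by (rule boundedI[of _ r]) (metis K_dist dist_0_norm dist_commute)

lemma K_zero: "0 \<in> K"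
proof -
  have "1 + \<epsilon>\<^sub>0 \<le> a * exp (M * m (clampT t))" for t
  proof -
    have "1 \<le> exp (M * m (clampT t))" using m_le[OF clampT] M_pos by simp
    then have "a * 1 \<le> a * exp (M * m (clampT t))" using a_ge \<epsilon>\<^sub>0(1) by (intro mult_left_mono) auto
    then show ?thesis using a_ge by linarith
  qed
  then show ?thesis using X_subspace by (simp add: K_def subspace_0)
qed

lemma K_convex: "convex K"
proof (rule convexI)
  fix x z and u v :: real assume x: "x \<in> K" and z: "z \<in> K" and uv: "0 \<le> u" "0 \<le> v" "u + v = 1"
  have "apply_bcontfun (u *\<^sub>R x + v *\<^sub>R z) t \<in> X" for t
    using x z X_subspace by (auto simp: K_def intro!: subspace_add subspace_scale)
  moreover have "1 + \<epsilon>\<^sub>0 + norm (apply_bcontfun (u *\<^sub>R x + v *\<^sub>R z) t) \<le> a * exp (M * m (clampT t))" for t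
  proof -
    define B where "B = a * exp (M * m (clampT t)) - (1 + \<epsilon>\<^sub>0)"
    have "norm (x t) \<le> B" "norm (z t) \<le> B" using x z by (auto simp: K_def B_def algebra_simps)
    then have "u * norm (x t) + v * norm (z t) \<le> B" using uv by (intro convex_bound_le) auto
    moreover have "norm (u *\<^sub>R x t + v *\<^sub>R z t) \<le> u * norm (x t) + v * norm (z t)"
      using norm_triangle_ineq[of "u *\<^sub>R x t" "v *\<^sub>R z t"] uv by simp
    ultimately show ?thesis by (simp add: B_def)
  qed
  ultimately show "u *\<^sub>R x + v *\<^sub>R z \<in> K" by (simp add: K_def)
qed

definition sol :: "(real \<Rightarrow>\<^sub>C 'e) \<Rightarrow> (real \<Rightarrow> 'e) \<Rightarrow> real \<Rightarrow>\<^sub>C 'e" where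
  "sol x h = extC (\<lambda>t. U t (G x)) + extC (mild h)"

definition H :: "real \<Rightarrow> (real \<Rightarrow>\<^sub>C 'e) \<Rightarrow> (real \<Rightarrow>\<^sub>C 'e) set" where
  "H \<epsilon> x = sol x ` sels \<epsilon> x"

lemma sol_apply:
  assumes "L1_function \<L> h"
  shows "apply_bcontfun (sol x h) t = U (clampT t) (G x) + mild h (clampT t)"
  by (simp add: sol_def extC_apply orbit_continuous mild_continuous[OF assms])

text \<open>The orbit of \<open>G x\<close> contributes at most M (L r + |G 0|), because |x| \<le> r
  on \<open>K\<close>, and by \<open>integral_exp_le\<close> with c = M the integral contributes at
  most a (exp (M m(t)) - 1). With the summand \<open>1 + \<epsilon>\<^sub>0\<close> these add up to
  the envelope.\<close>

lemma H_subset_K: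
  assumes "x \<in> K" "0 < \<epsilon>" "\<epsilon> \<le> \<epsilon>\<^sub>0"
  shows "H \<epsilon> x \<subseteq> K"
proof
  fix z assume "z \<in> H \<epsilon> x"
  then obtain h where h: "h \<in> sels \<epsilon> x" "z = sol x h" by (auto simp: H_def)
  have L1: "L1_function \<L> h" by (rule sels_L1[OF h(1)])
  have "apply_bcontfun z t \<in> X" for t
  proof -
    have "mild h (clampT t) \<in> X"
      unfolding mild_def
    proof (rule lebesgue.bochner_integral_in_closed_subspace[OF kernel_L1[OF L1 clampT] X_closed X_subspace])
      show "AE s in \<L>. kernel h (clampT t) s \<in> X"
        using sels_X[OF h(1)] AE_space
      proof eventually_elim
        case (elim s)
        then show ?case using U_X[of "clampT t - s" "h s"] clampT[of t] X_subspace
          by (auto simp: kernel_def subspace_0)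
      qed
    qed
    moreover have "U (clampT t) (G x) \<in> X"
      using assms(1) by (intro U_X clampT G_X) (auto simp: K_def)
    ultimately show ?thesis
      unfolding h(2) sol_apply[OF L1] using X_subspace by (intro subspace_add)
  qed
  moreover have "1 + \<epsilon>\<^sub>0 + norm (apply_bcontfun z t) \<le> a * exp (M * m (clampT t))" for t
  proof -
    let ?t = "clampT t"
    have abs: "(\<lambda>s. \<mu> s * exp (M * m s)) absolutely_integrable_on {0..T}"
      and le: "M * integral {0..?t} (\<lambda>s. \<mu> s * exp (M * m s)) \<le> exp (M * m ?t) - 1"
      using integral_exp_le[OF \<mu>_abs \<mu>(2) less_imp_le[OF M_pos] clampT] unfolding m_def by blast+
    have abs': "(\<lambda>s. a * (\<mu> s * exp (M * m s))) absolutely_integrable_on {0..T}"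
      using abs by (rule set_integrable_mult_right)
    have "norm (mild h ?t) \<le> M * (LINT s|\<L>. indicator {0..?t} s * (a * (\<mu> s * exp (M * m s))))"
    proof (rule norm_mild_le[OF L1 clampT LINT_eq_integral(1)[OF abs' clampT]])
      show "AE s in \<L>. s \<le> ?t \<longrightarrow> norm (h s) \<le> a * (\<mu> s * exp (M * m s))"
        using sels_bound[OF h(1)] AE_space
      proof eventually_elim
        case (elim s)
        have "norm (h s) \<le> \<mu> s * (1 + \<epsilon> + norm (x s))" by (rule elim(1))
        also have "\<dots> \<le> \<mu> s * (a * exp (M * m s))"
        proof (rule mult_left_mono[OF _ \<mu>(2)])
          have "1 + \<epsilon>\<^sub>0 + norm (x s) \<le> a * exp (M * m (clampT s))" using assms(1) by (auto simp: K_def)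
          moreover have "clampT s = s" using elim(2) by (intro clampT_id) auto
          ultimately show "1 + \<epsilon> + norm (x s) \<le> a * exp (M * m s)" using assms(3) by simp
        qed
        finally show ?case by (simp add: algebra_simps)
      qed
      show "AE s in \<L>. 0 \<le> a * (\<mu> s * exp (M * m s))"
        using \<mu>(2) a_ge \<epsilon>\<^sub>0(1) by (intro AE_I2 mult_nonneg_nonneg) auto
    qed
    also have "\<dots> = M * integral {0..?t} (\<lambda>s. a * (\<mu> s * exp (M * m s)))"
      by (subst LINT_eq_integral(2)[OF abs' clampT]) simp
    also have "\<dots> = a * (M * integral {0..?t} (\<lambda>s. \<mu> s * exp (M * m s)))"
      by simp
    also have "\<dots> \<le> a * (exp (M * m ?t) - 1)"
      using le a_ge \<epsilon>\<^sub>0(1) by (intro mult_left_mono) auto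
    finally have 1: "norm (mild h ?t) \<le> a * (exp (M * m ?t) - 1)" .
    have "norm (G x) \<le> norm (G 0) + norm (G x - G 0)" by (metis norm_triangle_sub)
    also have "norm (G x - G 0) \<le> L * r"
      using G_Lipschitz[of x 0] K_dist[OF assms(1)] L by (meson mult_left_mono order_trans)
    finally have "M * norm (G x) \<le> M * (L * r + norm (G 0))" using M_pos by (intro mult_left_mono) auto
    then have 2: "norm (U ?t (G x)) \<le> M * (L * r + norm (G 0))"
      using norm_U_apply[OF clampT, of t "G x"] by linarith
    have "norm (apply_bcontfun z t) \<le> norm (U ?t (G x)) + norm (mild h ?t)"
      unfolding h(2) sol_apply[OF L1] by (rule norm_triangle_ineq)
    with 1 2 show ?thesis by (simp add: a_def algebra_simps)
  qed
  ultimately show "z \<in> K" by (simp add: K_def)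
qed

text \<open>The weights form a partition of unity in the values \<open>x s\<close>, with
  \<open>\<omega> j\<close> positive exactly where \<open>d j\<close> is closer than \<epsilon>.
  They depend continuously on x, and dominated convergence turns their pointwise convergence into
  convergence of the integral term, uniformly in t.\<close>

lemma continuous_selection:
  assumes Z: "compact Z" "Z \<subseteq> K" and \<epsilon>: "0 < \<epsilon>"
  shows "\<exists>S. continuous_on Z S \<and> (\<forall>x\<in>Z. S x \<in> H \<epsilon> x)"
proof -
  \<comment> \<open>The functions in \<open>C\<close> come within \<epsilon> / 4 of every x in
    \<open>Z\<close>, and their values are within \<epsilon> / 2 of finitely many
    \<open>d j\<close>; hence these \<open>d j\<close> come within \<epsilon> of every value
    \<open>x t\<close>.\<close>
  obtain C where C: "finite C" "C \<subseteq> Z" "Z \<subseteq> (\<Union>c\<in>C. ball c (2 * (\<epsilon> / 8)))"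
    using ball_cover_centers_in[OF compact_imp_ball_cover[OF Z(1), of "\<epsilon> / 8"]] \<epsilon> by auto
  have "\<exists>n. \<forall>t\<in>{0..T}. \<exists>j<n. norm (apply_bcontfun c t - d j) < \<epsilon> / 2" if "c \<in> C" for c
  proof -
    have "compact (apply_bcontfun c ` {0..T})" by (intro compact_continuous_image) auto
    moreover have "apply_bcontfun c ` {0..T} \<subseteq> (\<Union>j\<in>UNIV. ball (d j) (\<epsilon> / 2))"
    proof
      fix v assume "v \<in> apply_bcontfun c ` {0..T}"
      moreover have "apply_bcontfun c t \<in> X" for t using that C(2) Z(2) unfolding K_def by blast
      ultimately have "v \<in> closure (range d)" unfolding X_def by blast
      then obtain j where "dist (d j) v < \<epsilon> / 2" using \<epsilon> unfolding closure_approachable by (metis half_gt_zero rangeE)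
      then show "v \<in> (\<Union>j\<in>UNIV. ball (d j) (\<epsilon> / 2))" by auto
    qed
    ultimately obtain J where J: "finite J" "apply_bcontfun c ` {0..T} \<subseteq> (\<Union>j\<in>J. ball (d j) (\<epsilon> / 2))"
      using compactE_image[of "apply_bcontfun c ` {0..T}" UNIV "\<lambda>j. ball (d j) (\<epsilon> / 2)"] by auto
    obtain n where n: "\<And>j. j \<in> J \<Longrightarrow> j < n" using J(1) by (meson finite_nat_set_iff_bounded)
    have "\<exists>j<n. norm (apply_bcontfun c t - d j) < \<epsilon> / 2" if "t \<in> {0..T}" for t
    proof -
      have "apply_bcontfun c t \<in> (\<Union>j\<in>J. ball (d j) (\<epsilon> / 2))" using J(2) that by blast
      then obtain j where "j \<in> J" "dist (d j) (apply_bcontfun c t) < \<epsilon> / 2" by auto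
      then show ?thesis using n by (intro exI[of _ j]) (auto simp: dist_norm norm_minus_commute)
    qed
    then show ?thesis by blast
  qed
  then obtain N where N: "\<And>c t. c \<in> C \<Longrightarrow> t \<in> {0..T} \<Longrightarrow> \<exists>j<N c. norm (apply_bcontfun c t - d j) < \<epsilon> / 2" by metis
  define n where "n = (\<Sum>c\<in>C. N c)"
  have N_le: "N c \<le> n" if "c \<in> C" for c unfolding n_def using that C(1) by (intro member_le_sum) auto
  have near: "\<exists>j<n. norm (apply_bcontfun x t - d j) < \<epsilon>" if "x \<in> Z" "t \<in> {0..T}" for x t
  proof -
    obtain c where c: "c \<in> C" "dist c x < 2 * (\<epsilon> / 8)" using C(3) \<open>x \<in> Z\<close> by auto
    obtain j where j: "j < N c" "norm (apply_bcontfun c t - d j) < \<epsilon> / 2" using N[OF c(1) \<open>t \<in> {0..T}\<close>] by blast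
    have "dist (apply_bcontfun c t) (apply_bcontfun x t) < \<epsilon> / 4" using dist_fun_lt_imp_dist_val_lt[OF c(2)] by simp
    then have "norm (apply_bcontfun x t - d j) < \<epsilon>"
      using j(2) norm_triangle_ineq[of "apply_bcontfun x t - apply_bcontfun c t" "apply_bcontfun c t - d j"] \<epsilon>
      by (simp add: dist_norm norm_minus_commute)
    then show ?thesis using j(1) N_le[OF c(1)] by (meson less_le_trans)
  qed
  define \<omega> where "\<omega> j v = max 0 (\<epsilon> - norm (v - d j))" for j v
  define W where "W v = (\<Sum>j<n. \<omega> j v)" for v
  define p where "p x j s = \<omega> j (apply_bcontfun x (clampT s)) / W (apply_bcontfun x (clampT s))" for x j s
  have W_pos: "W (apply_bcontfun x (clampT s)) > 0" if x: "x \<in> Z" for x s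
  proof -
    obtain j where "j < n" "norm (apply_bcontfun x (clampT s) - d j) < \<epsilon>"
      using near[OF x, of "clampT s"] clampT[of s] by auto
    then show ?thesis unfolding W_def by (intro sum_pos2[of _ j]) (auto simp: \<omega>_def)
  qed
  have \<omega>_le: "\<omega> j v \<le> W v" if "j < n" for j v
    unfolding W_def using that by (intro member_le_sum) (auto simp: \<omega>_def)
  have p_unit: "p x j \<in> unit_weights" if x: "x \<in> Z" and j: "j < n" for x j
  proof -
    have "continuous_on UNIV (\<lambda>s. apply_bcontfun x (clampT s))"
      by (rule continuous_on_compose2[of UNIV "apply_bcontfun x"]) (auto simp: clampT_def[abs_def] intro!: continuous_intros)
    then have "continuous_on UNIV (p x j)"
      unfolding p_def W_def \<omega>_def using W_pos[OF x]
      by (intro continuous_intros) (auto simp: W_def \<omega>_def less_imp_neq[THEN not_sym])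
    then have "p x j \<in> borel_measurable lborel" by (simp add: borel_measurable_continuous_onI)
    then have "p x j \<in> borel_measurable \<L>" by (intro measurable_restrict_space1 measurable_completion)
    moreover have "0 \<le> p x j s \<and> p x j s \<le> 1" for s
      using W_pos[OF x, of s] \<omega>_le[OF j] by (simp add: p_def \<omega>_def)
    ultimately show ?thesis by (simp add: unit_weights_def)
  qed
  define h where "h x = (\<lambda>s. \<Sum>j<n. p x j s *\<^sub>R f j s)" for x
  have h_sels: "h x \<in> sels \<epsilon> x" if x: "x \<in> Z" for x
  proof -
    have "(\<Sum>j<n. p x j s) = 1 \<and> (\<forall>j<n. p x j s \<noteq> 0 \<longrightarrow> norm (x s - d j) < \<epsilon>)" if s: "s \<in> {0..T}" for s
    proof -
      have "clampT s = s" using s by (intro clampT_id) auto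
      then show ?thesis
        using W_pos[OF x, of s] unfolding p_def
        by (auto simp: W_def \<omega>_def simp flip: sum_divide_distrib split: if_splits)
    qed
    then show ?thesis unfolding sels_def h_def using p_unit[OF x] by blast
  qed
  have "continuous_on Z (\<lambda>x. sol x (h x))"
    unfolding continuous_on_sequentially comp_def
  proof (intro allI ballI impI)
    fix xs x assume x: "x \<in> Z" and xs: "(\<forall>i. xs i \<in> Z) \<and> xs \<longlonglongrightarrow> x"
    have dist0: "(\<lambda>i. dist (xs i) x) \<longlonglongrightarrow> 0" using xs by (simp add: tendsto_dist_iff[symmetric])
    have pt: "(\<lambda>i. apply_bcontfun (xs i) t) \<longlonglongrightarrow> apply_bcontfun x t" for t
      unfolding tendsto_dist_iff[of _ "apply_bcontfun x t"]
      by (rule Lim_null_comparison[OF _ dist0]) (simp add: dist_bounded)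
    have L1h: "L1_function \<L> (h (xs i))" "L1_function \<L> (h x)" for i
      using h_sels xs x sels_L1 by blast+
    have intf: "integrable \<L> (\<lambda>s. \<Sum>j<n. 2 * norm (f j s))"
      using f_L1 by (auto simp: lebesgue.L1_function_iff)
    have "(\<lambda>i. LINT s|\<L>. norm (h (xs i) s - h x s)) \<longlonglongrightarrow> (LINT s|\<L>. 0)"
    proof (rule integral_dominated_convergence[OF _ _ intf])
      show "(\<lambda>s. norm (h (xs i) s - h x s)) \<in> borel_measurable \<L>" for i
        using L1h by (intro lebesgue.norm_borel_measurable lebesgue.strongly_measurable_diff) (auto simp: L1_function_def)
      show "AE s in \<L>. norm (norm (h (xs i) s - h x s)) \<le> (\<Sum>j<n. 2 * norm (f j s))" for i
      proof (rule AE_I2)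
        fix s
        have "norm (h (xs i) s - h x s) \<le> (\<Sum>j<n. norm (p (xs i) j s *\<^sub>R f j s - p x j s *\<^sub>R f j s))"
          unfolding h_def sum_subtractf[symmetric] by (rule norm_sum)
        also have "\<dots> \<le> (\<Sum>j<n. 2 * norm (f j s))"
        proof (rule sum_mono)
          fix j assume "j \<in> {..<n}"
          then have j: "j < n" by simp
          have "xs i \<in> Z" using xs by blast
          then have "\<bar>p (xs i) j s - p x j s\<bar> \<le> 2"
            using p_unit[OF _ j, of "xs i"] p_unit[OF x j] by (auto simp: unit_weights_def abs_le_iff) (smt (verit))+
          then show "norm (p (xs i) j s *\<^sub>R f j s - p x j s *\<^sub>R f j s) \<le> 2 * norm (f j s)"
            by (simp add: mult_right_mono flip: scaleR_diff_left)
        qed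
        finally show "norm (norm (h (xs i) s - h x s)) \<le> (\<Sum>j<n. 2 * norm (f j s))" by simp
      qed
      show "AE s in \<L>. (\<lambda>i. norm (h (xs i) s - h x s)) \<longlonglongrightarrow> 0"
      proof (rule AE_I2)
        fix s
        have "(\<lambda>i. p (xs i) j s) \<longlonglongrightarrow> p x j s" if "j < n" for j
          unfolding p_def W_def \<omega>_def using W_pos[OF x, of s]
          by (intro tendsto_intros pt) (simp add: W_def \<omega>_def)
        then have "(\<lambda>i. h (xs i) s) \<longlonglongrightarrow> h x s"
          unfolding h_def by (intro tendsto_sum tendsto_scaleR tendsto_const) auto
        then have "(\<lambda>i. norm (h (xs i) s - h x s)) \<longlonglongrightarrow> norm (h x s - h x s)" by (intro tendsto_intros)
        then show "(\<lambda>i. norm (h (xs i) s - h x s)) \<longlonglongrightarrow> 0" by simp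
      qed
    qed simp
    then have "(\<lambda>i. M * (L * dist (xs i) x) + M * (LINT s|\<L>. norm (h (xs i) s - h x s))) \<longlonglongrightarrow> M * (L * 0) + M * 0"
      by (intro tendsto_intros dist0) simp
    then have lim0: "(\<lambda>i. M * (L * dist (xs i) x) + M * (LINT s|\<L>. norm (h (xs i) s - h x s))) \<longlonglongrightarrow> 0" by simp
    have "dist (sol (xs i) (h (xs i))) (sol x (h x))
        \<le> M * (L * dist (xs i) x) + M * (LINT s|\<L>. norm (h (xs i) s - h x s))" for i
    proof -
      have "dist (extC (\<lambda>t. U t (G (xs i)))) (extC (\<lambda>t. U t (G x))) \<le> M * (L * dist (xs i) x)"
      proof (rule dist_extC_le[OF orbit_continuous orbit_continuous])
        fix t assume t: "0 \<le> t" "t \<le> T"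
        have "norm (U t (G (xs i)) - U t (G x)) \<le> M * norm (G (xs i) - G x)"
          using norm_U_apply[OF t, of "G (xs i) - G x"] by (simp add: blinfun.diff_right)
        also have "\<dots> \<le> M * (L * dist (xs i) x)" using M_pos G_Lipschitz by (intro mult_left_mono) auto
        finally show "norm (U t (G (xs i)) - U t (G x)) \<le> M * (L * dist (xs i) x)" .
      qed
      moreover have "dist (extC (mild (h (xs i)))) (extC (mild (h x))) \<le> M * (LINT s|\<L>. norm (h (xs i) s - h x s))"
      proof (rule dist_extC_le)
        fix t assume t: "0 \<le> t" "t \<le> T"
        show "norm (mild (h (xs i)) t - mild (h x) t) \<le> M * (LINT s|\<L>. norm (h (xs i) s - h x s))"
          using lebesgue.L1_function_diff[OF L1h(1)[of i] L1h(2)]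
          by (intro norm_mild_diff_le L1h t) (auto simp: lebesgue.L1_function_iff)
      qed (intro mild_continuous L1h)+
      ultimately show ?thesis unfolding sol_def by (intro order_trans[OF dist_triangle_add]) linarith
    qed
    then have "(\<lambda>i. dist (sol (xs i) (h (xs i))) (sol x (h x))) \<longlonglongrightarrow> 0"
      by (intro Lim_null_comparison[OF _ lim0]) auto
    then show "(\<lambda>i. sol (xs i) (h (xs i))) \<longlonglongrightarrow> sol x (h x)" by (simp add: tendsto_dist_iff[symmetric])
  qed
  moreover have "\<forall>x\<in>Z. sol x (h x) \<in> H \<epsilon> x" using h_sels by (auto simp: H_def)
  ultimately show ?thesis by blast
qed

end

context reduced_inclusion
begin

text \<open>The sets of points near \<open>c s\<close> form an uncountable family. By continuity of the centers it is enough to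
  consider rational times, and then countably many exceptional null sets remain.\<close>

lemma ball_cover_near_values:
  assumes A: "finite C" "\<And>c. c \<in> C \<Longrightarrow> continuous_on UNIV c" and \<rho>: "\<rho> > 0" and \<epsilon>: "\<epsilon> > 0"
  shows "AE s in \<L>. \<forall>\<delta>>0. ball_cover {f j s |j. \<exists>c\<in>C. norm (d j - c s) < \<rho> + \<epsilon>} (\<eta> s * (\<rho> + 2 * \<epsilon>) + \<delta>)"
proof -
  \<comment> \<open>The radius grows by another \<epsilon>, which pays for moving from
    \<open>c s\<close> to the value of \<open>c\<close> at a nearby rational time; hence \<rho> + 2
    \<epsilon> in the claim.\<close>
  define A where "A \<tau> = {d j |j. \<exists>c\<in>C. norm (d j - c \<tau>) < \<rho> + 2 * \<epsilon>}" for \<tau>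
  have cov: "ball_cover (A \<tau>) (\<rho> + 2 * \<epsilon>)" for \<tau>
    by (rule ball_coverI[of "(\<lambda>c. c \<tau>) ` C"]) (use A(1) in \<open>auto simp: A_def dist_norm norm_minus_commute\<close>)
  have bdd: "bounded (A \<tau>)" for \<tau>
  proof (rule bounded_subset)
    show "bounded (\<Union>c\<in>C. ball (c \<tau>) (\<rho> + 2 * \<epsilon>))" using A(1) by (intro bounded_UN) auto
    show "A \<tau> \<subseteq> (\<Union>c\<in>C. ball (c \<tau>) (\<rho> + 2 * \<epsilon>))" by (auto simp: A_def dist_norm norm_minus_commute)
  qed
  have "AE s in \<L>. \<forall>q. \<forall>\<delta>>0. ball_cover (\<Union>x\<in>A (real_of_rat q). F s x) (\<eta> s * (\<rho> + 2 * \<epsilon>) + \<delta>)"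
    unfolding AE_all_countable using \<rho> \<epsilon> by (intro allI F_mnc bdd cov) auto
  then show ?thesis
    using AE_space
  proof eventually_elim
    case (elim s)
    have "\<forall>\<^sub>F t in at s. \<forall>c\<in>C. dist (c t) (c s) < \<epsilon>"
      using A \<epsilon> by (auto simp: eventually_ball_finite_distrib continuous_on_def intro!: tendstoD)
    then obtain e where e: "e > 0" "\<And>t. t \<noteq> s \<Longrightarrow> dist t s < e \<Longrightarrow> \<forall>c\<in>C. dist (c t) (c s) < \<epsilon>"
      unfolding eventually_at by blast
    obtain q where q: "s < real_of_rat q" "real_of_rat q < s + e"
      using of_rat_dense[of s "s + e"] e(1) by auto
    then have "\<forall>c\<in>C. dist (c (real_of_rat q)) (c s) < \<epsilon>" by (intro e(2)) (auto simp: dist_real_def)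
    then have "{f j s |j. \<exists>c\<in>C. norm (d j - c s) < \<rho> + \<epsilon>} \<subseteq> (\<Union>x\<in>A (real_of_rat q). F s x)"
    proof (intro subsetI)
      fix v assume near: "\<forall>c\<in>C. dist (c (real_of_rat q)) (c s) < \<epsilon>"
        and "v \<in> {f j s |j. \<exists>c\<in>C. norm (d j - c s) < \<rho> + \<epsilon>}"
      then obtain j c where j: "v = f j s" "c \<in> C" "norm (d j - c s) < \<rho> + \<epsilon>" by blast
      have "norm (d j - c (real_of_rat q)) < \<rho> + 2 * \<epsilon>"
        using j(3) near[rule_format, OF j(2)] norm_triangle_ineq[of "d j - c s" "c s - c (real_of_rat q)"]
        by (simp add: dist_norm norm_minus_commute)
      then have "d j \<in> A (real_of_rat q)" using j(2) by (auto simp: A_def)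
      moreover have "v \<in> F s (d j)" using f_F[of s j] elim(2) j(1) by simp
      ultimately show "v \<in> (\<Union>x\<in>A (real_of_rat q). F s x)" by blast
    qed
    then show ?case using elim(1) by (meson ball_cover_mono order_refl)
  qed
qed

text \<open>The supremum over the countably many relevant \<open>j\<close> of the distance between \<open>f j s\<close> and
  \<open>{y 0, \<dots>, y l}\<close> is measurable in \<open>s\<close> and tends to at most \<open>\<kappa> * \<eta> s * (\<rho> + 2 * \<epsilon>)\<close> as \<open>l\<close> grows.\<close>

lemma distance_function:
  assumes C: "finite C" "\<And>c. c \<in> C \<Longrightarrow> continuous_on UNIV c" "\<And>c s. c \<in> C \<Longrightarrow> s \<in> {0..T} \<Longrightarrow> norm (c s) \<le> R"
    and \<rho>: "\<rho> > 0" and \<epsilon>: "\<epsilon> > 0" and \<delta>: "\<delta> > 0"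
  obtains e l where "integrable \<L> e" "(LINT s|\<L>. e s) \<le> \<kappa> * (LINT s|\<L>. \<eta> s) * (\<rho> + 2 * \<epsilon>) + \<delta>"
    "AE s in \<L>. \<forall>j. (\<exists>c\<in>C. norm (d j - c s) < \<rho> + \<epsilon>) \<longrightarrow> (\<exists>i\<le>l. norm (f j s - y i) \<le> e s)"
proof -
  define J where "J j s \<longleftrightarrow> (\<exists>c\<in>C. norm (d j - c s) < \<rho> + \<epsilon>)" for j s
  define B where "B s = \<mu> s * (1 + (\<bar>R\<bar> + \<rho> + \<epsilon>)) + norm (y 0)" for s
  \<comment> \<open>\<open>f_bound\<close> holds almost everywhere only; the cut-off at
    \<open>B s\<close> makes the supremum over j finite at every s, with an integrable majorant, and
    changes nothing where \<open>f_bound\<close> holds.\<close>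
  define D where "D l j s = (if J j s then min (B s) (dist (f j s) (y (nearest y l (f j s)))) else 0)" for l j s
  define E where "E l s = (SUP j. D l j s)" for l s
  define h where "h s = \<kappa> * (\<eta> s * (\<rho> + 2 * \<epsilon>))" for s
  have B: "integrable \<L> B" unfolding B_def using \<mu>(1) by simp
  have B0: "0 \<le> B s" for s unfolding B_def using \<mu>(2)[of s] \<rho> \<epsilon> by (intro add_nonneg_nonneg mult_nonneg_nonneg) auto
  have h: "integrable \<L> h" unfolding h_def using \<eta>(1) by simp
  have D_le: "D l j s \<le> B s" for l j s using B0 by (simp add: D_def)
  have D_ge: "0 \<le> D l j s" for l j s using B0 by (simp add: D_def)
  have bdd: "bdd_above (range (\<lambda>j. D l j s))" for l s using D_le by (intro bdd_aboveI2)
  have D_E: "D l j s \<le> E l s" for l j s unfolding E_def by (intro cSUP_upper bdd) auto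
  have E_le: "E l s \<le> B s" for l s unfolding E_def by (intro cSUP_least D_le) auto
  have E_ge: "0 \<le> E l s" for l s using D_ge[of l 0 s] D_E[of l 0 s] by linarith
  have [measurable]: "B \<in> borel_measurable \<L>" using B by simp
  have D_meas: "D l j \<in> borel_measurable \<L>" for l j
  proof -
    have "open {s. norm (d j - c s) < \<rho> + \<epsilon>}" if "c \<in> C" for c
      using C(2)[OF that] by (intro open_Collect_less continuous_intros)
    then have "open (\<Union>c\<in>C. {s. norm (d j - c s) < \<rho> + \<epsilon>})" by blast
    moreover have "{s. J j s} = (\<Union>c\<in>C. {s. norm (d j - c s) < \<rho> + \<epsilon>})" by (auto simp: J_def)
    ultimately have "{s. J j s} \<in> sets borel" by simp
    then have "{s. J j s} \<in> sets lebesgue" by (intro sets_completionI_sets) simp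
    then have "{s. J j s} \<inter> {0..T} \<in> sets \<L>" by (auto simp: sets_restrict_space)
    then have J_meas: "{s \<in> space \<L>. J j s} \<in> sets \<L>" by (simp add: Int_def conj_commute)
    have dist_meas: "(\<lambda>s. dist (f j s) (y i)) \<in> borel_measurable \<L>" for i
      using lebesgue.norm_borel_measurable[OF lebesgue.strongly_measurable_diff[OF f_measurable lebesgue.strongly_measurable_const[of "y i"]]]
      by (simp add: dist_norm)
    have simple: "simple_function \<L> (\<lambda>s. nearest y l (f j s))"
      by (rule lebesgue.simple_function_nearest[OF dist_meas])
    have "(\<lambda>s. dist (f j s) (y (nearest y l (f j s)))) \<in> borel_measurable \<L>"
    proof -
      have eq: "dist (f j s) (y (nearest y l (f j s))) = (\<Sum>i\<le>l. (if nearest y l (f j s) = i then 1 else 0) * dist (f j s) (y i))" for s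
      proof -
        have "(\<Sum>i\<le>l. (if nearest y l (f j s) = i then 1 else 0) * dist (f j s) (y i))
            = (\<Sum>i\<in>{nearest y l (f j s)}. (if nearest y l (f j s) = i then 1 else 0) * dist (f j s) (y i))"
          using nearest_le[of y l "f j s"] by (intro sum.mono_neutral_right) auto
        then show ?thesis by simp
      qed
      have ind: "(\<lambda>s. if nearest y l (f j s) = i then 1 else 0 :: real) \<in> borel_measurable \<L>" for i
        using lebesgue.sets_nearest_eq[where m = l and j = i, OF dist_meas] by (intro measurable_If) auto
      show ?thesis unfolding eq by (intro borel_measurable_sum borel_measurable_times ind dist_meas)
    qed
    then show ?thesis unfolding D_def using J_meas by (intro measurable_If borel_measurable_min) auto
  qed
  have E_meas[measurable]: "E l \<in> borel_measurable \<L>" for l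
    unfolding E_def by (intro borel_measurable_cSUP D_meas bdd) auto
  have near_cov: "AE s in \<L>. \<forall>\<delta>>0. ball_cover {f j s |j. \<exists>c\<in>C. norm (d j - c s) < \<rho> + \<epsilon>} (\<eta> s * (\<rho> + 2 * \<epsilon>) + \<delta>)"
    by (rule ball_cover_near_values[OF C(1) _ \<rho> \<epsilon>]) (rule C(2))
  \<comment> \<open>The maximum with \<open>h\<close> replaces an upper bound for the limit of
    \<open>E l\<close> by an actual limit, as dominated convergence requires. At almost every s a
    cover by balls around y 0, ..., y m bounds \<open>E l s\<close> for all l \<ge> m.\<close>
  have lim: "AE s in \<L>. (\<lambda>l. max (E l s) (h s)) \<longlonglongrightarrow> h s"
    using near_cov f_in_X
  proof eventually_elim
    case (elim s)
    show ?case
    proof (rule LIMSEQ_I)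
      fix \<delta>' :: real assume "\<delta>' > 0"
      define A where "A = {f j s |j. J j s}"
      have AX: "A \<subseteq> X" using elim(2) by (auto simp: A_def)
      define \<delta>'' where "\<delta>'' = \<delta>' / (4 * \<kappa>)"
      have "\<delta>'' > 0" using \<open>\<delta>' > 0\<close> \<kappa>(1) by (simp add: \<delta>''_def)
      then have "ball_cover A (\<eta> s * (\<rho> + 2 * \<epsilon>) + \<delta>'')" using elim(1) by (simp add: A_def J_def)
      moreover have "\<kappa> * (\<eta> s * (\<rho> + 2 * \<epsilon>) + \<delta>'') < h s + \<delta>' / 2"
        using \<kappa>(1) \<open>\<delta>' > 0\<close> by (simp add: h_def \<delta>''_def distrib_left)
      ultimately obtain m where m: "A \<subseteq> (\<Union>j\<le>m. ball (y j) (h s + \<delta>' / 2))" using y[OF AX] by blast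
      have "norm (max (E l s) (h s) - h s) < \<delta>'" if "l \<ge> m" for l
      proof -
        have h0: "0 \<le> h s" using \<kappa>(1) \<eta>(2)[of s] \<rho> \<epsilon> by (simp add: h_def)
        have "D l j s \<le> h s + \<delta>' / 2" for j
        proof (cases "J j s")
          case True
          then have "f j s \<in> A" unfolding A_def by blast
          then have "f j s \<in> (\<Union>j\<le>m. ball (y j) (h s + \<delta>' / 2))" using m by blast
          then obtain i where i: "i \<le> m" "dist (y i) (f j s) < h s + \<delta>' / 2" by auto
          have "dist (f j s) (y (nearest y l (f j s))) \<le> dist (f j s) (y i)"
            using i(1) that by (intro nearest_dist) simp
          then show ?thesis using i(2) True by (simp add: D_def dist_commute)
        qed (use h0 \<open>\<delta>' > 0\<close> in \<open>simp add: D_def\<close>)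
        then have "E l s \<le> h s + \<delta>' / 2" unfolding E_def by (intro cSUP_least) auto
        then show ?thesis using \<open>\<delta>' > 0\<close> by (auto simp: max_def)
      qed
      then show "\<exists>no. \<forall>n\<ge>no. norm (max (E n s) (h s) - h s) < \<delta>'" by blast
    qed
  qed
  have "(\<lambda>l. LINT s|\<L>. max (E l s) (h s)) \<longlonglongrightarrow> (LINT s|\<L>. h s)"
  proof (rule integral_dominated_convergence[OF _ _ _ lim])
    show "integrable \<L> (\<lambda>s. B s + \<bar>h s\<bar>)" using B h by simp
    show "AE s in \<L>. norm (max (E l s) (h s)) \<le> B s + \<bar>h s\<bar>" for l
    proof (rule AE_I2)
      fix s show "norm (max (E l s) (h s)) \<le> B s + \<bar>h s\<bar>"
        using E_le[of l s] E_ge[of l s] B0[of s] by (auto simp: max_def)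
    qed
  qed (use h in auto)
  then have "\<forall>\<^sub>F l in sequentially. (LINT s|\<L>. max (E l s) (h s)) < (LINT s|\<L>. h s) + \<delta>"
    by (rule order_tendstoD(2)) (use \<delta> in simp)
  then obtain l where l: "(LINT s|\<L>. max (E l s) (h s)) < (LINT s|\<L>. h s) + \<delta>"
    by (auto simp: eventually_sequentially)
  show ?thesis
  proof (rule that[of "\<lambda>s. max (E l s) (h s)" l])
    show "integrable \<L> (\<lambda>s. max (E l s) (h s))"
    proof (rule Bochner_Integration.integrable_bound[of _ "\<lambda>s. B s + \<bar>h s\<bar>"])
      show "integrable \<L> (\<lambda>s. B s + \<bar>h s\<bar>)" using B h by simp
      show "AE s in \<L>. norm (max (E l s) (h s)) \<le> norm (B s + \<bar>h s\<bar>)"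
      proof (rule AE_I2)
        fix s show "norm (max (E l s) (h s)) \<le> norm (B s + \<bar>h s\<bar>)"
          using E_le[of l s] E_ge[of l s] B0[of s] by (auto simp: max_def)
      qed
    qed (use h in measurable)
    have "(LINT s|\<L>. h s) = \<kappa> * (LINT s|\<L>. \<eta> s) * (\<rho> + 2 * \<epsilon>)"
      by (simp add: h_def mult.assoc)
    then show "(LINT s|\<L>. max (E l s) (h s)) \<le> \<kappa> * (LINT s|\<L>. \<eta> s) * (\<rho> + 2 * \<epsilon>) + \<delta>"
      using l by simp
    show "AE s in \<L>. \<forall>j. (\<exists>c\<in>C. norm (d j - c s) < \<rho> + \<epsilon>) \<longrightarrow> (\<exists>i\<le>l. norm (f j s - y i) \<le> max (E l s) (h s))"
      using f_bound AE_space
    proof eventually_elim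
      case (elim s)
      show ?case
      proof (intro allI impI)
        fix j assume j: "\<exists>c\<in>C. norm (d j - c s) < \<rho> + \<epsilon>"
        then obtain c where c: "c \<in> C" "norm (d j - c s) < \<rho> + \<epsilon>" by blast
        have "norm (c s) \<le> R" using C(3)[OF c(1), of s] elim(2) by simp
        then have dj: "norm (d j) \<le> \<bar>R\<bar> + \<rho> + \<epsilon>"
          using c(2) norm_triangle_ineq[of "d j - c s" "c s"] by simp
        have "dist (f j s) (y (nearest y l (f j s))) \<le> dist (f j s) (y 0)"
          by (rule nearest_dist) simp
        also have "\<dots> \<le> norm (f j s) + norm (y 0)" unfolding dist_norm by (rule norm_triangle_ineq4)
        also have "norm (f j s) \<le> \<mu> s * (1 + (\<bar>R\<bar> + \<rho> + \<epsilon>))"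
        proof -
          have "\<mu> s * (1 + norm (d j)) \<le> \<mu> s * (1 + (\<bar>R\<bar> + \<rho> + \<epsilon>))"
            using dj \<mu>(2) by (intro mult_left_mono) auto
          then show ?thesis using elim(1) by (meson order_trans)
        qed
        finally have "dist (f j s) (y (nearest y l (f j s))) \<le> B s" by (simp add: B_def)
        then have "dist (f j s) (y (nearest y l (f j s))) = D l j s" using j by (simp add: D_def J_def)
        also have "\<dots> \<le> max (E l s) (h s)" using D_E[of l j s] by simp
        finally show "\<exists>i\<le>l. norm (f j s - y i) \<le> max (E l s) (h s)"
          using nearest_le[of y l "f j s"] by (auto simp: dist_norm)
      qed
    qed
  qed
qed

text \<open>\<open>q\<close> adds the contributions of \<open>G\<close> and of the integral term;
  \<open>b\<close> collects the terms in \<epsilon>, the part with 2 M \<open>\<kappa>\<close>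
  coming from the radius \<rho> + 2 \<epsilon> and the summand 1 from auxiliary slacks.\<close>

definition q :: real where "q = M * (k + \<kappa> * (LINT t|\<L>. \<eta> t))"
definition b :: real where "b = 2 * M * \<kappa> * (LINT t|\<L>. \<eta> t) + 1"

lemma int_\<eta>: "0 \<le> (LINT t|\<L>. \<eta> t)"
  using \<eta>(2) by (intro Bochner_Integration.integral_nonneg) auto

lemma q_bounds: "0 \<le> q" "q < 1"
  using contraction int_\<eta> M_pos k \<kappa>(1) by (auto simp: q_def)

lemma b_ge: "b \<ge> 1"
  using int_\<eta> M_pos \<kappa>(1) by (simp add: b_def)

text \<open>The two summands of \<open>sol\<close> are covered separately: the orbits through
  \<open>G_mnc\<close> and the bound \<open>M\<close>, the integral terms through
  \<open>distance_function\<close> and \<open>ball_cover_mild\<close>.\<close>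

lemma ball_cover_H:
  assumes \<Omega>: "\<Omega> \<subseteq> K" and \<rho>: "\<rho> > 0" and cov: "ball_cover \<Omega> \<rho>" and \<epsilon>: "0 < \<epsilon>" "\<epsilon> \<le> \<epsilon>\<^sub>0"
  shows "ball_cover (\<Union>x\<in>\<Omega>. H \<epsilon> x) (q * \<rho> + b * \<epsilon>)"
proof -
  \<comment> \<open>This slack enters M + 1 times through the orbits and M + 1 times through the
    integral terms, so in total it amounts to \<epsilon>.\<close>
  define \<delta> where "\<delta> = \<epsilon> / (2 * M + 2)"
  have \<delta>: "\<delta> > 0" using \<epsilon> M_pos by (simp add: \<delta>_def)
  have \<delta>_eq: "(2 * M + 2) * \<delta> = \<epsilon>" using M_pos by (simp add: \<delta>_def)
  obtain C where C: "finite C" "\<Omega> \<subseteq> (\<Union>c\<in>C. ball c \<rho>)" using cov by (rule ball_coverE)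
  have "ball_cover (G ` \<Omega>) (k * \<rho> + \<delta>)"
    by (intro G_mnc cov \<rho> \<delta> bounded_subset[OF K_bounded \<Omega>])
  then obtain B where B: "finite B" "G ` \<Omega> \<subseteq> (\<Union>c\<in>B. ball c (k * \<rho> + \<delta>))" by (rule ball_coverE)
  have orbits: "ball_cover ((\<lambda>x. extC (\<lambda>t. U t (G x))) ` \<Omega>) (M * (k * \<rho> + \<delta>) + \<delta>)"
  proof (rule ball_coverI[of "(\<lambda>v. extC (\<lambda>t. U t v)) ` B"])
    show "(\<lambda>x. extC (\<lambda>t. U t (G x))) ` \<Omega> \<subseteq> (\<Union>c\<in>(\<lambda>v. extC (\<lambda>t. U t v)) ` B. ball c (M * (k * \<rho> + \<delta>) + \<delta>))"
    proof
      fix z assume "z \<in> (\<lambda>x. extC (\<lambda>t. U t (G x))) ` \<Omega>"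
      then obtain x where x: "x \<in> \<Omega>" "z = extC (\<lambda>t. U t (G x))" by blast
      then obtain v where v: "v \<in> B" "dist v (G x) < k * \<rho> + \<delta>" using B(2) by auto
      have "dist (extC (\<lambda>t. U t v)) z \<le> M * (k * \<rho> + \<delta>)"
        unfolding x(2)
      proof (rule dist_extC_le[OF orbit_continuous orbit_continuous])
        fix t assume t: "0 \<le> t" "t \<le> T"
        have "norm (U t v - U t (G x)) \<le> M * norm (v - G x)"
          using norm_U_apply[OF t, of "v - G x"] by (simp add: blinfun.diff_right)
        also have "\<dots> \<le> M * (k * \<rho> + \<delta>)" using v(2) M_pos by (intro mult_left_mono) (auto simp: dist_norm)
        finally show "norm (U t v - U t (G x)) \<le> M * (k * \<rho> + \<delta>)" .
      qed
      then have "dist (extC (\<lambda>t. U t v)) z < M * (k * \<rho> + \<delta>) + \<delta>" using \<delta> by linarith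
      then show "z \<in> (\<Union>c\<in>(\<lambda>v. extC (\<lambda>t. U t v)) ` B. ball c (M * (k * \<rho> + \<delta>) + \<delta>))" using v(1) by auto
    qed
  qed (use B in simp)
  define \<Phi> where "\<Phi> = (\<Union>x\<in>\<Omega>. sels \<epsilon> x)"
  obtain e l where e: "integrable \<L> e" "(LINT s|\<L>. e s) \<le> \<kappa> * (LINT s|\<L>. \<eta> s) * (\<rho> + 2 * \<epsilon>) + \<delta>"
    and near: "AE s in \<L>. \<forall>j. (\<exists>c\<in>apply_bcontfun ` C. norm (d j - c s) < \<rho> + \<epsilon>) \<longrightarrow> (\<exists>i\<le>l. norm (f j s - y i) \<le> e s)"
  proof (rule distance_function[of "apply_bcontfun ` C" "\<Sum>c\<in>C. norm c" \<rho> \<epsilon> \<delta>])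
    fix c s assume "c \<in> apply_bcontfun ` C"
    then obtain c' where c': "c' \<in> C" "c = apply_bcontfun c'" by blast
    have "norm (c s) \<le> norm c'" using norm_bounded[of c' s] c'(2) by simp
    also have "\<dots> \<le> (\<Sum>c\<in>C. norm c)" using c'(1) C(1) by (intro member_le_sum) auto
    finally show "norm (c s) \<le> (\<Sum>c\<in>C. norm c)" .
  qed (use C \<rho> \<epsilon> \<delta> in auto)
  have "ball_cover ((\<lambda>h. extC (mild h)) ` \<Phi>) (M * (LINT s|\<L>. e s) + \<delta>)"
  proof (rule ball_cover_mild[OF _ e(1) _ _ _ \<delta>])
    show "L1_function \<L> h" if "h \<in> \<Phi>" for h using that sels_L1 by (auto simp: \<Phi>_def)
    \<comment> \<open>The hull replaces the points \<open>y i\<close> because \<open>h s\<close>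
      combines values that may be close to different \<open>y i\<close>.\<close>
    show "compact (convex hull (y ` {..l}))" by (intro finite_imp_compact_convex_hull) auto
    show "convex hull (y ` {..l}) \<noteq> {}" by simp
    fix h assume "h \<in> \<Phi>"
    then obtain x where x: "x \<in> \<Omega>" "h \<in> sels \<epsilon> x" by (auto simp: \<Phi>_def)
    then obtain c where c: "c \<in> C" "dist c x < \<rho>" using C(2) by auto
    show "AE s in \<L>. \<exists>v\<in>convex hull (y ` {..l}). norm (h s - v) \<le> e s"
      using near AE_space
    proof eventually_elim
      case (elim s)
      have "near_values \<epsilon> (x s) s \<subseteq> {u. \<exists>v\<in>convex hull (y ` {..l}). norm (u - v) \<le> e s}"
      proof
        fix u assume "u \<in> near_values \<epsilon> (x s) s"
        then obtain j where j: "u = f j s" "norm (x s - d j) < \<epsilon>" by (auto simp: near_values_def)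
        have "dist (c s) (x s) < \<rho>" by (rule dist_fun_lt_imp_dist_val_lt[OF c(2)])
        then have "norm (d j - c s) < \<rho> + \<epsilon>"
          using j(2) norm_triangle_ineq[of "d j - x s" "x s - c s"] by (simp add: dist_norm norm_minus_commute)
        then obtain i where "i \<le> l" "norm (u - y i) \<le> e s" using elim(1) c(1) j(1) by blast
        then show "u \<in> {u. \<exists>v\<in>convex hull (y ` {..l}). norm (u - v) \<le> e s}"
          by (intro CollectI bexI[of _ "y i"]) (auto intro: hull_inc)
      qed
      then have "convex hull (near_values \<epsilon> (x s) s) \<subseteq> {u. \<exists>v\<in>convex hull (y ` {..l}). norm (u - v) \<le> e s}"
        by (rule hull_minimal) (intro convex_thickening convex_convex_hull)
      then show ?case using sels_hull[OF x(2), of s] elim(2) by auto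
    qed
  qed
  from ball_cover_sums[OF orbits this]
  have "ball_cover {u + v |u v. u \<in> (\<lambda>x. extC (\<lambda>t. U t (G x))) ` \<Omega> \<and> v \<in> (\<lambda>h. extC (mild h)) ` \<Phi>}
      (M * (k * \<rho> + \<delta>) + \<delta> + (M * (LINT s|\<L>. e s) + \<delta>))" .
  moreover have "(\<Union>x\<in>\<Omega>. H \<epsilon> x) \<subseteq> {u + v |u v. u \<in> (\<lambda>x. extC (\<lambda>t. U t (G x))) ` \<Omega> \<and> v \<in> (\<lambda>h. extC (mild h)) ` \<Phi>}"
    unfolding H_def sol_def \<Phi>_def by blast
  moreover have "M * (k * \<rho> + \<delta>) + \<delta> + (M * (LINT s|\<L>. e s) + \<delta>) \<le> q * \<rho> + b * \<epsilon>"
  proof -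
    have "M * (LINT s|\<L>. e s) \<le> M * (\<kappa> * (LINT s|\<L>. \<eta> s) * (\<rho> + 2 * \<epsilon>) + \<delta>)"
      using e(2) M_pos by (intro mult_left_mono) auto
    moreover have "M * (k * \<rho> + \<delta>) + \<delta> + (M * (\<kappa> * (LINT s|\<L>. \<eta> s) * (\<rho> + 2 * \<epsilon>) + \<delta>) + \<delta>)
        = q * \<rho> + (b - 1) * \<epsilon> + (2 * M + 2) * \<delta>"
      by (simp add: q_def b_def algebra_simps)
    ultimately show ?thesis unfolding \<delta>_eq by (simp add: algebra_simps)
  qed
  ultimately show ?thesis by (rule ball_cover_mono)
qed

end

section \<open>Passage to the limit\<close>

lemma ball_cover_tails_convergent_subsequence:
  fixes u :: "nat \<Rightarrow> 'a::complete_space"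
  assumes "\<And>e. e > 0 \<Longrightarrow> \<exists>N. ball_cover (u ` {N..}) e"
  obtains \<phi> l where "strict_mono \<phi>" "(\<lambda>n. u (\<phi> n)) \<longlonglongrightarrow> l"
proof -
  have cov: "ball_cover (range u) e" if "e > 0" for e
  proof -
    obtain N where N: "ball_cover (u ` {N..}) e" using assms[OF \<open>e > 0\<close>] by blast
    have "range u = u ` ({N..} \<union> {..<N})" by (rule arg_cong[where f = "image u"]) auto
    then show ?thesis using ball_cover_Un[OF N ball_cover_finite[of "u ` {..<N}", OF _ that]] by (simp add: image_Un)
  qed
  have "compact (closure (range u))"
    unfolding compact_eq_totally_bounded
  proof (intro conjI allI impI)
    show "complete (closure (range u))" by (simp add: complete_eq_closed)
    fix e :: real assume "e > 0"
    then have "e / 2 > 0" by simp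
    then have "ball_cover (closure (range u)) (e / 2 + e / 2)"
    proof (rule ball_cover_near[OF cov])
      fix a assume "a \<in> closure (range u)"
      then obtain b where "b \<in> range u" "dist b a < e / 2" using \<open>e / 2 > 0\<close> unfolding closure_approachable by blast
      then show "\<exists>b\<in>range u. dist a b \<le> e / 2" by (intro bexI[of _ b]) (auto simp: dist_commute)
    qed
    then show "\<exists>k. finite k \<and> closure (range u) \<subseteq> (\<Union>x\<in>k. ball x e)"
      by (simp add: ball_cover_def)
  qed
  then have "seq_compact (closure (range u))" by (simp add: compact_eq_seq_compact_metric)
  moreover have "\<forall>n. u n \<in> closure (range u)" using closure_subset[of "range u"] by blast
  ultimately obtain l \<phi> where "strict_mono \<phi>" "(u \<circ> \<phi>) \<longlonglongrightarrow> l"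
    unfolding seq_compact_def by blast
  then show ?thesis using that by (simp add: comp_def)
qed

lemma wsum_in_convex:
  fixes u :: "nat \<Rightarrow> 'b::real_vector"
  assumes "w \<in> tail_weights n" "convex S" "\<And>i. n \<le> i \<Longrightarrow> u i \<in> S"
  shows "wsum w u \<in> S"
proof -
  have "\<exists>N. (\<forall>i\<ge>N. w i = 0) \<and> (\<Sum>i<N. w i) = 1" and w: "\<And>i. 0 \<le> w i" "\<And>i. i < n \<Longrightarrow> w i = 0"
    using assms(1) by (simp_all add: tail_weights_def)
  then obtain N where N: "\<forall>i\<ge>N. w i = 0" "(\<Sum>i<N. w i) = 1" by blast
  have sub: "{i. w i \<noteq> 0} \<subseteq> {..<N}" using N(1) by (auto simp: not_le[symmetric])
  show ?thesis
    unfolding wsum_def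
  proof (rule convex_sum[OF finite_subset[OF sub] assms(2)])
    have "(\<Sum>i | w i \<noteq> 0. w i) = (\<Sum>i<N. w i)" using sub by (intro sum.mono_neutral_left) auto
    then show "(\<Sum>i | w i \<noteq> 0. w i) = 1" using N(2) by (simp only:)
    show "u i \<in> S" if "i \<in> {i. w i \<noteq> 0}" for i
      using that w(2)[of i] assms(3)[of i] by (cases "i < n") auto
  qed (use w in auto)
qed

lemma tail_weights_finite: "w \<in> tail_weights n \<Longrightarrow> finite {i. w i \<noteq> 0}"
proof -
  assume "w \<in> tail_weights n"
  then obtain N where "\<forall>i\<ge>N. w i = 0" unfolding tail_weights_def by blast
  then have "{i. w i \<noteq> 0} \<subseteq> {..<N}" by (auto simp: not_le[symmetric])
  then show ?thesis by (rule finite_subset) simp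
qed

lemma wsum_diff: "wsum w (\<lambda>i. u i - v i) = wsum w u - wsum w v"
  by (simp add: wsum_def scaleR_diff_right sum_subtractf)

lemma norm_wsum_diff_le:
  fixes u v :: "nat \<Rightarrow> 'b::real_normed_vector"
  assumes "w \<in> tail_weights n" "\<And>i. n \<le> i \<Longrightarrow> norm (u i - v i) \<le> e"
  shows "norm (wsum w u - wsum w v) \<le> e"
proof -
  have "wsum w (\<lambda>i. u i - v i) \<in> cball 0 e"
    by (rule wsum_in_convex[OF assms(1)]) (use assms(2) in auto)
  then show ?thesis by (simp add: wsum_diff)
qed

lemma wsum_const: "w \<in> tail_weights n \<Longrightarrow> wsum w (\<lambda>i. l) = (l :: 'b::real_normed_vector)"
  using wsum_in_convex[of w n "{l}" "\<lambda>i. l"] by simp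

lemma wsum_tendsto:
  fixes u :: "nat \<Rightarrow> 'b::real_normed_vector"
  assumes w: "\<And>n. w n \<in> tail_weights n" and u: "u \<longlonglongrightarrow> l"
  shows "(\<lambda>n. wsum (w n) u) \<longlonglongrightarrow> l"
proof (rule LIMSEQ_I)
  fix e :: real assume "e > 0"
  then have "e / 2 > 0" by simp
  then obtain N where N: "\<And>i. i \<ge> N \<Longrightarrow> norm (u i - l) < e / 2" using LIMSEQ_D[OF u] by blast
  have "norm (wsum (w n) u - l) < e" if "n \<ge> N" for n
  proof -
    have "norm (u i - l) \<le> e / 2" if "n \<le> i" for i using N[of i] that \<open>n \<ge> N\<close> by simp
    then have "norm (wsum (w n) u - wsum (w n) (\<lambda>i. l)) \<le> e / 2" by (rule norm_wsum_diff_le[OF w])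
    then show ?thesis using \<open>e > 0\<close> by (simp add: wsum_const[OF w])
  qed
  then show "\<exists>no. \<forall>n\<ge>no. norm (wsum (w n) u - l) < e" by blast
qed

text \<open>The coefficients of the \<open>y j\<close> are weighted sums of indicator functions, and
  their convergence is what \<open>convex_combinations_converge_AE\<close> provides.\<close>

lemma wsum_nearest:
  "wsum w (\<lambda>i. y (nearest y l (u i))) = (\<Sum>j\<le>l. wsum w (\<lambda>i. if nearest y l (u i) = j then 1 else 0 :: real) *\<^sub>R y j)"
proof -
  have eq: "y (nearest y l v) = (\<Sum>j\<le>l. (if nearest y l v = j then 1 else 0 :: real) *\<^sub>R y j)" for v
  proof -
    have "(\<Sum>j\<le>l. (if nearest y l v = j then 1 else 0 :: real) *\<^sub>R y j)
        = (\<Sum>j\<in>{nearest y l v}. (if nearest y l v = j then 1 else 0 :: real) *\<^sub>R y j)"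
      using nearest_le[of y l v] by (intro sum.mono_neutral_right) auto
    then show ?thesis by simp
  qed
  have "wsum w (\<lambda>i. y (nearest y l (u i)))
      = (\<Sum>i | w i \<noteq> 0. w i *\<^sub>R (\<Sum>j\<le>l. (if nearest y l (u i) = j then 1 else 0 :: real) *\<^sub>R y j))"
    unfolding wsum_def by (intro sum.cong refl arg_cong[where f = "scaleR _"] eq)
  also have "\<dots> = (\<Sum>j\<le>l. \<Sum>i | w i \<noteq> 0. w i *\<^sub>R ((if nearest y l (u i) = j then 1 else 0 :: real) *\<^sub>R y j))"
    unfolding scaleR_sum_right by (rule sum.swap)
  also have "\<dots> = (\<Sum>j\<le>l. wsum w (\<lambda>i. if nearest y l (u i) = j then 1 else 0 :: real) *\<^sub>R y j)"
    unfolding wsum_def scaleR_sum_left by (intro sum.cong refl) simp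
  finally show ?thesis .
qed

context reduced_inclusion
begin

lemma approximate_solution:
  assumes "0 < \<epsilon>" "\<epsilon> \<le> \<epsilon>\<^sub>0"
  shows "\<exists>x\<in>K. \<exists>h\<in>sels \<epsilon> x. norm (x - sol x h) \<le> 6 * b / (1 - q) * \<epsilon>"
proof -
  have "\<exists>x\<in>K. \<exists>z\<in>H \<epsilon> x. norm (x - z) \<le> 6 * (b * \<epsilon>) / (1 - q)"
  proof (rule condensing_approximate_fixed_point[OF K_convex K_zero K_bounded])
    show "H \<epsilon> x \<subseteq> K" if "x \<in> K" for x by (rule H_subset_K[OF that assms])
    show "\<exists>S. continuous_on Z S \<and> (\<forall>x\<in>Z. S x \<in> H \<epsilon> x)" if "compact Z" "convex Z" "Z \<subseteq> K" for Z
      by (rule continuous_selection[OF that(1,3) assms(1)])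
    show "ball_cover (\<Union>x\<in>\<Omega>. H \<epsilon> x) (q * \<rho> + b * \<epsilon>)" if "\<Omega> \<subseteq> K" "\<rho> > 0" "ball_cover \<Omega> \<rho>" for \<Omega> \<rho>
      by (rule ball_cover_H[OF that assms])
    show "0 < b * \<epsilon>" using b_ge assms by simp
  qed (rule q_bounds)+
  then show ?thesis unfolding H_def by (auto simp: mult.assoc)
qed

text \<open>Up to C \<theta>, the terms with \<open>\<epsilon> n \<le> \<theta>\<close> lie in the
  union of the sets \<open>H \<theta> (x m)\<close>, and the finitely many others need no larger
  radius. So a cover with radius \<rho> improves to q \<rho> + (b + C) \<theta>, and
  \<open>affine_descent\<close> leaves a radius that tends to 0 with \<theta>.\<close>

lemma approximate_solutions_converge:
  obtains x h \<epsilon> xl where "\<And>n. x n \<in> K" "\<And>n. h n \<in> sels (\<epsilon> n) (x n)" "\<And>n. 0 < \<epsilon> n \<and> \<epsilon> n \<le> \<epsilon>\<^sub>0"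
    "\<epsilon> \<longlonglongrightarrow> 0" "x \<longlonglongrightarrow> xl" "(\<lambda>n. sol (x n) (h n)) \<longlonglongrightarrow> xl"
proof -
  define \<epsilon> where "\<epsilon> n = \<epsilon>\<^sub>0 * (1 / real (Suc n))" for n
  have \<epsilon>: "0 < \<epsilon> n" "\<epsilon> n \<le> \<epsilon>\<^sub>0" for n
  proof -
    show "0 < \<epsilon> n" using \<epsilon>\<^sub>0(1) by (simp add: \<epsilon>_def)
    have "1 / real (Suc n) \<le> 1" by simp
    then show "\<epsilon> n \<le> \<epsilon>\<^sub>0" using \<epsilon>\<^sub>0(1) mult_left_le[of "1 / real (Suc n)" \<epsilon>\<^sub>0] by (simp only: \<epsilon>_def)
  qed
  have "(\<lambda>n. \<epsilon>\<^sub>0 * inverse (real (Suc n))) \<longlonglongrightarrow> \<epsilon>\<^sub>0 * 0"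
    by (intro tendsto_intros LIMSEQ_inverse_real_of_nat)
  then have \<epsilon>_lim: "\<epsilon> \<longlonglongrightarrow> 0" by (simp add: \<epsilon>_def[abs_def] inverse_eq_divide)
  define C where "C = 6 * b / (1 - q)"
  have C: "C \<ge> 0" using b_ge q_bounds by (simp add: C_def)
  have "\<forall>n. \<exists>x h. x \<in> K \<and> h \<in> sels (\<epsilon> n) x \<and> norm (x - sol x h) \<le> C * \<epsilon> n"
    using approximate_solution[OF \<epsilon>] unfolding C_def by blast
  then obtain x h where x: "\<And>n. x n \<in> K" and h: "\<And>n. h n \<in> sels (\<epsilon> n) (x n)"
    and near: "\<And>n. norm (x n - sol (x n) (h n)) \<le> C * \<epsilon> n" by metis
  have ev: "\<exists>N. \<forall>n\<ge>N. \<epsilon> n \<le> \<theta>" if "\<theta> > 0" for \<theta>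
  proof -
    have "\<forall>\<^sub>F n in sequentially. \<epsilon> n < \<theta>" by (rule order_tendstoD(2)[OF \<epsilon>_lim that])
    then show ?thesis unfolding eventually_sequentially by (meson less_imp_le)
  qed
  have cov: "ball_cover (range x) ((b + C) * \<theta> / (1 - q) + \<theta>)" if \<theta>: "0 < \<theta>" "\<theta> \<le> \<epsilon>\<^sub>0" for \<theta>
  proof (rule affine_descent[where q = q and R = "r + 1"])
    show "ball_cover (range x) (r + 1)"
    proof (rule ball_coverI[of "{0}"], simp, rule subsetI)
      fix z assume "z \<in> range x"
      then have "dist z 0 \<le> r" using K_dist[OF x] by blast
      then show "z \<in> (\<Union>c\<in>{0}. ball c (r + 1))" by (simp add: dist_commute)
    qed
    show "ball_cover (range x) \<rho>'" if "ball_cover (range x) \<rho>" "\<rho> \<le> \<rho>'" for \<rho> \<rho>'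
      using that ball_cover_mono by blast
    show "ball_cover (range x) (q * \<rho> + (b + C) * \<theta>)" if \<rho>: "\<rho> > 0" "ball_cover (range x) \<rho>" for \<rho>
    proof -
      obtain N where N: "\<And>n. n \<ge> N \<Longrightarrow> \<epsilon> n \<le> \<theta>" using ev[OF \<theta>(1)] by blast
      have "ball_cover (\<Union>z\<in>range x. H \<theta> z) (q * \<rho> + b * \<theta>)"
        using x by (intro ball_cover_H \<rho> \<theta>) auto
      then have "ball_cover (x ` {N..}) (q * \<rho> + b * \<theta> + C * \<theta>)"
      proof (rule ball_cover_near)
        fix z assume "z \<in> x ` {N..}"
        then obtain n where n: "n \<ge> N" "z = x n" by auto
        have "h n \<in> sels \<theta> (x n)" using h[of n] sels_mono[OF N[OF n(1)]] by blast
        then have "sol (x n) (h n) \<in> (\<Union>z\<in>range x. H \<theta> z)" by (auto simp: H_def)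
        moreover have "dist z (sol (x n) (h n)) \<le> C * \<theta>"
          using near[of n] mult_left_mono[OF N[OF n(1)] C] by (simp add: n(2) dist_norm)
        ultimately show "\<exists>v\<in>(\<Union>z\<in>range x. H \<theta> z). dist z v \<le> C * \<theta>" by blast
      qed
      moreover have pos: "0 < q * \<rho> + b * \<theta> + C * \<theta>"
        using q_bounds(1) \<rho>(1) b_ge \<theta>(1) C by (simp add: add_nonneg_pos add_pos_nonneg)
      ultimately have "ball_cover (x ` {N..} \<union> x ` {..<N}) (q * \<rho> + b * \<theta> + C * \<theta>)"
        using ball_cover_finite[of "x ` {..<N}"] by (intro ball_cover_Un) auto
      moreover have "range x = x ` ({N..} \<union> {..<N})" by (rule arg_cong[where f = "image x"]) auto
      ultimately show ?thesis by (simp add: image_Un algebra_simps)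
    qed
  qed (use q_bounds r b_ge C \<theta> in auto)
  have tb: "\<exists>N. ball_cover (x ` {N..}) e" if "e > 0" for e
  proof -
    define D where "D = (b + C) / (1 - q) + 1"
    have D: "D > 0" using b_ge C q_bounds by (simp add: D_def add_nonneg_pos)
    define \<theta> where "\<theta> = min \<epsilon>\<^sub>0 (e / D)"
    have \<theta>: "0 < \<theta>" "\<theta> \<le> \<epsilon>\<^sub>0" using \<epsilon>\<^sub>0(1) \<open>e > 0\<close> D by (auto simp: \<theta>_def)
    have "D * \<theta> \<le> D * (e / D)" using D by (intro mult_left_mono) (auto simp: \<theta>_def)
    then have "D * \<theta> \<le> e" using D by simp
    moreover have "(b + C) * \<theta> / (1 - q) + \<theta> = D * \<theta>" by (simp add: D_def algebra_simps)
    ultimately have "ball_cover (x ` {0..}) e"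
      by (intro ball_cover_mono[OF cov[OF \<theta>]]) auto
    then show ?thesis by blast
  qed
  obtain \<phi> xl where \<phi>: "strict_mono \<phi>" "(\<lambda>n. x (\<phi> n)) \<longlonglongrightarrow> xl"
    using ball_cover_tails_convergent_subsequence[OF tb] by blast
  have \<epsilon>\<phi>: "(\<lambda>n. \<epsilon> (\<phi> n)) \<longlonglongrightarrow> 0" using LIMSEQ_subseq_LIMSEQ[OF \<epsilon>_lim \<phi>(1)] by (simp add: comp_def)
  show ?thesis
  proof (rule that[of "\<lambda>n. x (\<phi> n)" "\<lambda>n. h (\<phi> n)" "\<lambda>n. \<epsilon> (\<phi> n)" xl])
    have "(\<lambda>n. C * \<epsilon> (\<phi> n)) \<longlonglongrightarrow> C * 0" by (intro tendsto_intros \<epsilon>\<phi>)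
    then have C0: "(\<lambda>n. C * \<epsilon> (\<phi> n)) \<longlonglongrightarrow> 0" by simp
    have "(\<lambda>n. x (\<phi> n) - sol (x (\<phi> n)) (h (\<phi> n))) \<longlonglongrightarrow> 0"
      by (rule Lim_null_comparison[OF _ C0]) (simp add: near)
    from tendsto_diff[OF \<phi>(2) this] show "(\<lambda>n. sol (x (\<phi> n)) (h (\<phi> n))) \<longlonglongrightarrow> xl" by simp
  qed (use x h \<epsilon> \<epsilon>\<phi> \<phi> in auto)
qed

text \<open>The values \<open>h i s\<close> stay close to finitely many \<open>y j\<close>, so for the almost everywhere convergence of convex
  combinations of the \<open>h i\<close> it suffices that the same combinations of the indicator functions of the sets where
  \<open>y j\<close> is the nearest point converge. This avoids weak compactness in \<open>L\<^sup>1\<close>.\<close>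

lemma solution_exists:
  "\<exists>xl hl. L1_function \<L> hl \<and> (AE t in \<L>. hl t \<in> F t (apply_bcontfun xl t)) \<and>
     (\<forall>t\<in>{0..T}. apply_bcontfun xl t = U t (G xl) + mild hl t)"
proof -
  obtain x h \<epsilon> xl where x: "\<And>n. x n \<in> K" and h: "\<And>n. h n \<in> sels (\<epsilon> n) (x n)"
    and \<epsilon>: "\<And>n. 0 < \<epsilon> n \<and> \<epsilon> n \<le> \<epsilon>\<^sub>0" "\<epsilon> \<longlonglongrightarrow> 0" and xl: "x \<longlonglongrightarrow> xl"
    and sol: "(\<lambda>n. sol (x n) (h n)) \<longlonglongrightarrow> xl"
    by (rule approximate_solutions_converge) blast
  have pt: "(\<lambda>n. apply_bcontfun (u n) t) \<longlonglongrightarrow> apply_bcontfun l t" if "u \<longlonglongrightarrow> l" for u :: "nat \<Rightarrow> real \<Rightarrow>\<^sub>C 'e" and l t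
  proof -
    have "(\<lambda>n. dist (u n) l) \<longlonglongrightarrow> 0" using that by (simp add: tendsto_dist_iff[symmetric])
    then show ?thesis unfolding tendsto_dist_iff[of _ "apply_bcontfun l t"]
      by (rule Lim_null_comparison[rotated]) (simp add: dist_bounded)
  qed
  have xl_X: "apply_bcontfun xl t \<in> X" for t
    by (rule closed_sequentially[OF X_closed _ pt[OF xl, of t]]) (use x in \<open>auto simp: K_def\<close>)
  have L1h: "L1_function \<L> (h n)" for n by (rule sels_L1[OF h])
  define V where "V N s = near_values (1 / real (Suc N)) (apply_bcontfun xl s) s" for N s
  \<comment> \<open>Since the x n converge uniformly, the index does not depend on s; it absorbs
    both \<open>\<epsilon> i\<close> and the distance of \<open>x i\<close> to the limit.\<close>
  have h_V: "\<exists>I. \<forall>i\<ge>I. \<forall>s\<in>{0..T}. h i s \<in> convex hull (V N s)" for N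
  proof -
    have "(\<lambda>n. \<epsilon> n + dist (x n) xl) \<longlonglongrightarrow> 0 + 0"
      using xl by (intro tendsto_add \<epsilon>) (simp add: tendsto_dist_iff[symmetric])
    then have "\<forall>\<^sub>F n in sequentially. \<epsilon> n + dist (x n) xl < 1 / real (Suc N)"
      by (rule order_tendstoD(2)) simp
    then obtain I where I: "\<And>i. i \<ge> I \<Longrightarrow> \<epsilon> i + dist (x i) xl < 1 / real (Suc N)"
      by (auto simp: eventually_sequentially)
    have "h i s \<in> convex hull (V N s)" if "i \<ge> I" "s \<in> {0..T}" for i s
    proof -
      have "near_values (\<epsilon> i) (apply_bcontfun (x i) s) s \<subseteq> V N s"
      proof
        fix v assume "v \<in> near_values (\<epsilon> i) (apply_bcontfun (x i) s) s"
        then obtain j where j: "v = f j s" "norm (apply_bcontfun (x i) s - d j) < \<epsilon> i" by (auto simp: near_values_def)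
        have "norm (apply_bcontfun xl s - apply_bcontfun (x i) s) \<le> dist (x i) xl"
          using dist_bounded[of "x i" s xl] by (simp add: dist_norm norm_minus_commute)
        then have "norm (apply_bcontfun xl s - d j) < 1 / real (Suc N)"
          using j(2) I[OF that(1)]
            norm_triangle_ineq[of "apply_bcontfun xl s - apply_bcontfun (x i) s" "apply_bcontfun (x i) s - d j"]
          by (simp del: of_nat_Suc)
        then show "v \<in> V N s" unfolding V_def near_values_def using j(1) by blast
      qed
      then show ?thesis using sels_hull[OF h that(2)] hull_mono by blast
    qed
    then show ?thesis by blast
  qed

  \<comment> \<open>Selection values attached to points near the limit\<close>
  have F_near: "AE s in \<L>. \<forall>i N. \<forall>\<delta>>0. ball_cover (\<Union>v\<in>{d j |j. norm (d j - d i) < 2 / real (Suc N)}. F s v)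
      (\<eta> s * (2 / real (Suc N)) + \<delta>)"
    unfolding AE_all_countable
  proof (intro allI F_mnc)
    fix i N
    have sub: "{d j |j. norm (d j - d i) < 2 / real (Suc N)} \<subseteq> ball (d i) (2 / real (Suc N))"
      by (auto simp: dist_norm norm_minus_commute)
    show "bounded {d j |j. norm (d j - d i) < 2 / real (Suc N)}" by (rule bounded_subset[OF bounded_ball sub])
    show "ball_cover {d j |j. norm (d j - d i) < 2 / real (Suc N)} (2 / real (Suc N))"
      by (rule ball_coverI[of "{d i}"]) (use sub in auto)
  qed simp
  \<comment> \<open>The center \<open>xl s\<close> varies with s, so it is replaced by some
    \<open>d i\<close> at distance less than 1 / (N + 1): the balls about the \<open>d i\<close> are
    countably many, and the radius 2 / (N + 1) accommodates the shift.\<close>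
  have V_cov: "AE s in \<L>. \<forall>N. ball_cover (V N s) ((2 * \<eta> s + 1) / real (Suc N))"
    using F_near AE_space
  proof eventually_elim
    case (elim s)
    show ?case
    proof
      fix N
      have "apply_bcontfun xl s \<in> closure (range d)" using xl_X by (simp add: X_def)
      then obtain i where i: "dist (d i) (apply_bcontfun xl s) < 1 / real (Suc N)"
        unfolding closure_approachable by (metis divide_pos_pos of_nat_0_less_iff rangeE zero_less_Suc zero_less_one)
      have "V N s \<subseteq> (\<Union>v\<in>{d j |j. norm (d j - d i) < 2 / real (Suc N)}. F s v)"
      proof
        fix v assume "v \<in> V N s"
        then obtain j where j: "v = f j s" "norm (apply_bcontfun xl s - d j) < 1 / real (Suc N)"
          by (auto simp: V_def near_values_def)
        have "norm (d j - d i) \<le> norm (d j - apply_bcontfun xl s) + norm (apply_bcontfun xl s - d i)"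
          using norm_triangle_ineq[of "d j - apply_bcontfun xl s" "apply_bcontfun xl s - d i"] by simp
        moreover have "2 / real (Suc N) = 1 / real (Suc N) + 1 / real (Suc N)" by (simp flip: add_divide_distrib)
        ultimately have "norm (d j - d i) < 2 / real (Suc N)"
          using i j(2) unfolding dist_norm norm_minus_commute[of "d j" "apply_bcontfun xl s"]
            norm_minus_commute[of "d i" "apply_bcontfun xl s"] by linarith
        moreover have "v \<in> F s (d j)" using f_F[of s j] elim(2) j(1) by simp
        ultimately show "v \<in> (\<Union>v\<in>{d j |j. norm (d j - d i) < 2 / real (Suc N)}. F s v)" by blast
      qed
      note sub = this
      have eq: "\<eta> s * (2 / real (Suc N)) + 1 / real (Suc N) = (2 * \<eta> s + 1) / real (Suc N)"
        by (simp add: add_divide_distrib mult.commute)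
      have "0 < 1 / real (Suc N)" by simp
      then have "ball_cover (\<Union>v\<in>{d j |j. norm (d j - d i) < 2 / real (Suc N)}. F s v)
          (\<eta> s * (2 / real (Suc N)) + 1 / real (Suc N))"
        using elim(1) by blast
      then show "ball_cover (V N s) ((2 * \<eta> s + 1) / real (Suc N))"
        using sub unfolding eq by (rule ball_cover_mono) simp
    qed
  qed
  have small: "\<exists>N. c / real (Suc N) < e" if "e > 0" for c e :: real
  proof -
    obtain N :: nat where "c / e < real N" using reals_Archimedean2 by blast
    then have "c < e * real N" using that by (simp add: pos_divide_less_eq mult.commute)
    also have "\<dots> \<le> e * real (Suc N)" using that by (intro mult_left_mono) auto
    finally show ?thesis by (intro exI[of _ N]) (subst pos_divide_less_eq, auto)
  qed
  \<comment> \<open>A form of upper semicontinuity of \<open>F s\<close> at \<open>xl s\<close>, by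
    contradiction: values \<open>v N\<close> that stay away from \<open>F s (xl s)\<close> have a
    convergent subsequence by \<open>V_cov\<close>, and the closed graph puts its limit into
    \<open>F s (xl s)\<close>.\<close>
  have V_F: "AE s in \<L>. \<forall>e>0. \<exists>N. \<forall>v\<in>V N s. \<exists>z\<in>F s (apply_bcontfun xl s). norm (v - z) \<le> e"
    using V_cov F_closed AE_space
  proof eventually_elim
    case (elim s)
    show ?case
    proof (rule ccontr)
      assume "\<not> ?thesis"
      then obtain e where e: "e > 0" "\<forall>N. \<exists>v\<in>V N s. \<forall>z\<in>F s (apply_bcontfun xl s). \<not> norm (v - z) \<le> e" by blast
      then obtain v where v: "\<And>N. v N \<in> V N s" "\<And>N z. z \<in> F s (apply_bcontfun xl s) \<Longrightarrow> \<not> norm (v N - z) \<le> e"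
        by metis
      have "\<exists>j. v N = f j s \<and> norm (apply_bcontfun xl s - d j) < 1 / real (Suc N)" for N
        using v(1)[of N] by (auto simp: V_def near_values_def)
      then obtain j where j: "\<And>N. v N = f (j N) s" "\<And>N. norm (apply_bcontfun xl s - d (j N)) < 1 / real (Suc N)"
        by metis
      have V_mono: "V N' s \<subseteq> V N s" if "N \<le> N'" for N N'
      proof -
        have "1 / real (Suc N') \<le> 1 / real (Suc N)" using that by (intro divide_left_mono) auto
        then show ?thesis unfolding V_def near_values_def by (auto simp del: of_nat_Suc intro: less_le_trans)
      qed
      have "\<exists>N. ball_cover (v ` {N..}) e'" if "e' > 0" for e'
      proof -
        obtain N where N: "(2 * \<eta> s + 1) / real (Suc N) < e'" using small[OF \<open>e' > 0\<close>] by blast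
        have "v ` {N..} \<subseteq> V N s" using v(1) V_mono by blast
        then have "ball_cover (v ` {N..}) e'"
          using elim(1) N by (meson ball_cover_mono less_imp_le)
        then show ?thesis by blast
      qed
      then obtain \<phi> l where \<phi>: "strict_mono \<phi>" and l: "(\<lambda>n. v (\<phi> n)) \<longlonglongrightarrow> l"
        by (rule ball_cover_tails_convergent_subsequence)
      have inv0: "(\<lambda>N. 1 / real (Suc N)) \<longlonglongrightarrow> 0"
        using LIMSEQ_inverse_real_of_nat by (simp add: inverse_eq_divide)
      have "(\<lambda>N. d (j N) - apply_bcontfun xl s) \<longlonglongrightarrow> 0"
        by (rule Lim_null_comparison[OF _ inv0])
          (use j(2) in \<open>simp add: norm_minus_commute less_imp_le del: of_nat_Suc\<close>)
      then have "(\<lambda>N. d (j N)) \<longlonglongrightarrow> apply_bcontfun xl s" by (simp add: LIM_zero_iff)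
      then have dj: "(\<lambda>n. d (j (\<phi> n))) \<longlonglongrightarrow> apply_bcontfun xl s"
        using LIMSEQ_subseq_LIMSEQ[OF _ \<phi>] by (auto simp: comp_def)
      have "\<forall>n. v (\<phi> n) \<in> F s (d (j (\<phi> n)))" using f_F[of s] elim(3) by (simp add: j(1))
      then have "l \<in> F s (apply_bcontfun xl s)"
        using elim(2)[rule_format, of "\<lambda>n. v (\<phi> n)" "\<lambda>n. d (j (\<phi> n))" "apply_bcontfun xl s" l] dj l by simp
      then have "\<not> norm (v (\<phi> n) - l) \<le> e" for n by (rule v(2))
      moreover obtain n where "norm (v (\<phi> n) - l) < e" using LIMSEQ_D[OF l e(1)] by blast
      ultimately show False by (meson less_imp_le)
    qed
  qed

  \<comment> \<open>Almost everywhere convergence of convex combinations\<close>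
  have meas_h: "(\<lambda>s. dist (h i s) (y j)) \<in> borel_measurable \<L>" for i j
    using lebesgue.norm_borel_measurable[OF lebesgue.strongly_measurable_diff[OF _ lebesgue.strongly_measurable_const[of "y j"]], of "h i"]
      L1h[of i] by (simp add: L1_function_def dist_norm)
  define ind where "ind p i s = (if nearest y (fst (prod_decode p)) (h i s) = snd (prod_decode p) then 1 else 0 :: real)" for p i s
  obtain w where w: "\<And>n. w n \<in> tail_weights n"
    and w_conv: "\<And>p. AE s in \<L>. convergent (\<lambda>n. wsum (w n) (\<lambda>i. ind p i s))"
  proof (rule lebesgue.convex_combinations_converge_AE[of ind])
    show "ind p i \<in> borel_measurable \<L>" for p i
      unfolding ind_def using lebesgue.sets_nearest_eq[OF meas_h] by (intro measurable_If) auto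
    show "\<bar>ind p i s\<bar> \<le> 1" for p i s by (simp add: ind_def)
  qed blast
  have w_conv': "AE s in \<L>. \<forall>p. convergent (\<lambda>n. wsum (w n) (\<lambda>i. ind p i s))"
    using w_conv by (simp add: AE_all_countable)
  define hn where "hn n s = wsum (w n) (\<lambda>i. h i s)" for n s
  \<comment> \<open>Three errors of size e / 3: replacing each \<open>h i s\<close> by its nearest
    \<open>y j\<close>, an error that averaging does not increase, occurs for both indices, and the
    averages of the nearest points converge as combinations of indicators.\<close>
  have hn_conv: "AE s in \<L>. convergent (\<lambda>n. hn n s)"
    using V_cov w_conv' f_in_X AE_space
  proof eventually_elim
    case (elim s)
    have "Cauchy (\<lambda>n. hn n s)"
    proof (rule CauchyI)
      fix e :: real assume "e > 0"
      then have e3: "e / 3 > 0" by simp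
      obtain N where N: "(\<kappa> * (2 * \<eta> s + 2)) / real (Suc N) < e / 3" using small[OF e3] by blast
      obtain I where "\<forall>i\<ge>I. \<forall>s\<in>{0..T}. h i s \<in> convex hull (V N s)" using h_V[of N] by blast
      then have I: "\<And>i. i \<ge> I \<Longrightarrow> h i s \<in> convex hull (V N s)" using elim(4) by simp
      have "V N s \<subseteq> X" using elim(3) by (auto simp: V_def near_values_def)
      then have hull_X: "convex hull (V N s) \<subseteq> X" by (intro hull_minimal subspace_imp_convex X_subspace)
      have "ball_cover (convex hull (V N s)) ((2 * \<eta> s + 2) / real (Suc N))"
        by (rule ball_cover_convex_hull[OF elim(1)[rule_format, of N]]) (intro divide_strict_right_mono, auto)
      moreover have "\<kappa> * ((2 * \<eta> s + 2) / real (Suc N)) < e / 3" using N by simp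
      ultimately obtain l where l: "convex hull (V N s) \<subseteq> (\<Union>j\<le>l. ball (y j) (e / 3))"
        using y[OF hull_X] by blast
      have near: "norm (h i s - y (nearest y l (h i s))) \<le> e / 3" if "i \<ge> I" for i
      proof -
        have "h i s \<in> (\<Union>j\<le>l. ball (y j) (e / 3))" using I[OF that] l by blast
        then obtain j where j: "j \<le> l" "dist (y j) (h i s) < e / 3" by auto
        have "dist (h i s) (y (nearest y l (h i s))) \<le> dist (h i s) (y j)" by (rule nearest_dist[OF j(1)])
        then show ?thesis using j(2) by (simp add: dist_norm norm_minus_commute)
      qed
      define c where "c n = wsum (w n) (\<lambda>i. y (nearest y l (h i s)))" for n
      have "convergent c"
      proof -
        have "convergent (\<lambda>n. wsum (w n) (\<lambda>i. if nearest y l (h i s) = j then 1 else 0 :: real))" for j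
          using elim(2)[rule_format, of "prod_encode (l, j)"] by (simp add: ind_def)
        then have "\<exists>z. (\<lambda>n. wsum (w n) (\<lambda>i. if nearest y l (h i s) = j then 1 else 0 :: real)) \<longlonglongrightarrow> z" for j
          by (simp add: convergent_def)
        then obtain z where z: "\<And>j. (\<lambda>n. wsum (w n) (\<lambda>i. if nearest y l (h i s) = j then 1 else 0 :: real)) \<longlonglongrightarrow> z j"
          by metis
        have "c = (\<lambda>n. \<Sum>j\<le>l. wsum (w n) (\<lambda>i. if nearest y l (h i s) = j then 1 else 0 :: real) *\<^sub>R y j)"
          unfolding c_def by (intro ext wsum_nearest)
        then have "c \<longlonglongrightarrow> (\<Sum>j\<le>l. z j *\<^sub>R y j)"
          by (simp only:) (intro tendsto_intros z)
        then show ?thesis by (rule convergentI)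
      qed
      then obtain N' where N': "\<And>m n. m \<ge> N' \<Longrightarrow> n \<ge> N' \<Longrightarrow> norm (c m - c n) < e / 3"
        using CauchyD[OF convergent_Cauchy e3] by blast
      have hc: "norm (hn n s - c n) \<le> e / 3" if "n \<ge> I" for n
        unfolding hn_def c_def by (rule norm_wsum_diff_le[OF w]) (use near that in simp)
      have "norm (hn m s - hn n s) < e" if "m \<ge> max I N'" "n \<ge> max I N'" for m n
      proof -
        have "hn m s - hn n s = (hn m s - c m) + (c m - c n) - (hn n s - c n)" by simp
        then have "norm (hn m s - hn n s) \<le> norm (hn m s - c m) + norm (c m - c n) + norm (hn n s - c n)"
          by (metis (no_types, opaque_lifting) add_mono_thms_linordered_semiring(3) norm_triangle_ineq norm_triangle_ineq4 order_trans)
        then show ?thesis using hc[of m] hc[of n] N'[of m n] that by linarith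
      qed
      then show "\<exists>M. \<forall>m\<ge>M. \<forall>n\<ge>M. norm (hn m s - hn n s) < e" by blast
    qed
    then show ?case by (simp add: Cauchy_convergent_iff)
  qed
  define hl where "hl s = lim (\<lambda>n. hn n s)" for s
  have lim: "AE s in \<L>. (\<lambda>n. hn n s) \<longlonglongrightarrow> hl s"
    using hn_conv by eventually_elim (simp add: hl_def convergent_LIMSEQ_iff)
  have L1hn: "L1_function \<L> (hn n)" for n
  proof -
    have "L1_function \<L> (\<lambda>s. \<Sum>i | w n i \<noteq> 0. w n i *\<^sub>R h i s)"
      using lebesgue.bochner_integral_sum[OF tail_weights_finite[OF w], of n "\<lambda>i s. w n i *\<^sub>R h i s",
          OF lebesgue.L1_function_scaleR_const[OF L1h]] by blast
    then show ?thesis by (simp add: hn_def[abs_def] wsum_def)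
  qed
  define B where "B s = \<mu> s * (1 + \<epsilon>\<^sub>0 + r)" for s
  have B: "integrable \<L> B" unfolding B_def using \<mu>(1) by simp
  have h_bound: "AE s in \<L>. \<forall>i. norm (h i s) \<le> B s"
    unfolding AE_all_countable
  proof
    fix i
    show "AE s in \<L>. norm (h i s) \<le> B s"
      using sels_bound[OF h[of i]]
    proof eventually_elim
      case (elim s)
      have "\<mu> s * (1 + \<epsilon> i + norm (apply_bcontfun (x i) s)) \<le> B s"
        unfolding B_def using \<epsilon>(1)[of i] K_norm[OF x, of i s] \<mu>(2) by (intro mult_left_mono) auto
      with elim show ?case by simp
    qed
  qed
  have hn_bound: "AE s in \<L>. \<forall>n. norm (hn n s) \<le> B s"
    using h_bound
  proof eventually_elim
    case (elim s)
    show ?case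
    proof
      fix n
      have "hn n s \<in> cball 0 (B s)" unfolding hn_def by (rule wsum_in_convex[OF w]) (use elim in auto)
      then show "norm (hn n s) \<le> B s" by simp
    qed
  qed
  have hl_bound: "AE s in \<L>. norm (hl s) \<le> B s"
    using hn_bound lim
  proof eventually_elim
    case (elim s)
    show ?case by (rule LIMSEQ_le_const2[OF tendsto_norm[OF elim(2)]]) (use elim(1) in blast)
  qed
  have hl_meas: "strongly_measurable \<L> hl"
    by (rule lebesgue.strongly_measurable_AE_LIMSEQ[OF _ lim]) (use L1hn in \<open>auto simp: L1_function_def\<close>)
  have L1hl: "L1_function \<L> hl" by (rule lebesgue.L1_function_bound[OF hl_meas B hl_bound])
  \<comment> \<open>The e-neighborhood of \<open>F s (xl s)\<close> is convex, so it contains the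
    averages along with the \<open>h i s\<close>. Letting e tend to 0 uses that
    \<open>F s (xl s)\<close> is closed, which is the closed graph along a constant first
    component.\<close>
  have hl_F: "AE s in \<L>. hl s \<in> F s (apply_bcontfun xl s)"
    using V_F F_closed lim AE_space
  proof eventually_elim
    case (elim s)
    have s: "s \<in> {0..T}" using elim(4) by simp
    have "\<exists>z\<in>F s (apply_bcontfun xl s). norm (hl s - z) \<le> 2 * (1 / real (Suc p))" for p
    proof -
      define e where "e = 1 / real (Suc p)"
      have e: "e > 0" by (simp add: e_def)
      obtain N where N: "\<forall>v\<in>V N s. \<exists>z\<in>F s (apply_bcontfun xl s). norm (v - z) \<le> e" using elim(1) e by blast
      obtain I where "\<forall>i\<ge>I. \<forall>s\<in>{0..T}. h i s \<in> convex hull (V N s)" using h_V[of N] by blast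
      then have I: "\<And>i. i \<ge> I \<Longrightarrow> h i s \<in> convex hull (V N s)" using s by simp
      let ?S = "{u. \<exists>z\<in>F s (apply_bcontfun xl s). norm (u - z) \<le> e}"
      have S: "convex ?S" by (intro convex_thickening F_convex s)
      then have "convex hull (V N s) \<subseteq> ?S" using N by (intro hull_minimal) auto
      then have hS: "h i s \<in> ?S" if "i \<ge> I" for i using I[OF that] by blast
      obtain n where n: "n \<ge> I" "norm (hn n s - hl s) < e"
        using LIMSEQ_D[OF elim(3) e] by (metis nle_le)
      have "hn n s \<in> ?S" unfolding hn_def by (rule wsum_in_convex[OF w S]) (use hS n(1) in \<open>auto simp del: mem_Collect_eq\<close>)
      then obtain z where z: "z \<in> F s (apply_bcontfun xl s)" "norm (hn n s - z) \<le> e" by blast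
      have "norm (hl s - z) \<le> 2 * e"
        using n(2) z(2) norm_triangle_ineq[of "hl s - hn n s" "hn n s - z"] by (simp add: norm_minus_commute)
      then show ?thesis using z(1) unfolding e_def by blast
    qed
    then obtain z where z: "\<And>p. z p \<in> F s (apply_bcontfun xl s)" "\<And>p. norm (hl s - z p) \<le> 2 * (1 / real (Suc p))"
      by metis
    have inv0: "(\<lambda>p. 2 * (1 / real (Suc p))) \<longlonglongrightarrow> 0"
      using tendsto_mult_left[OF LIMSEQ_inverse_real_of_nat, of 2] by (simp add: inverse_eq_divide)
    have "(\<lambda>p. z p - hl s) \<longlonglongrightarrow> 0"
      by (rule Lim_null_comparison[OF _ inv0], rule always_eventually, rule allI)
        (use z(2) in \<open>simp only: norm_minus_commute\<close>)
    then have "z \<longlonglongrightarrow> hl s" by (simp add: LIM_zero_iff)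
    then show ?case using elim(2)[rule_format, of z "\<lambda>_. apply_bcontfun xl s" "apply_bcontfun xl s" "hl s"] z(1) by simp
  qed

  \<comment> \<open>The limit equation\<close>
  have "apply_bcontfun xl t = U t (G xl) + mild hl t" if t: "t \<in> {0..T}" for t
  proof -
    have t': "0 \<le> t" "t \<le> T" using t by auto
    have G_lim: "(\<lambda>n. G (x n)) \<longlonglongrightarrow> G xl"
    proof -
      have "(\<lambda>n. L * dist (x n) xl) \<longlonglongrightarrow> L * 0" using xl by (intro tendsto_intros) (simp add: tendsto_dist_iff[symmetric])
      then have L0: "(\<lambda>n. L * dist (x n) xl) \<longlonglongrightarrow> 0" by simp
      have "(\<lambda>n. G (x n) - G xl) \<longlonglongrightarrow> 0" by (rule Lim_null_comparison[OF _ L0]) (simp add: G_Lipschitz)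
      then show ?thesis by (simp add: LIM_zero_iff)
    qed
    have "(\<lambda>n. apply_bcontfun (sol (x n) (h n)) t - U t (G (x n))) \<longlonglongrightarrow> apply_bcontfun xl t - U t (G xl)"
      by (intro tendsto_intros pt[OF sol] G_lim)
    then have "(\<lambda>n. mild (h n) t) \<longlonglongrightarrow> apply_bcontfun xl t - U t (G xl)"
      using sol_apply[OF L1h] clampT_id[OF t'] by simp
    \<comment> \<open>Averaging over tails preserves the limit, and by linearity the averaged
      integrals are the integrals of \<open>hn n\<close>.\<close>
    then have "(\<lambda>n. wsum (w n) (\<lambda>i. mild (h i) t)) \<longlonglongrightarrow> apply_bcontfun xl t - U t (G xl)"
      by (rule wsum_tendsto[OF w])
    moreover have "wsum (w n) (\<lambda>i. mild (h i) t) = mild (hn n) t" for n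
      unfolding hn_def[abs_def] wsum_def by (rule mild_sum[symmetric, OF tail_weights_finite[OF w] L1h t'])
    ultimately have 1: "(\<lambda>n. mild (hn n) t) \<longlonglongrightarrow> apply_bcontfun xl t - U t (G xl)" by simp
    have "(\<lambda>n. LINT s|\<L>. norm (hn n s - hl s)) \<longlonglongrightarrow> (LINT s|\<L>. 0)"
    proof (rule integral_dominated_convergence)
      show "integrable \<L> (\<lambda>s. 2 * B s)" using B by simp
      show "(\<lambda>s. norm (hn n s - hl s)) \<in> borel_measurable \<L>" for n
        using lebesgue.L1_function_diff[OF L1hn L1hl] by (auto simp: lebesgue.L1_function_iff)
      show "AE s in \<L>. norm (norm (hn n s - hl s)) \<le> 2 * B s" for n
        using hn_bound hl_bound
      proof eventually_elim
        case (elim s)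
        have "norm (hn n s - hl s) \<le> 2 * B s"
          using norm_triangle_ineq4[of "hn n s" "hl s"] elim(1)[rule_format, of n] elim(2) by linarith
        then show ?case by simp
      qed
      show "AE s in \<L>. (\<lambda>n. norm (hn n s - hl s)) \<longlonglongrightarrow> 0"
        using lim
      proof eventually_elim
        case (elim s)
        show ?case using tendsto_norm[OF tendsto_diff[OF elim tendsto_const[of "hl s"]]] by simp
      qed
    qed simp
    then have "(\<lambda>n. M * (LINT s|\<L>. norm (hn n s - hl s))) \<longlonglongrightarrow> M * 0" by (intro tendsto_intros) simp
    then have M0: "(\<lambda>n. M * (LINT s|\<L>. norm (hn n s - hl s))) \<longlonglongrightarrow> 0" by simp
    have "norm (mild (hn n) t - mild hl t) \<le> M * (LINT s|\<L>. norm (hn n s - hl s))" for n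
      using lebesgue.L1_function_diff[OF L1hn[of n] L1hl]
      by (intro norm_mild_diff_le L1hn L1hl t') (auto simp: lebesgue.L1_function_iff)
    then have "(\<lambda>n. mild (hn n) t - mild hl t) \<longlonglongrightarrow> 0"
      by (intro Lim_null_comparison[OF _ M0]) auto
    then have "(\<lambda>n. mild (hn n) t) \<longlonglongrightarrow> mild hl t" by (simp add: LIM_zero_iff)
    from LIMSEQ_unique[OF 1 this] show ?thesis by (simp add: algebra_simps)
  qed
  with L1hl hl_F show ?thesis by blast
qed

end

section \<open>Mild solutions\<close>

text \<open>This links the integral of the kernel extended by 0, over [0, T], with the integral over
  [0, t] in the definition of a mild solution.\<close>

lemma (in finite_complete_measure) has_strong_bochner_integral_restrict_space:
  fixes \<phi> :: "'a \<Rightarrow> 'b::banach"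
  assumes \<Omega>: "\<Omega> \<in> sets M" and int: "has_strong_bochner_integral M (\<lambda>x. indicator \<Omega> x *\<^sub>R \<phi> x) v"
  shows "has_strong_bochner_integral (restrict_space M \<Omega>) \<phi> v"
proof -
  let ?h = "\<lambda>x. indicator \<Omega> x *\<^sub>R \<phi> x"
  have \<Omega>': "\<Omega> \<inter> space M \<in> sets M" using \<Omega> by simp
  obtain s where sm: "strongly_measurable M ?h" and s: "\<And>i. simple_vector_integrable M (s i)"
    and lim: "(\<lambda>i. \<integral>\<^sup>+x. ennreal (norm (?h x - s i x)) \<partial>M) \<longlonglongrightarrow> 0"
    and v: "(\<lambda>i. simple_vector_integral M (s i)) \<longlonglongrightarrow> v"
    using int unfolding has_strong_bochner_integral_def by blast
  have sf: "simple_function M (s i)" for i using s[of i] by (auto elim: simple_bochner_integrable.cases)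
  have ind_sf: "simple_function M (indicator \<Omega> :: 'a \<Rightarrow> real)" using \<Omega> by simp
  \<comment> \<open>Multiplication by the indicator makes the simple functions vanish outside
    \<Omega>, so that their integrals over both measure spaces agree.\<close>
  define t where "t i x = (indicator \<Omega> x :: real) *\<^sub>R s i x" for i x
  have tf: "simple_function M (t i)" for i
    unfolding t_def by (rule simple_function_compose2[OF ind_sf sf])
  have le: "norm (?h x - t i x) \<le> norm (?h x - s i x)" for i x
    by (cases "x \<in> \<Omega>") (simp_all add: t_def)
  have t_lim: "(\<lambda>i. \<integral>\<^sup>+x. ennreal (norm (?h x - t i x)) \<partial>M) \<longlonglongrightarrow> 0"
  proof (rule tendsto_sandwich[OF _ _ tendsto_const lim])
    show "\<forall>\<^sub>F i in sequentially. (\<integral>\<^sup>+x. ennreal (norm (?h x - t i x)) \<partial>M) \<le> (\<integral>\<^sup>+x. ennreal (norm (?h x - s i x)) \<partial>M)"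
      by (intro always_eventually allI nn_integral_mono ennreal_leI le)
  qed simp
  have t_v: "(\<lambda>i. simple_vector_integral M (t i)) \<longlonglongrightarrow> v"
  proof -
    have "(\<lambda>i. (\<integral>\<^sup>+x. ennreal (norm (?h x - t i x)) \<partial>M) + (\<integral>\<^sup>+x. ennreal (norm (?h x - s i x)) \<partial>M)) \<longlonglongrightarrow> 0 + 0"
      by (rule tendsto_add[OF t_lim lim])
    then have sum0: "(\<lambda>i. (\<integral>\<^sup>+x. ennreal (norm (?h x - t i x)) \<partial>M) + (\<integral>\<^sup>+x. ennreal (norm (?h x - s i x)) \<partial>M)) \<longlonglongrightarrow> 0"
      unfolding add_0 .
    have "(\<lambda>i. ennreal (norm (simple_vector_integral M (t i) - simple_vector_integral M (s i)))) \<longlonglongrightarrow> 0"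
      by (rule tendsto_sandwich[OF _ _ tendsto_const sum0])
        (intro always_eventually allI zero_le norm_simple_bochner_integral_diff_le[OF sm tf sf])+
    then have "(\<lambda>i. norm (simple_vector_integral M (t i) - simple_vector_integral M (s i))) \<longlonglongrightarrow> 0"
      by (subst (asm) ennreal_0[symmetric], subst (asm) tendsto_ennreal_iff) auto
    then have "(\<lambda>i. simple_vector_integral M (t i) - simple_vector_integral M (s i)) \<longlonglongrightarrow> 0"
      by (rule tendsto_norm_zero_cancel)
    from tendsto_add[OF this v] show ?thesis by simp
  qed
  have ind_t: "(\<lambda>x. indicator \<Omega> x *\<^sub>R t i x) = t i" for i
    by (auto simp: t_def indicator_def)
  have rsf: "simple_function (restrict_space M \<Omega>) (t i)" for i
    using simple_function_restrict_space[OF \<Omega>', of "t i"] ind_t tf by simp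
  have rsb: "simple_vector_integrable (restrict_space M \<Omega>) (t i)" for i
    using simple_bochner_integrable_restrict_space[OF \<Omega>', of "t i"] ind_t simple_bochner_integrableI[OF tf] by simp
  have "strongly_measurable (restrict_space M \<Omega>) \<phi>"
  proof -
    obtain s' where s': "\<And>i. simple_function M (s' i)" "AE x in M. (\<lambda>i. s' i x) \<longlonglongrightarrow> ?h x"
      using sm unfolding strongly_measurable_def by blast
    have "simple_function (restrict_space M \<Omega>) (s' i)" for i
      using simple_function_restrict_space[OF \<Omega>', of "s' i"] simple_function_compose2[OF ind_sf s'(1), of scaleR i] by simp
    moreover have "AE x in restrict_space M \<Omega>. (\<lambda>i. s' i x) \<longlonglongrightarrow> \<phi> x"
      unfolding AE_restrict_space_iff[OF \<Omega>'] using s'(2) by eventually_elim auto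
    ultimately show ?thesis unfolding strongly_measurable_def by blast
  qed
  moreover have "(\<lambda>i. \<integral>\<^sup>+x. ennreal (norm (\<phi> x - t i x)) \<partial>restrict_space M \<Omega>) \<longlonglongrightarrow> 0"
  proof -
    have "(\<integral>\<^sup>+x. ennreal (norm (\<phi> x - t i x)) \<partial>restrict_space M \<Omega>) = (\<integral>\<^sup>+x. ennreal (norm (?h x - t i x)) \<partial>M)" for i
      unfolding nn_integral_restrict_space[OF \<Omega>']
      by (intro nn_integral_cong) (auto simp: t_def indicator_def)
    then show ?thesis using t_lim by simp
  qed
  moreover have "(\<lambda>i. simple_vector_integral (restrict_space M \<Omega>) (t i)) \<longlonglongrightarrow> v"
    using simple_bochner_integral_restrict_space[OF \<Omega>' rsb] ind_t t_v by simp
  ultimately show ?thesis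
    unfolding has_strong_bochner_integral_def using rsb by blast
qed

lemma (in semigroup_on_interval) mild_has_integral:
  assumes h: "L1_function (lebesgue_on {0..T}) h" and t: "t \<in> {0..T}"
  shows "has_strong_bochner_integral (lebesgue_on {0..t}) (\<lambda>s. U (t - s) (h s)) (mild h t)"
proof -
  have sets: "{0..t} \<in> sets (lebesgue_on {0..T})" using t by (subst sets_restrict_space_iff) auto
  have L1: "L1_function (lebesgue_on {0..T}) (kernel h t)" using h t by (intro kernel_L1) auto
  have eq: "AE s in lebesgue_on {0..T}. kernel h t s = indicator {0..t} s *\<^sub>R U (t - s) (h s)"
    by (rule AE_I2) (auto simp: kernel_def indicator_def)
  have "has_strong_bochner_integral (lebesgue_on {0..T}) (\<lambda>s. indicator {0..t} s *\<^sub>R U (t - s) (h s)) (mild h t)"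
    using lebesgue.has_strong_bochner_integral_bochner_integral[OF lebesgue.bochner_integral_AE_eq(1)[OF L1 eq]]
      lebesgue.bochner_integral_AE_eq(2)[OF L1 eq] by (simp add: mild_def)
  from lebesgue.has_strong_bochner_integral_restrict_space[OF sets this]
  have "has_strong_bochner_integral (restrict_space (lebesgue_on {0..T}) {0..t}) (\<lambda>s. U (t - s) (h s)) (mild h t)" .
  moreover have "restrict_space (lebesgue_on {0..T}) {0..t} = lebesgue_on {0..t}"
    using t by (subst restrict_restrict_space) (auto simp: Int_absorb1)
  ultimately show ?thesis by simp
qed

section \<open>Covers with centers in a fixed sequence\<close>

lemma finite_cover_by_dense_sequence:
  fixes y :: "nat \<Rightarrow> 'b::metric_space"
  assumes B: "finite B" "B \<subseteq> closure (range y)" and A: "A \<subseteq> (\<Union>b\<in>B. ball b \<sigma>)" and "\<sigma> < \<rho>"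
  shows "\<exists>m. A \<subseteq> (\<Union>j\<le>m. ball (y j) \<rho>)"
proof -
  have "\<exists>j. dist (y j) b < \<rho> - \<sigma>" if b: "b \<in> B" for b
  proof -
    have "b \<in> closure (range y)" using B(2) b by blast
    moreover have "0 < \<rho> - \<sigma>" using \<open>\<sigma> < \<rho>\<close> by simp
    ultimately obtain z where "z \<in> range y" "dist z b < \<rho> - \<sigma>" unfolding closure_approachable by blast
    then show ?thesis by blast
  qed
  then obtain n where n: "\<And>b. b \<in> B \<Longrightarrow> dist (y (n b)) b < \<rho> - \<sigma>" by metis
  obtain m where m: "\<And>b. b \<in> B \<Longrightarrow> n b \<le> m"
    using finite_imageI[OF B(1), of n] by (metis finite_nat_set_iff_bounded_le image_eqI)
  have "A \<subseteq> (\<Union>j\<le>m. ball (y j) \<rho>)"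
  proof
    fix a assume "a \<in> A"
    then obtain b where b: "b \<in> B" "dist b a < \<sigma>" using A by auto
    have "dist (y (n b)) a < \<rho>" using n[OF b(1)] b(2) dist_triangle[of "y (n b)" a b] by linarith
    then show "a \<in> (\<Union>j\<le>m. ball (y j) \<rho>)" using m[OF b(1)] by auto
  qed
  then show ?thesis by blast
qed

text \<open>The projection moves the centers into a separable subspace; it fixes the covered points
  and has norm one, so no distance to them increases. A dense sequence of the subspace then replaces
  the centers at arbitrarily small cost.\<close>

lemma property_S_cover:
  fixes C :: "'e::banach set"
  assumes S: "property_S TYPE('e)" and C: "countable C"
  shows "\<exists>y::nat \<Rightarrow> 'e. \<forall>A \<rho> \<rho>'. A \<subseteq> closure C \<longrightarrow> ball_cover A \<rho> \<longrightarrow> 1 * \<rho> < \<rho>' \<longrightarrow>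
    (\<exists>m. A \<subseteq> (\<Union>j\<le>m. ball (y j) \<rho>'))"
proof -
  \<comment> \<open>\<open>property_S\<close> speaks of subspaces, so the countable set is first
    enlarged until its closure is one.\<close>
  define ops where "ops l = insert 0 C \<union> range (\<lambda>q. real_of_rat q *\<^sub>R (l ! 0) + l ! 1)" for l :: "'e list"
  have "countable (ops l)" for l unfolding ops_def using C by auto
  then obtain D where D: "countable D" "\<And>l. set l \<subseteq> D \<Longrightarrow> ops l \<subseteq> D"
    using countable_closure_exists[of ops] by blast
  have D0: "insert 0 C \<subseteq> D" using D(2)[of "[]"] by (auto simp: ops_def)
  have sub: "subspace (closure D)"
  proof (rule subspace_closure_rational_combinations)
    show "real_of_rat q *\<^sub>R a + b \<in> D" if "a \<in> D" "b \<in> D" for q a b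
      using D(2)[of "[a, b]"] that by (auto simp: ops_def)
  qed (use D0 in auto)
  have "separable_space (top_of_set (closure D))"
    unfolding separable_space_def
    using D(1) closure_subset[of D]
    by (intro exI[of _ D]) (auto simp: closure_of_subtopology Int_absorb1)
  then obtain Y and P :: "'e \<Rightarrow>\<^sub>L 'e" where Y: "separable_space (top_of_set Y)" "closure D \<subseteq> Y"
    and P: "range P \<subseteq> Y" "\<And>z. z \<in> Y \<Longrightarrow> P z = z" "norm P = 1"
    using S sub unfolding property_S_def by blast
  obtain E where E: "countable E" "E \<subseteq> Y" "top_of_set Y closure_of E = Y"
    using Y(1) unfolding separable_space_def by auto
  have "Y \<subseteq> closure E" using E(2,3) by (auto simp: closure_of_subtopology Int_absorb1)
  define y where "y = from_nat_into (insert 0 E)"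
  have range_y: "range y = insert 0 E" unfolding y_def using E(1) by (intro range_from_nat_into) auto
  have Y_cl: "Y \<subseteq> closure (range y)" using \<open>Y \<subseteq> closure E\<close> closure_mono[of E "range y"] range_y by auto
  have "\<exists>m. A \<subseteq> (\<Union>j\<le>m. ball (y j) \<rho>')" if A: "A \<subseteq> closure C" "ball_cover A \<rho>" "1 * \<rho> < \<rho>'" for A \<rho> \<rho>'
  proof -
    obtain B where B: "finite B" "A \<subseteq> (\<Union>b\<in>B. ball b \<rho>)" using A(2) by (rule ball_coverE)
    show ?thesis
    proof (rule finite_cover_by_dense_sequence[of "blinfun_apply P ` B"])
      show "blinfun_apply P ` B \<subseteq> closure (range y)" using P(1) Y_cl by blast
      show "A \<subseteq> (\<Union>b\<in>blinfun_apply P ` B. ball b \<rho>)"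
      proof
        fix a assume "a \<in> A"
        then obtain b where b: "b \<in> B" "dist b a < \<rho>" using B by auto
        have "C \<subseteq> D" using D0 by simp
        then have "a \<in> Y" using \<open>a \<in> A\<close> A(1) closure_mono[of C D] Y(2) by blast
        then have "dist (P b) a = norm (P (b - a))" by (simp add: dist_norm blinfun.diff_right P(2))
        also have "\<dots> \<le> dist b a" using norm_blinfun[of P "b - a"] P(3) by (simp add: dist_norm)
        finally have "dist (P b) a < \<rho>" using b(2) by simp
        then show "a \<in> (\<Union>b\<in>blinfun_apply P ` B. ball b \<rho>)" using b(1) by auto
      qed
    qed (use B A in auto)
  qed
  then show ?thesis by blast
qed

text \<open>Centers chosen in the covered set automatically lie in the closure of \<open>C\<close>;
  this is the origin of the factor 2.\<close>

lemma separable_cover: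
  fixes C :: "'e::banach set"
  assumes C: "countable C"
  shows "\<exists>y::nat \<Rightarrow> 'e. \<forall>A \<rho> \<rho>'. A \<subseteq> closure C \<longrightarrow> ball_cover A \<rho> \<longrightarrow> 2 * \<rho> < \<rho>' \<longrightarrow>
    (\<exists>m. A \<subseteq> (\<Union>j\<le>m. ball (y j) \<rho>'))"
proof -
  define y where "y = from_nat_into (insert 0 C)"
  have range_y: "range y = insert 0 C" unfolding y_def using C by (intro range_from_nat_into) auto
  have "\<exists>m. A \<subseteq> (\<Union>j\<le>m. ball (y j) \<rho>')" if A: "A \<subseteq> closure C" "ball_cover A \<rho>" "2 * \<rho> < \<rho>'" for A \<rho> \<rho>'
  proof -
    obtain B where B: "finite B" "B \<subseteq> A" "A \<subseteq> (\<Union>b\<in>B. ball b (2 * \<rho>))"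
      using A(2) by (rule ball_cover_centers_in)
    have "closure C \<subseteq> closure (range y)" unfolding range_y by (intro closure_mono) auto
    then show ?thesis
      using B A by (intro finite_cover_by_dense_sequence[OF B(1) _ B(3)]) auto
  qed
  then show ?thesis by blast
qed

lemma (in nonlocal_inclusion) mild_solution_exists:
  "\<exists>xl hl. L1_function (lebesgue_on {0..T}) hl \<and> (AE t in lebesgue_on {0..T}. hl t \<in> F t (apply_bcontfun xl t)) \<and>
     (\<forall>t\<in>{0..T}. apply_bcontfun xl t = U t (G xl) + mild hl t)"
proof -
  obtain d :: "nat \<Rightarrow> 'e" and f :: "nat \<Rightarrow> real \<Rightarrow> 'e" where d:
    "subspace (closure (range d))"
    "\<And>t x. 0 \<le> t \<Longrightarrow> t \<le> T \<Longrightarrow> x \<in> closure (range d) \<Longrightarrow> U t x \<in> closure (range d)"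
    "\<And>x. (\<And>t. t \<in> {0..T} \<Longrightarrow> apply_bcontfun x t \<in> closure (range d)) \<Longrightarrow> G x \<in> closure (range d)"
    "\<And>j. strongly_measurable (lebesgue_on {0..T}) (f j)"
    "\<And>j t. t \<in> {0..T} \<Longrightarrow> f j t \<in> F t (d j)"
    "\<And>j. AE t in lebesgue_on {0..T}. f j t \<in> closure (range d)"
    by (rule separable_reduction) blast
  obtain y :: "nat \<Rightarrow> 'e" where y: "\<forall>A \<rho> \<rho>'. A \<subseteq> closure (range d) \<longrightarrow> ball_cover A \<rho> \<longrightarrow> \<kappa> * \<rho> < \<rho>' \<longrightarrow>
        (\<exists>m. A \<subseteq> (\<Union>j\<le>m. ball (y j) \<rho>'))"
    using \<kappa>(2)[of "range d"] by auto
  define E where "E = exp (M * (LINT t|lebesgue_on {0..T}. \<mu> t))"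
  define c where "c = 1 + M * (L * r + norm (G 0))"
  define \<epsilon>\<^sub>0 where "\<epsilon>\<^sub>0 = (1 + r - c * E) / E"
  have E: "E > 0" by (simp add: E_def)
  \<comment> \<open>Strictness makes \<open>\<epsilon>\<^sub>0\<close> positive; it is defined as
    the solution of \<open>(c + \<epsilon>\<^sub>0) * E = 1 + r\<close>.\<close>
  have "c * E < 1 + r" using growth by (simp add: c_def E_def)
  then have \<epsilon>: "\<epsilon>\<^sub>0 > 0" using E by (simp add: \<epsilon>\<^sub>0_def)
  have "(c + \<epsilon>\<^sub>0) * E = 1 + r" using E by (simp add: \<epsilon>\<^sub>0_def distrib_right)
  moreover have "1 + \<epsilon>\<^sub>0 + M * (L * r + norm (G 0)) = c + \<epsilon>\<^sub>0" by (simp add: c_def)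
  ultimately have \<epsilon>': "(1 + \<epsilon>\<^sub>0 + M * (L * r + norm (G 0))) * E \<le> 1 + \<epsilon>\<^sub>0 + r"
    using \<epsilon> by (simp only:)
  interpret reduced_inclusion U T M F G \<mu> \<eta> L k r \<kappa> d f "closure (range d)" y \<epsilon>\<^sub>0
    by unfold_locales (use d y \<epsilon> \<epsilon>' in \<open>auto simp: E_def\<close>)
  show ?thesis by (rule solution_exists)
qed

lemma restrict_mem_C_space:
  fixes x :: "real \<Rightarrow> 'e::banach"
  assumes "continuous_on {0..T} x"
  shows "restrict x {0..T} \<in> mspace (C_space T)"
proof -
  have "continuous_on {0..T} (restrict x {0..T})"
    using assms by (rule continuous_on_eq) simp
  then show ?thesis
    by (subst compactin_mspace_cfunspace) (auto simp: compactin_subtopology)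
qed

lemma mdist_C_space_restrict_le:
  fixes x y :: "real \<Rightarrow>\<^sub>C 'e::banach"
  shows "mdist (C_space T) (restrict x {0..T}) (restrict y {0..T}) \<le> dist x y"
  by (rule mdist_cfunspace_le) (auto simp: dist_bounded)

theorem theorem8:
  fixes T :: real
    and D :: "'e::banach set" and A :: "'e \<Rightarrow> 'e" and U :: "real \<Rightarrow> 'e \<Rightarrow>\<^sub>L 'e"
    and F :: "real \<Rightarrow> 'e \<Rightarrow> 'e set" and g :: "(real \<Rightarrow> 'e) \<Rightarrow> 'e"
    and \<mu> \<eta> :: "real \<Rightarrow> real" and M L k r :: real
  assumes "T > 0"
    and "closed_densely_defined_operator D A"
    and "C0_semigroup U"
    and "infinitesimal_generator U D A"
    and "M = (SUP t\<in>{0..T}. norm (U t))"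
    and F1: "\<forall>t\<in>{0..T}. \<forall>x. F t x \<noteq> {} \<and> convex (F t x)"
    and F2: "\<forall>x. \<exists>f. strongly_measurable (lebesgue_on {0..T}) f \<and> (\<forall>t\<in>{0..T}. f t \<in> F t x)"
    and F3: "AE t in lebesgue_on {0..T}.
               sequentially_closedin (prod_topology euclidean weak_topology) {(x, y). y \<in> F t x}"
    and F4: "integrable (lebesgue_on {0..T}) \<mu>"
            "\<forall>x. AE t in lebesgue_on {0..T}.
               (SUP y\<in>F t x. ereal (norm y)) \<le> ereal (\<mu> t * (1 + norm x))"
    and F5: "integrable (lebesgue_on {0..T}) \<eta>"
            "\<forall>\<Omega>. bounded \<Omega> \<longrightarrow> (AE t in lebesgue_on {0..T}.
               hausdorff_mnc (\<Union>x\<in>\<Omega>. F t x) \<le> ereal (\<eta> t) * hausdorff_mnc \<Omega>)"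
    and g_Lipschitz: "L \<ge> 0"
            "\<forall>x\<in>mspace (C_space T). \<forall>y\<in>mspace (C_space T).
               norm (g x - g y) \<le> L * mdist (C_space T) x y"
    and g_mnc: "k > 0"
            "\<forall>\<Omega>. Metric_space.mbounded (mspace (C_space T)) (mdist (C_space T)) \<Omega> \<longrightarrow>
               hausdorff_mnc (g ` \<Omega>) \<le> ereal k * (SUP t\<in>{0..T}. hausdorff_mnc ((\<lambda>x. x t) ` \<Omega>))"
    and "r > 0"
    and "0 < (LINT t|lebesgue_on {0..T}. \<bar>\<mu> t\<bar>)"
    and "(LINT t|lebesgue_on {0..T}. \<bar>\<mu> t\<bar>)
           < inverse M * ln ((1 + r) / (1 + M * (L * r + norm (g (\<lambda>t\<in>{0..T}. 0)))))"
    and cases: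
      "M * (k + (LINT t|lebesgue_on {0..T}. \<bar>\<eta> t\<bar>)) < 1 \<and> property_S TYPE('e) \<or>
       M * (k + 4 * (LINT t|lebesgue_on {0..T}. \<bar>\<eta> t\<bar>)) < 1"
  shows "\<exists>x. mild_solution T U F g x"
proof -
  note T_pos = assms(1) and C0 = assms(3) and M = assms(5) and r_pos = assms(17) and \<mu>_pos = assms(18) and \<mu>_less = assms(19)
  let ?L = "lebesgue_on {0..T}"
  have norm_U: "norm (U t) \<le> M" if "0 \<le> t" "t \<le> T" for t
    unfolding M using that by (intro cSUP_upper C0_semigroup_bdd[OF C0]) auto
  have "M \<ge> 0" using norm_U[of 0] T_pos norm_ge_zero[of "U 0"] by linarith
  \<comment> \<open>For M = 0 the convention \<open>inverse 0 = 0\<close> would make the upper bound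
    for the integral of |\<mu>| equal to 0, against its positivity.\<close>
  moreover have "M \<noteq> 0" using \<mu>_pos \<mu>_less by auto
  ultimately have M_pos: "M > 0" by simp
  interpret semigroup_on_interval U T M
    using T_pos C0 norm_U M_pos by unfold_locales auto
  define G where "G x = g (restrict (apply_bcontfun x) {0..T})" for x :: "real \<Rightarrow>\<^sub>C 'e"
  have mem: "restrict (apply_bcontfun x) {0..T} \<in> mspace (C_space T)" for x :: "real \<Rightarrow>\<^sub>C 'e"
    by (rule restrict_mem_C_space) simp
  have G0: "G 0 = g (\<lambda>t\<in>{0..T}. 0)"
    unfolding G_def by (rule arg_cong[where f = g]) (simp add: fun_eq_iff)
  obtain \<kappa> :: real where \<kappa>: "\<kappa> \<ge> 1" "M * (k + \<kappa> * (LINT t|?L. \<bar>\<eta> t\<bar>)) < 1"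
    and cover: "\<And>C. countable C \<Longrightarrow> \<exists>y::nat \<Rightarrow> 'e. \<forall>A \<rho> \<rho>'. A \<subseteq> closure C \<longrightarrow> ball_cover A \<rho> \<longrightarrow> \<kappa> * \<rho> < \<rho>' \<longrightarrow>
        (\<exists>m. A \<subseteq> (\<Union>j\<le>m. ball (y j) \<rho>'))"
  proof (cases "M * (k + (LINT t|?L. \<bar>\<eta> t\<bar>)) < 1 \<and> property_S TYPE('e)")
    case True
    show thesis
    proof (rule that[of 1])
      show "M * (k + 1 * (LINT t|?L. \<bar>\<eta> t\<bar>)) < 1" using True by simp
      show "\<exists>y::nat \<Rightarrow> 'e. \<forall>A \<rho> \<rho>'. A \<subseteq> closure C \<longrightarrow> ball_cover A \<rho> \<longrightarrow> 1 * \<rho> < \<rho>' \<longrightarrow>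
          (\<exists>m. A \<subseteq> (\<Union>j\<le>m. ball (y j) \<rho>'))" if "countable C" for C :: "'e set"
        using True that by (intro property_S_cover) auto
    qed simp
  next
    case False
    then have "M * (k + 4 * (LINT t|?L. \<bar>\<eta> t\<bar>)) < 1" using cases by blast
    \<comment> \<open>Centers in the covered set give the factor 2, and the condition with the
      factor 4 implies the one with 2 because the integral of |\<eta>| is nonnegative.\<close>
    moreover have "M * (k + 2 * (LINT t|?L. \<bar>\<eta> t\<bar>)) \<le> M * (k + 4 * (LINT t|?L. \<bar>\<eta> t\<bar>))"
      using M_pos by (intro mult_left_mono) auto
    ultimately have 2: "M * (k + 2 * (LINT t|?L. \<bar>\<eta> t\<bar>)) < 1" by simp
    show thesis by (rule that[of 2, OF _ 2 separable_cover]) simp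
  qed
  \<comment> \<open>Absolute values provide the nonnegativity that the locale asks for; the
    pointwise bounds on \<open>F\<close> only become weaker, and the integral conditions are stated
    for |\<mu>| and |\<eta>| already.\<close>
  interpret nonlocal_inclusion U T M F G "\<lambda>t. \<bar>\<mu> t\<bar>" "\<lambda>t. \<bar>\<eta> t\<bar>" L k r \<kappa>
  proof
    show "convex (F t x)" if "t \<in> {0..T}" for t x using F1 that by blast
    show "\<exists>f. strongly_measurable ?L f \<and> (\<forall>t\<in>{0..T}. f t \<in> F t x)" for x using F2 by blast
    show "AE t in ?L. \<forall>xs ys x y. (\<forall>n. ys n \<in> F t (xs n)) \<longrightarrow> xs \<longlonglongrightarrow> x \<longrightarrow> ys \<longlonglongrightarrow> y \<longrightarrow> y \<in> F t x"
      using F3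
    proof eventually_elim
      case (elim t)
      show ?case
      proof (intro allI impI)
        fix xs ys x y assume ys: "\<forall>n. ys n \<in> F t (xs n)" and lim: "xs \<longlonglongrightarrow> x" "ys \<longlonglongrightarrow> y"
        have "limitin weak_topology ys y sequentially"
          unfolding limitin_weak_topology using lim(2) by (auto intro: tendsto_intros)
        then have "limitin (prod_topology euclidean weak_topology) (\<lambda>n. (xs n, ys n)) (x, y) sequentially"
          using lim(1) by (simp add: limitin_pairwise comp_def)
        then have "(x, y) \<in> {(x, y). y \<in> F t x}"
          using elim[unfolded sequentially_closedin_def, THEN conjunct2, rule_format, of "\<lambda>n. (xs n, ys n)" "(x, y)"] ys
          by simp
        then show "y \<in> F t x" by simp
      qed
    qed
    show "integrable ?L (\<lambda>t. \<bar>\<mu> t\<bar>)" "integrable ?L (\<lambda>t. \<bar>\<eta> t\<bar>)" using F4(1) F5(1) by auto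
    show "AE t in ?L. \<forall>y\<in>F t x. norm y \<le> \<bar>\<mu> t\<bar> * (1 + norm x)" for x
      using F4(2)[rule_format, of x]
    proof eventually_elim
      case (elim t)
      show ?case
      proof
        fix y assume "y \<in> F t x"
        then have "ereal (norm y) \<le> (SUP y\<in>F t x. ereal (norm y))" by (intro SUP_upper)
        also note elim
        finally have "norm y \<le> \<mu> t * (1 + norm x)" by simp
        also have "\<dots> \<le> \<bar>\<mu> t\<bar> * (1 + norm x)" by (intro mult_right_mono) auto
        finally show "norm y \<le> \<bar>\<mu> t\<bar> * (1 + norm x)" .
      qed
    qed
    show "AE t in ?L. \<forall>\<delta>>0. ball_cover (\<Union>x\<in>\<Omega>. F t x) (\<bar>\<eta> t\<bar> * \<rho> + \<delta>)"
      if \<Omega>: "bounded \<Omega>" "\<rho> > 0" "ball_cover \<Omega> \<rho>" for \<Omega> \<rho>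
      using F5(2)[rule_format, OF \<Omega>(1)]
    proof eventually_elim
      case (elim t)
      have nn: "0 \<le> hausdorff_mnc \<Omega>" unfolding hausdorff_mnc_def by (intro Inf_greatest) auto
      have "hausdorff_mnc \<Omega> \<le> ereal \<rho>" by (rule ball_cover_imp_hausdorff_mnc[OF \<Omega>(3,2)])
      then have "ereal \<bar>\<eta> t\<bar> * hausdorff_mnc \<Omega> \<le> ereal \<bar>\<eta> t\<bar> * ereal \<rho>" by (intro ereal_mult_left_mono) auto
      moreover have "ereal (\<eta> t) * hausdorff_mnc \<Omega> \<le> ereal \<bar>\<eta> t\<bar> * hausdorff_mnc \<Omega>"
        using nn by (intro ereal_mult_right_mono) auto
      ultimately have "hausdorff_mnc (\<Union>x\<in>\<Omega>. F t x) \<le> ereal (\<bar>\<eta> t\<bar> * \<rho>)" using elim by (auto intro: order_trans)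
      then show ?case by (auto intro: hausdorff_mnc_imp_ball_cover)
    qed
    show "G x = G y" if "\<And>t. t \<in> {0..T} \<Longrightarrow> apply_bcontfun x t = apply_bcontfun y t" for x y
    proof -
      have "restrict (apply_bcontfun x) {0..T} = restrict (apply_bcontfun y) {0..T}"
        using that by (intro restrict_ext)
      then show ?thesis by (simp only: G_def)
    qed
    show "norm (G x - G y) \<le> L * dist x y" for x y
    proof -
      have "norm (G x - G y) \<le> L * mdist (C_space T) (restrict x {0..T}) (restrict y {0..T})"
        unfolding G_def using g_Lipschitz(2) mem by blast
      also have "\<dots> \<le> L * dist x y" using g_Lipschitz(1) by (intro mult_left_mono mdist_C_space_restrict_le)
      finally show ?thesis .
    qed
    show "ball_cover (G ` \<Omega>) (k * \<rho> + \<delta>)" if \<Omega>: "bounded \<Omega>" "\<rho> > 0" "ball_cover \<Omega> \<rho>" "\<delta> > 0" for \<Omega> \<rho> \<delta>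
    proof -
      define R where "R = (\<lambda>x. restrict (apply_bcontfun x) {0..T}) ` \<Omega>"
      obtain B where B: "\<And>x y. x \<in> \<Omega> \<Longrightarrow> y \<in> \<Omega> \<Longrightarrow> dist x y \<le> B"
        using \<Omega>(1) unfolding bounded_two_points by blast
      have "Metric_space.mbounded (mspace (C_space T)) (mdist (C_space T)) R"
        unfolding Metric_space.mbounded_alt[OF Metric_space_mspace_mdist]
      proof (intro conjI exI ballI)
        show "R \<subseteq> mspace (C_space T)" unfolding R_def using mem by blast
        show "mdist (C_space T) u v \<le> B" if "u \<in> R" "v \<in> R" for u v
          using that B mdist_C_space_restrict_le order_trans unfolding R_def by blast
      qed
      then have "hausdorff_mnc (g ` R) \<le> ereal k * (SUP t\<in>{0..T}. hausdorff_mnc ((\<lambda>x. x t) ` R))"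
        using g_mnc(2) by blast
      also have "\<dots> \<le> ereal k * ereal \<rho>"
      proof (intro ereal_mult_left_mono SUP_least ball_cover_imp_hausdorff_mnc)
        fix t assume t: "t \<in> {0..T}"
        obtain C where C: "finite C" "\<Omega> \<subseteq> (\<Union>c\<in>C. ball c \<rho>)" using \<Omega>(3) by (rule ball_coverE)
        show "ball_cover ((\<lambda>x. x t) ` R) \<rho>"
        proof (rule ball_coverI[of "(\<lambda>c. apply_bcontfun c t) ` C"])
          show "(\<lambda>x. x t) ` R \<subseteq> (\<Union>c\<in>(\<lambda>c. apply_bcontfun c t) ` C. ball c \<rho>)"
          proof
            fix v assume "v \<in> (\<lambda>x. x t) ` R"
            then obtain x where x: "x \<in> \<Omega>" "v = apply_bcontfun x t" using t by (auto simp: R_def)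
            then obtain c where "c \<in> C" "dist c x < \<rho>" using C(2) by auto
            then show "v \<in> (\<Union>c\<in>(\<lambda>c. apply_bcontfun c t) ` C. ball c \<rho>)"
              using dist_fun_lt_imp_dist_val_lt[of c x \<rho> t] x(2) by auto
          qed
        qed (use C in simp)
      qed (use \<Omega> g_mnc in auto)
      also have "ereal k * ereal \<rho> = ereal (k * \<rho>)" by simp
      finally have "ball_cover (g ` R) (k * \<rho> + \<delta>)" by (rule hausdorff_mnc_imp_ball_cover) (use \<Omega> in simp)
      moreover have "g ` R = G ` \<Omega>" by (auto simp: R_def G_def)
      ultimately show ?thesis by simp
    qed
    show "(1 + M * (L * r + norm (G 0))) * exp (M * (LINT t|?L. \<bar>\<mu> t\<bar>)) < 1 + r"
    proof -
      define c where "c = 1 + M * (L * r + norm (G 0))"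
      have c: "c > 0" using M_pos g_Lipschitz(1) r_pos by (simp add: c_def add_pos_nonneg)
      have "M * (LINT t|?L. \<bar>\<mu> t\<bar>) < M * (inverse M * ln ((1 + r) / c))"
        using \<mu>_less M_pos by (intro mult_strict_left_mono) (auto simp: c_def G0)
      moreover have "M * (inverse M * ln ((1 + r) / c)) = ln ((1 + r) / c)" using M_pos by simp
      ultimately have "M * (LINT t|?L. \<bar>\<mu> t\<bar>) < ln ((1 + r) / c)" by (simp only:)
      then have "exp (M * (LINT t|?L. \<bar>\<mu> t\<bar>)) < exp (ln ((1 + r) / c))" by simp
      also have "\<dots> = (1 + r) / c" using c r_pos by simp
      finally have "c * exp (M * (LINT t|?L. \<bar>\<mu> t\<bar>)) < 1 + r"
        using c by (simp add: pos_less_divide_eq mult.commute)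
      then show ?thesis by (simp add: c_def)
    qed
  qed (use g_Lipschitz(1) g_mnc(1) r_pos \<kappa> cover in auto)
  obtain x h where h: "L1_function ?L h" "AE t in ?L. h t \<in> F t (apply_bcontfun x t)"
    and x: "\<And>t. t \<in> {0..T} \<Longrightarrow> apply_bcontfun x t = U t (G x) + mild h t"
    using mild_solution_exists by blast
  have "mild_solution T U F g (restrict (apply_bcontfun x) {0..T})"
    unfolding mild_solution_def
  proof (intro conjI exI[of _ h] h(1) mem ballI)
    show "AE t in ?L. h t \<in> F t (restrict (apply_bcontfun x) {0..T} t)"
      using h(2) AE_space by eventually_elim auto
    fix t assume t: "t \<in> {0..T}"
    show "\<exists>v. has_strong_bochner_integral (lebesgue_on {0..t}) (\<lambda>s. U (t - s) (h s)) v \<and>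
        restrict (apply_bcontfun x) {0..T} t = U t (g (restrict (apply_bcontfun x) {0..T})) + v"
      using mild_has_integral[OF h(1) t] x[OF t] t by (intro exI[of _ "mild h t"]) (simp add: G_def)
  qed
  then show ?thesis by blast
qed

end
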